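(* For all ordinary $\lambda$-terms $t,u$, the following are equivalent: (1) Böhm tree preorder up to $\eta$-reductions: $t \sqsubseteq_{\mathcal{B}\eta\mathrm{red}} u$; (2) polarized whiter-cheaper type improvement: $t \sqsubseteq^{\mathrm{pwc}} u$; (3) interaction improvement: $t \sqsubseteq^{\mathrm{int\cdot imp}} u$; (4) plain type preorder: $t \sqsubseteq^{\mathrm{rel}} u$.
   Context: Checkers calculus: terms $t ::= x \mid \lambda_c x.t \mid t\cdot^{c} u$ with colors $c\in\{\circ\ (\text{white}),\bullet\ (\text{black})\}$. A redex $(\lambda_c x.t)\cdot^{d}u \to t\{x:=u\}$ is silent if $c=d$ and an interaction step if $c\neq d$. Head reduction is the closure of these rules under head contexts $\lambda_{c_1}x_1\ldots\lambda_{c_n}x_n.([\cdot]\cdot^{d_1}t_1\cdots\cdot^{d_k}t_k)$; we write $t\Downarrow^k$ if $t$ head-normalizes and the (unique) head reduction sequence to its head normal form contains exactly $k$ interaction steps. Checkers contexts $C$ are arbitrary colored one-hole contexts. For an ordinary $\lambda$-term $t$, $t^\bullet$ is the checkers term obtained by painting all abstractions and applications black. Interaction improvement: $t \sqsubseteq^{\mathrm{int\cdot imp}} u$ iff for every checkers context $C$ and every $k$, $C[t^\bullet]\Downarrow^k$ implies $C[u^\bullet]\Downarrow^{k'}$ for some $k'\le k$. Colored multi types: linear types $L ::= X \mid M\to_c L$, multi types $M=[L_1,\dots,L_n]$; judgments $\Gamma\vdash^k t:L$ with rules: $x:[L]\vdash^0 x:L$; many: from $(\Gamma_i\vdash^{k_i}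 t:L_i)_{i\in I}$ infer $\uplus_i\Gamma_i\vdash^{\sum_i k_i} t:[L_i]_{i\in I}$; from $\Gamma,x:M\vdash^k t:L$ infer $\Gamma\vdash^k\lambda_c x.t: M\to_c L$; from $\Gamma\vdash^{k_1}t:M\to_c L$ and $\Delta\vdash^{k_2}u:M$ infer $\Gamma\uplus\Delta\vdash^{k}t\cdot^{d}u:L$ where $k=k_1+k_2$ if $c=d$ and $k=k_1+k_2+1$ otherwise. Interpretation $[\![t]\!]=\{(\Gamma,L,k)\mid \Gamma\vdash^k t:L \text{ derivable}\}$. Polarized whitening $\le^{p}_k$ ($p\in\{+,-\}$, $\bar p$ the opposite polarity): $X\le^p_0 X$; $M'\to_\circ L'\le^+_{k_1+k_2+1} M\to_\bullet L$ if $M'\le^-_{k_1}M$ and $L'\le^+_{k_2}L$; $M'\to_c L'\le^p_{k_1+k_2} M\to_c L$ if $M'\le^{\bar p}_{k_1}M$ and $L'\le^p_{k_2}L$; multisets pointwise with summed indices; environments pointwise; $(\Gamma',L')\le^p_{k_1+k_2}(\Gamma,L)$ if $\Gamma'\le^{\bar p}_{k_1}\Gamma$ and $L'\le^p_{k_2}L$. Polarized whiter-cheaper preorder: on checkers terms $t\sqsubseteq^{\mathrm{pwc}}u$ iff for every $(\Gamma,L,k)\in[\![t]\!]$ there exist $(\Gamma',L',k')\in[\![u]\!]$ and $d$ with $(\Gamma',L')\le^+_d(\Gamma,L)$ and $k\ge k'+d$; on $\lambda$-terms $t\sqsubseteq^{\mathrm{pwc}}u$ iff $t^\bullet\sqsubseteq^{\mathrm{pwc}}u^\bullet$.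 $\sqsubseteq_{\mathcal{B}\eta\mathrm{red}}$ is the largest relation such that $t\sqsubseteq_{\mathcal{B}\eta\mathrm{red}}u$ implies either $t$ has no head normal form, or $t$ has head normal form $\lambda x_1\dots x_{n+p}.y\,t_1\cdots t_{k+p}$ and $u$ has head normal form $\lambda x_1\dots x_n.y\,u_1\cdots u_k$ with $p\ge 0$, $y$ equally bound or free in both, $t_i\sqsubseteq_{\mathcal{B}\eta\mathrm{red}}u_i$ for $i\le k$, $t_i\sqsubseteq_{\mathcal{B}\eta\mathrm{red}}x_i$ for $k<i\le k+p$, and $x_{k+1},\dots,x_{k+p}$ not free in $y\,u_1\cdots u_k$. $\sqsubseteq^{\mathrm{rel}}$ is the inequational theory (preorder) induced by the relational graph model $\mathcal{E}$ (Hyland et al.), i.e. by the uncolored non-idempotent intersection (multi) type interpretation. *)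

theory Defs
  imports Main "HOL-Library.Multiset"
begin

section \<open>Terms\<close>

text \<open>
  De Bruijn terms whose abstractions and applications carry a colour from an arbitrary set.
  Checkers terms use two colours; an ordinary lambda-term is a term over the one-element
  colour set.
\<close>

datatype 'c tm = Var nat | Lam 'c "'c tm" | App 'c "'c tm" "'c tm"
  for map: recolor

datatype color = White | Black

type_synonym lam = "unit tm"
type_synonym checkers = "color tm"

definition paint_black :: "lam \<Rightarrow> checkers" where
  "paint_black = recolor (\<lambda>_. Black)"

primrec ren :: "(nat \<Rightarrow> nat) \<Rightarrow> 'c tm \<Rightarrow> 'c tm" where
  "ren f (Var i) = Var (f i)"
| "ren f (Lam c t) = Lam c (ren (case_nat 0 (\<lambda>i. Suc (f i))) t)"
| "ren f (App d t u) = App d (ren f t) (ren f u)"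

primrec sub :: "(nat \<Rightarrow> 'c tm) \<Rightarrow> 'c tm \<Rightarrow> 'c tm" where
  "sub s (Var i) = s i"
| "sub s (Lam c t) = Lam c (sub (case_nat (Var 0) (\<lambda>i. ren Suc (s i))) t)"
| "sub s (App d t u) = App d (sub s t) (sub s u)"

text \<open>The contractum of \<open>(\<lambda>x. t) u\<close>: replace index 0 by \<open>u\<close>, lower the other indices.\<close>

definition inst :: "'c tm \<Rightarrow> 'c tm \<Rightarrow> 'c tm" where
  "inst t u = sub (case_nat u Var) t"


section \<open>Head reduction and interaction improvement\<close>

definition mark :: "'c \<Rightarrow> 'c \<Rightarrow> nat" where
  "mark c d = (if c = d then 0 else 1)"

definition head_plug :: "'c list \<Rightarrow> ('c \<times> 'c tm) list \<Rightarrow> 'c tm \<Rightarrow> 'c tm" where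
  "head_plug cs us t = foldr Lam cs (foldl (\<lambda>s (d, u). App d s u) t us)"

inductive head_step :: "nat \<Rightarrow> 'c tm \<Rightarrow> 'c tm \<Rightarrow> bool" where
  "head_step (mark c d) (head_plug cs us (App d (Lam c t) u)) (head_plug cs us (inst t u))"

definition head_normal :: "'c tm \<Rightarrow> bool" where
  "head_normal t \<longleftrightarrow> (\<nexists>k u. head_step k t u)"

inductive head_red :: "nat \<Rightarrow> 'c tm \<Rightarrow> 'c tm \<Rightarrow> bool" where
  refl: "head_red 0 t t"
| step: "head_step k t u \<Longrightarrow> head_red l u v \<Longrightarrow> head_red (k + l) t v"

definition converges :: "'c tm \<Rightarrow> nat \<Rightarrow> bool" where
  "converges t k \<longleftrightarrow> (\<exists>h. head_red k t h \<and> head_normal h)"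

datatype 'c ctx =
    Hole
  | CLam 'c "'c ctx"
  | CAppL 'c "'c ctx" "'c tm"
  | CAppR 'c "'c tm" "'c ctx"

text \<open>Plugging does not shift indices, so that the binders of the context capture.\<close>

primrec plug :: "'c ctx \<Rightarrow> 'c tm \<Rightarrow> 'c tm" where
  "plug Hole t = t"
| "plug (CLam c C) t = Lam c (plug C t)"
| "plug (CAppL d C u) t = App d (plug C t) u"
| "plug (CAppR d u C) t = App d u (plug C t)"

definition int_imp :: "lam \<Rightarrow> lam \<Rightarrow> bool" where
  "int_imp t u \<longleftrightarrow>
    (\<forall>(C :: color ctx) k. converges (plug C (paint_black t)) k \<longrightarrow>
      (\<exists>k' \<le> k. converges (plug C (paint_black u)) k'))"


section \<open>Multi types\<close>

datatype 'c ltype = Atom nat | Arr "'c ltype multiset" 'c "'c ltype"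

text \<open>
  Environments are total functions on indices, with the empty multiset for undeclared
  variables; derivable judgements only involve finitely supported ones. \<open>case_nat M \<Gamma>\<close> is
  \<open>\<Gamma>\<close> extended with the multi type \<open>M\<close> for the variable bound by an abstraction.
\<close>

type_synonym 'c env = "nat \<Rightarrow> 'c ltype multiset"

definition env_empty :: "'c env" where
  "env_empty = (\<lambda>_. {#})"

definition env_plus :: "'c env \<Rightarrow> 'c env \<Rightarrow> 'c env" where
  "env_plus \<Gamma> \<Delta> = (\<lambda>x. \<Gamma> x + \<Delta> x)"

text \<open>\<open>many_nil\<close> and \<open>many_cons\<close> together are the finitary rule typing a term with a multiset.\<close>

inductive typing :: "color env \<Rightarrow> nat \<Rightarrow> checkers \<Rightarrow> color ltype \<Rightarrow> bool"
  and mtyping :: "color env \<Rightarrow> nat \<Rightarrow> checkers \<Rightarrow> color ltype multiset \<Rightarrow> bool"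
where
  var: "typing (env_empty(x := {#L#})) 0 (Var x) L"
| many_nil: "mtyping env_empty 0 t {#}"
| many_cons: "typing \<Gamma> k t L \<Longrightarrow> mtyping \<Delta> l t M \<Longrightarrow>
    mtyping (env_plus \<Gamma> \<Delta>) (k + l) t (add_mset L M)"
| abs: "typing (case_nat M \<Gamma>) k t L \<Longrightarrow> typing \<Gamma> k (Lam c t) (Arr M c L)"
| app: "typing \<Gamma> k t (Arr M c L) \<Longrightarrow> mtyping \<Delta> l u M \<Longrightarrow>
    typing (env_plus \<Gamma> \<Delta>) (k + l + mark c d) (App d t u) L"

definition interp :: "checkers \<Rightarrow> (color env \<times> color ltype \<times> nat) set" where
  "interp t = {(\<Gamma>, L, k). typing \<Gamma> k t L}"


section \<open>The polarized whiter-cheaper preorder\<close>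

datatype polarity = Pos | Neg

fun opp :: "polarity \<Rightarrow> polarity" where
  "opp Pos = Neg"
| "opp Neg = Pos"

text \<open>\<open>whiten p k L' L\<close> is \<open>L' \<le>\<^sup>p\<^sub>k L\<close>, and likewise for the other three predicates.\<close>

inductive whiten :: "polarity \<Rightarrow> nat \<Rightarrow> color ltype \<Rightarrow> color ltype \<Rightarrow> bool"
  and mwhiten :: "polarity \<Rightarrow> nat \<Rightarrow> color ltype multiset \<Rightarrow> color ltype multiset \<Rightarrow> bool"
where
  atom: "whiten p 0 (Atom X) (Atom X)"
| flip: "mwhiten Neg k M' M \<Longrightarrow> whiten Pos l L' L \<Longrightarrow>
    whiten Pos (k + l + 1) (Arr M' White L') (Arr M Black L)"
| keep: "mwhiten (opp p) k M' M \<Longrightarrow> whiten p l L' L \<Longrightarrow>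
    whiten p (k + l) (Arr M' c L') (Arr M c L)"
| nil: "mwhiten p 0 {#} {#}"
| cons: "whiten p k L' L \<Longrightarrow> mwhiten p l M' M \<Longrightarrow>
    mwhiten p (k + l) (add_mset L' M') (add_mset L M)"

definition env_whiten :: "polarity \<Rightarrow> nat \<Rightarrow> color env \<Rightarrow> color env \<Rightarrow> bool" where
  "env_whiten p k \<Gamma>' \<Gamma> \<longleftrightarrow>
    (\<exists>f. (\<forall>x. mwhiten p (f x) (\<Gamma>' x) (\<Gamma> x)) \<and> finite {x. f x \<noteq> 0} \<and>
      k = (\<Sum>x | f x \<noteq> 0. f x))"

definition judg_whiten ::
    "polarity \<Rightarrow> nat \<Rightarrow> color env \<times> color ltype \<Rightarrow> color env \<times> color ltype \<Rightarrow> bool" where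
  "judg_whiten p k J' J \<longleftrightarrow>
    (\<exists>k1 k2. k = k1 + k2 \<and> env_whiten (opp p) k1 (fst J') (fst J) \<and> whiten p k2 (snd J') (snd J))"

definition pwc_checkers :: "checkers \<Rightarrow> checkers \<Rightarrow> bool" where
  "pwc_checkers t u \<longleftrightarrow>
    (\<forall>(\<Gamma>, L, k) \<in> interp t. \<exists>(\<Gamma>', L', k') \<in> interp u. \<exists>d.
      judg_whiten Pos d (\<Gamma>', L') (\<Gamma>, L) \<and> k \<ge> k' + d)"

definition pwc :: "lam \<Rightarrow> lam \<Rightarrow> bool" where
  "pwc t u \<longleftrightarrow> pwc_checkers (paint_black t) (paint_black u)"


section \<open>The plain type preorder\<close>

text \<open>
  Types over the one-element colour set are the elements of the relational graph model freely
  generated by countably many atoms; the interpretation of a term in it is its set of typings.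
\<close>

inductive ptyping :: "unit env \<Rightarrow> lam \<Rightarrow> unit ltype \<Rightarrow> bool"
  and pmtyping :: "unit env \<Rightarrow> lam \<Rightarrow> unit ltype multiset \<Rightarrow> bool"
where
  pvar: "ptyping (env_empty(x := {#L#})) (Var x) L"
| pmany_nil: "pmtyping env_empty t {#}"
| pmany_cons: "ptyping \<Gamma> t L \<Longrightarrow> pmtyping \<Delta> t M \<Longrightarrow> pmtyping (env_plus \<Gamma> \<Delta>) t (add_mset L M)"
| pabs: "ptyping (case_nat M \<Gamma>) t L \<Longrightarrow> ptyping \<Gamma> (Lam () t) (Arr M () L)"
| papp: "ptyping \<Gamma> t (Arr M () L) \<Longrightarrow> pmtyping \<Delta> u M \<Longrightarrow> ptyping (env_plus \<Gamma> \<Delta>) (App () t u) L"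

definition rel_interp :: "lam \<Rightarrow> (unit env \<times> unit ltype) set" where
  "rel_interp t = {(\<Gamma>, L). ptyping \<Gamma> t L}"

definition rel_le :: "lam \<Rightarrow> lam \<Rightarrow> bool" where
  "rel_le t u \<longleftrightarrow> rel_interp t \<subseteq> rel_interp u"


section \<open>The Boehm tree preorder up to eta-reductions\<close>

definition hnf_of :: "lam \<Rightarrow> lam \<Rightarrow> bool" where
  "hnf_of t h \<longleftrightarrow> (\<exists>k. head_red k t h) \<and> head_normal h"

definition lams :: "nat \<Rightarrow> lam \<Rightarrow> lam" where
  "lams n t = (Lam () ^^ n) t"

definition apps :: "lam \<Rightarrow> lam list \<Rightarrow> lam" where
  "apps t us = foldl (App ()) t us"

text \<open>
  The arguments of the two head normal forms live below \<open>n + p\<close> and \<open>n\<close> binders respectively,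
  so the body \<open>y u\<^sub>1 \<dots> u\<^sub>k\<close> is shifted by \<open>p\<close> before it is compared. The shift also says that the
  last \<open>p\<close> bound variables do not occur in that body. Below the \<open>n + p\<close> binders,
  \<open>x\<^bsub>n+1+j\<^esub>\<close> is index \<open>p - 1 - j\<close>.
\<close>

coinductive boehm_eta_red :: "lam \<Rightarrow> lam \<Rightarrow> bool" where
  no_hnf: "(\<nexists>h. hnf_of t h) \<Longrightarrow> boehm_eta_red t u"
| hnf: "hnf_of t (lams (n + p) (apps (Var (y + p)) ts)) \<Longrightarrow>
    hnf_of u (lams n (apps (Var y) us)) \<Longrightarrow>
    length ts = length us + p \<Longrightarrow>
    (\<forall>i < length us. boehm_eta_red (ts ! i) (ren (\<lambda>m. m + p) (us ! i))) \<Longrightarrow>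
    (\<forall>j < p. boehm_eta_red (ts ! (length us + j)) (Var (p - 1 - j))) \<Longrightarrow>
    boehm_eta_red t u"

end

theory Submission
  imports Defs "HOL-Library.Function_Algebras" "HOL-Library.Groups_Big_Fun"
begin

text \<open>
  Head reduction preserves types backwards and forwards, each interaction step lowering the index
  by one; so a term converges with at most \<open>k\<close> interactions iff it has a type with an index at
  most \<open>k\<close>.

  A Boehm tree inclusion turns a derivation for \<open>t\<close> into one for \<open>u\<close> by induction on its number of
  application rules: removing an \<open>\<eta>\<close>-expansion replaces black arrows of the type by those of the
  head variable, which costs as many whitenings as interactions are saved. Whitening improvement is
  contextual because whitening the type of an argument lets the function answer with a whitening of
  its own and conversely, an exchange that terminates since it consumes black arrows. On derivations
  with black types and index 0 it is inclusion of plain types.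

  Conversely, plain types separate head normal forms that differ, since a head variable can be given
  a type with a fresh target atom and one nonempty argument type. Contexts separate them by
  Boehm-out: white tuplers for the variables make every black abstraction and every argument of a
  head variable cost one interaction, which shows in the total cost when \<open>u\<close> has more abstractions
  than \<open>t\<close>.
\<close>

section \<open>Substitution\<close>

text \<open>Two cycles of implications share the step from Boehm trees to types: one closes through
  contexts, the other through plain types. In that step the Boehm preorder is coinductive and may
  relate an infinite eta-expansion of a variable to the variable itself, so no tree is available for
  recursion; a derivation is, since it inspects a finite part only. In the step from types to
  contexts, the improved function may demand an argument type other than the one available.
  Improvement alone is therefore not shown to be compositional: every single term is proved stable
  under moves of its context, and improvement is then combined with that stability. For the converse
  through contexts, interaction improvement says nothing directly about the arguments of head normal
  forms. It is weakened to an invariant on tests that passes to arguments. What is lost on the way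
  is known exactly: reaching an argument costs \<open>t\<close> precisely \<open>2 * p\<close>
  interactions more than \<open>u\<close>, where \<open>p\<close> counts the eta-reduced binders, so
  \<open>2 * p + 1\<close> runs of one test reveal a single excess interaction.\<close>

definition up :: "(nat \<Rightarrow> 'c tm) \<Rightarrow> nat \<Rightarrow> 'c tm" where
  "up s = case_nat (Var 0) (\<lambda>i. ren Suc (s i))"

definition up_ren :: "(nat \<Rightarrow> nat) \<Rightarrow> nat \<Rightarrow> nat" where
  "up_ren f = case_nat 0 (\<lambda>i. Suc (f i))"

lemma up_simps [simp]: "up s 0 = Var 0" "up s (Suc i) = ren Suc (s i)"
  by (simp_all add: up_def)

lemma up_ren_simps [simp]: "up_ren f 0 = 0" "up_ren f (Suc i) = Suc (f i)"
  by (simp_all add: up_ren_def)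

lemma sub_Lam [simp]: "sub s (Lam c t) = Lam c (sub (up s) t)"
  by (simp add: up_def)

lemma ren_Lam [simp]: "ren f (Lam c t) = Lam c (ren (up_ren f) t)"
  by (simp add: up_ren_def)

declare sub.simps(2) [simp del] ren.simps(2) [simp del]

lemma nat_fun_eqI: "f 0 = g 0 \<Longrightarrow> (\<And>i. f (Suc i) = g (Suc i)) \<Longrightarrow> f = g"
  by (rule ext) (metis nat.exhaust)

text \<open>
  Rewriting with an equation between functions leaves eta-expanded terms behind, which these
  pointwise rules would turn into abstractions.
\<close>

lemmas fn = comp_apply plus_fun_apply zero_fun_apply fun_upd_apply

declare fn [simp del]

lemma ren_ren: "ren f (ren g t) = ren (f \<circ> g) t"
proof (induction t arbitrary: f g)
  case (Lam c t)
  have eq: "up_ren f \<circ> up_ren g = up_ren (f \<circ> g)"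
    by (rule nat_fun_eqI) (auto simp: fn o_def)
  show ?case by (simp only: sub_Lam ren_Lam Lam.IH eq tm.map)
qed (auto simp: fn)

lemma sub_ren: "sub s (ren f t) = sub (s \<circ> f) t"
proof (induction t arbitrary: s f)
  case (Lam c t)
  have eq: "up s \<circ> up_ren f = up (s \<circ> f)"
    by (rule nat_fun_eqI) (auto simp: fn o_def)
  show ?case by (simp only: sub_Lam ren_Lam Lam.IH eq tm.map)
qed (auto simp: fn)

lemma ren_sub: "ren f (sub s t) = sub (ren f \<circ> s) t"
proof (induction t arbitrary: s f)
  case (Lam c t)
  have eq: "ren (up_ren f) \<circ> up s = up (ren f \<circ> s)"
    by (rule nat_fun_eqI) (auto simp: ren_ren fn o_def)
  show ?case by (simp only: sub_Lam ren_Lam Lam.IH eq tm.map)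
qed (auto simp: fn)

lemma sub_sub: "sub r (sub s t) = sub (sub r \<circ> s) t"
proof (induction t arbitrary: s r)
  case (Lam c t)
  have eq: "sub (up r) \<circ> up s = up (sub r \<circ> s)"
    by (rule nat_fun_eqI) (auto simp: sub_ren ren_sub fn o_def)
  show ?case by (simp only: sub_Lam ren_Lam Lam.IH eq tm.map)
qed (auto simp: fn)

lemma up_Var [simp]: "up Var = Var"
  by (rule nat_fun_eqI) (auto simp: fn o_def)

lemma sub_Var [simp]: "sub Var t = t"
  by (induction t) auto

text \<open>Lets a block of beta steps be carried out with one accumulated substitution.\<close>

lemma inst_sub_up: "inst (sub (up s) t) u = sub (case_nat u s) t"
proof -
  have "sub (case_nat u Var) \<circ> up s = case_nat u s"
    by (rule nat_fun_eqI) (auto simp: sub_ren fn o_def)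
  then show ?thesis by (simp add: inst_def sub_sub)
qed

lemma sub_inst: "sub s (inst t u) = inst (sub (up s) t) (sub s u)"
proof -
  have "sub s \<circ> case_nat u Var = case_nat (sub s u) s"
    by (rule nat_fun_eqI) (auto simp: fn o_def)
  then show ?thesis unfolding inst_sub_up by (simp add: inst_def sub_sub)
qed

lemma recolor_ren: "recolor g (ren f t) = ren f (recolor g t)"
  by (induction t arbitrary: f) auto

lemma recolor_sub: "recolor g (sub s t) = sub (recolor g \<circ> s) (recolor g t)"
proof (induction t arbitrary: s)
  case (Lam c t)
  have eq: "recolor g \<circ> up s = up (recolor g \<circ> s)"
    by (rule nat_fun_eqI) (auto simp: recolor_ren fn o_def)
  show ?case by (simp only: sub_Lam ren_Lam Lam.IH eq tm.map)
qed (auto simp: fn)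

lemma recolor_inst: "recolor g (inst t u) = inst (recolor g t) (recolor g u)"
proof -
  have "recolor g \<circ> case_nat u Var = case_nat (recolor g u) Var"
    by (rule nat_fun_eqI) (auto simp: fn o_def)
  then show ?thesis by (simp add: inst_def recolor_sub)
qed


section \<open>Derivations with their number of application rules\<close>

lemma env_plus_eq: "env_plus \<Gamma> \<Delta> = \<Gamma> + \<Delta>"
  by (auto simp: env_plus_def fn)

lemma env_empty_eq: "env_empty = 0"
  by (auto simp: env_empty_def fn)

lemma case_nat_plus: "case_nat (M + N) (\<Gamma> + \<Delta>) = case_nat M \<Gamma> + case_nat N (\<Delta> :: nat \<Rightarrow> 'a::plus)"
  by (rule nat_fun_eqI) (auto simp: fn)

lemma case_nat_eta: "case_nat (f 0) (f \<circ> Suc) = f"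
  by (rule nat_fun_eqI) (auto simp: fn)

lemma case_nat_inject: "case_nat a f = case_nat b g \<longleftrightarrow> a = b \<and> f = g"
  by (metis ext nat.simps(4) nat.simps(5))

lemma case_nat_zero: "case_nat {#} 0 = (0 :: 'c env)"
  by (rule nat_fun_eqI) (auto simp: fn)

text \<open>
  Counting application rules makes a head step decrease the count by exactly one, so that
  typability entails termination of head reduction.
\<close>

inductive der :: "nat \<Rightarrow> 'c env \<Rightarrow> nat \<Rightarrow> 'c tm \<Rightarrow> 'c ltype \<Rightarrow> bool"
  and mder :: "nat \<Rightarrow> 'c env \<Rightarrow> nat \<Rightarrow> 'c tm \<Rightarrow> 'c ltype multiset \<Rightarrow> bool"
where
  dvar: "der 0 (0(x := {#L#})) 0 (Var x) L"
| dnil: "mder 0 0 0 t {#}"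
| dcons: "der m \<Gamma> k t L \<Longrightarrow> mder n \<Delta> l t M \<Longrightarrow> mder (m + n) (\<Gamma> + \<Delta>) (k + l) t (add_mset L M)"
| dabs: "der n (case_nat M \<Gamma>) k t L \<Longrightarrow> der n \<Gamma> k (Lam c t) (Arr M c L)"
| dapp: "der m \<Gamma> k t (Arr M c L) \<Longrightarrow> mder n \<Delta> l u M \<Longrightarrow>
    der (Suc (m + n)) (\<Gamma> + \<Delta>) (k + l + mark c d) (App d t u) L"

inductive_cases der_VarE: "der n \<Gamma> k (Var x) L"
inductive_cases der_LamE: "der n \<Gamma> k (Lam c t) L"
inductive_cases der_AppE: "der n \<Gamma> k (App d t u) L"
inductive_cases mder_nilE: "mder n \<Gamma> k t {#}"

lemma der_Var: "der n \<Gamma> k (Var x) L \<longleftrightarrow> n = 0 \<and> k = 0 \<and> \<Gamma> = 0(x := {#L#})"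
  by (auto elim: der_VarE intro: dvar)

lemma der_Lam:
  "der n \<Gamma> k (Lam c t) T \<longleftrightarrow> (\<exists>M L. T = Arr M c L \<and> der n (case_nat M \<Gamma>) k t L)"
  by (auto elim: der_LamE intro: dabs)

lemma mder_empty: "mder n \<Gamma> k t {#} \<longleftrightarrow> n = 0 \<and> k = 0 \<and> \<Gamma> = 0"
  by (auto elim: mder_nilE intro: dnil)

text \<open>A derivation lists the elements of a multi type in some order, while the equation may
  single out any of them. If \<open>L\<close> was not added last, it is extracted from the rest and
  the last element is added again.\<close>

lemma mder_addD:
  "mder n \<Gamma> k t N \<Longrightarrow> N = add_mset L M \<Longrightarrow>
    \<exists>n1 n2 \<Gamma>1 \<Gamma>2 k1 k2. n = n1 + n2 \<and> \<Gamma> = \<Gamma>1 + \<Gamma>2 \<and> k = k1 + k2 \<and> der n1 \<Gamma>1 k1 t L \<and> mder n2 \<Gamma>2 k2 t M"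
proof (induction arbitrary: L M rule: der_mder.inducts(2)[where ?P1.0 = "\<lambda>_ _ _ _ _. True"])
  case (dcons m \<Gamma> k t L0 n \<Delta> l M0)
  show ?case
  proof (cases "L0 = L")
    case True
    then have "M0 = M" using dcons.prems by simp
    then show ?thesis using dcons.hyps True by blast
  next
    case False
    with dcons.prems obtain K where K: "M0 = add_mset L K" "M = add_mset L0 K"
      by (auto simp: add_eq_conv_ex)
    then obtain n1 n2 \<Gamma>1 \<Gamma>2 k1 k2 where *: "n = n1 + n2" "\<Delta> = \<Gamma>1 + \<Gamma>2" "l = k1 + k2"
      "der n1 \<Gamma>1 k1 t L" "mder n2 \<Gamma>2 k2 t K" using dcons.IH by blast
    have "mder (m + n2) (\<Gamma> + \<Gamma>2) (k + k2) t M"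
      unfolding K using dcons.hyps(1) *(5) by (rule der_mder.dcons)
    moreover have "m + n = n1 + (m + n2)" "\<Gamma> + \<Delta> = \<Gamma>1 + (\<Gamma> + \<Gamma>2)" "k + l = k1 + (k + k2)"
      using * by (simp_all add: ac_simps)
    ultimately show ?thesis using *(4) by blast
  qed
qed auto

lemma mder_add:
  "mder n \<Gamma> k t (add_mset L M) \<longleftrightarrow>
    (\<exists>n1 n2 \<Gamma>1 \<Gamma>2 k1 k2. n = n1 + n2 \<and> \<Gamma> = \<Gamma>1 + \<Gamma>2 \<and> k = k1 + k2 \<and> der n1 \<Gamma>1 k1 t L \<and> mder n2 \<Gamma>2 k2 t M)"
  using mder_addD der_mder.dcons by blast

lemma mder_single: "mder n \<Gamma> k t {#L#} \<longleftrightarrow> der n \<Gamma> k t L"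
  by (simp add: mder_add mder_empty)

lemma der_App:
  "der n \<Theta> j (App d t u) L \<longleftrightarrow>
    (\<exists>n1 n2 \<Gamma> \<Delta> k l c M. n = Suc (n1 + n2) \<and> \<Theta> = \<Gamma> + \<Delta> \<and> j = k + l + mark c d \<and>
      der n1 \<Gamma> k t (Arr M c L) \<and> mder n2 \<Delta> l u M)"
  by (blast elim: der_AppE intro: dapp)

section \<open>Renamings acting on derivations\<close>

text \<open>Transport of an environment along an injective renaming. Indices outside the range get
  the empty multi type, which is how non-occurrence of a variable shows in typings.\<close>

definition push :: "(nat \<Rightarrow> nat) \<Rightarrow> 'c env \<Rightarrow> 'c env" where
  "push f \<Gamma> = (\<lambda>y. if y \<in> range f then \<Gamma> (inv f y) else {#})"

lemma push_zero: "push f 0 = 0"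
  by (auto simp: push_def fn)

lemma push_plus: "push f (\<Gamma> + \<Delta>) = push f \<Gamma> + push f \<Delta>"
  by (auto simp: push_def fn)

lemma push_upd: "inj f \<Longrightarrow> push f (0(x := M)) = 0(f x := M)"
  by (auto simp: push_def fn fun_eq_iff inv_f_f)

lemma inj_up_ren:
  assumes "inj f"
  shows "inj (up_ren f)"
proof (rule injI)
  fix x y
  assume "up_ren f x = up_ren f y"
  then show "x = y" using injD[OF assms] by (cases x; cases y) auto
qed

lemma push_app: "inj f \<Longrightarrow> push f \<Gamma> (f x) = \<Gamma> x"
  by (simp add: push_def fn)

lemma push_notin: "y \<notin> range f \<Longrightarrow> push f \<Gamma> y = {#}"
  by (simp add: push_def fn)

lemma push_up: "inj f \<Longrightarrow> push (up_ren f) (case_nat M \<Gamma>) = case_nat M (push f \<Gamma>)"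
proof (rule nat_fun_eqI)
  assume f: "inj f"
  show "push (up_ren f) (case_nat M \<Gamma>) 0 = case_nat M (push f \<Gamma>) 0"
    using push_app[OF inj_up_ren[OF f], of "case_nat M \<Gamma>" 0] by simp
  fix i
  show "push (up_ren f) (case_nat M \<Gamma>) (Suc i) = case_nat M (push f \<Gamma>) (Suc i)"
  proof (cases "i \<in> range f")
    case True
    then obtain x where "i = f x" by blast
    then show ?thesis
      using push_app[OF inj_up_ren[OF f], of "case_nat M \<Gamma>" "Suc x"] push_app[OF f, of \<Gamma> x] by simp
  next
    case False
    have "Suc i \<notin> range (up_ren f)"
    proof
      assume "Suc i \<in> range (up_ren f)"
      then obtain x where "Suc i = up_ren f x" by blast
      then show False using False by (cases x) auto
    qed
    then show ?thesis using False by (simp add: push_notin)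
  qed
qed

text \<open>The hypotheses \<open>R0\<close> and \<open>Rp\<close> say that \<open>R\<close> splits
  along sums of environments. This is all that is needed to distribute a property of single
  derivations over the elements of a multi type.\<close>

lemma mder_lift:
  assumes "\<And>n \<Theta> k L. der n \<Theta> k t' L \<longleftrightarrow> (\<exists>n1 n2 k1 k2 \<Gamma>. n = n1 + n2 \<and> k = k1 + k2 \<and> der n1 \<Gamma> k1 t L \<and> R n2 \<Theta> k2 \<Gamma>)"
    and R0: "\<And>n \<Theta> k. R n \<Theta> k 0 \<longleftrightarrow> n = 0 \<and> k = 0 \<and> \<Theta> = 0"
    and Rp: "\<And>n \<Theta> k \<Gamma>1 \<Gamma>2. R n \<Theta> k (\<Gamma>1 + \<Gamma>2) \<longleftrightarrow>
      (\<exists>n1 n2 k1 k2 \<Theta>1 \<Theta>2. n = n1 + n2 \<and> k = k1 + k2 \<and> \<Theta> = \<Theta>1 + \<Theta>2 \<and> R n1 \<Theta>1 k1 \<Gamma>1 \<and> R n2 \<Theta>2 k2 \<Gamma>2)"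
  shows "mder n \<Theta> k t' M \<longleftrightarrow> (\<exists>n1 n2 k1 k2 \<Gamma>. n = n1 + n2 \<and> k = k1 + k2 \<and> mder n1 \<Gamma> k1 t M \<and> R n2 \<Theta> k2 \<Gamma>)"
proof (induction M arbitrary: n \<Theta> k)
  case empty
  show ?case by (simp add: mder_empty R0)
next
  case (add L M)
  show ?case (is "?l \<longleftrightarrow> ?r")
  proof
    assume ?l
    then obtain n1 n2 \<Theta>1 \<Theta>2 k1 k2 where *: "n = n1 + n2" "\<Theta> = \<Theta>1 + \<Theta>2" "k = k1 + k2"
      and d: "der n1 \<Theta>1 k1 t' L" "mder n2 \<Theta>2 k2 t' M" by (auto simp: mder_add)
    obtain a1 a2 b1 b2 \<Gamma> where a: "n1 = a1 + a2" "k1 = b1 + b2" "der a1 \<Gamma> b1 t L" "R a2 \<Theta>1 b2 \<Gamma>"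
      using d(1) assms(1) by blast
    obtain c1 c2 e1 e2 \<Delta> where c: "n2 = c1 + c2" "k2 = e1 + e2" "mder c1 \<Delta> e1 t M" "R c2 \<Theta>2 e2 \<Delta>"
      using d(2) add.IH by blast
    have "mder (a1 + c1) (\<Gamma> + \<Delta>) (b1 + e1) t (add_mset L M)" using a(3) c(3) by (rule dcons)
    moreover have "R (a2 + c2) \<Theta> (b2 + e2) (\<Gamma> + \<Delta>)" unfolding Rp *(2) using a(4) c(4) by blast
    moreover have "n = (a1 + c1) + (a2 + c2)" "k = (b1 + e1) + (b2 + e2)" using * a c by auto
    ultimately show ?r by blast
  next
    assume ?r
    then obtain n1 n2 k1 k2 \<Gamma> where *: "n = n1 + n2" "k = k1 + k2" "mder n1 \<Gamma> k1 t (add_mset L M)"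
      and R: "R n2 \<Theta> k2 \<Gamma>" by blast
    from *(3) obtain a1 a2 \<Gamma>1 \<Gamma>2 b1 b2 where a: "n1 = a1 + a2" "\<Gamma> = \<Gamma>1 + \<Gamma>2" "k1 = b1 + b2"
      "der a1 \<Gamma>1 b1 t L" "mder a2 \<Gamma>2 b2 t M" by (auto simp: mder_add)
    from R a(2) obtain c1 c2 e1 e2 \<Theta>1 \<Theta>2 where c: "n2 = c1 + c2" "k2 = e1 + e2" "\<Theta> = \<Theta>1 + \<Theta>2"
      "R c1 \<Theta>1 e1 \<Gamma>1" "R c2 \<Theta>2 e2 \<Gamma>2" by (auto simp: Rp)
    have "der (a1 + c1) \<Theta>1 (b1 + e1) t' L" using a c assms(1) by blast
    moreover have "mder (a2 + c2) \<Theta>2 (b2 + e2) t' M" using a c add.IH by blast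
    ultimately have "mder ((a1 + c1) + (a2 + c2)) (\<Theta>1 + \<Theta>2) ((b1 + e1) + (b2 + e2)) t' (add_mset L M)"
      by (rule dcons)
    moreover have "n = (a1 + c1) + (a2 + c2)" "k = (b1 + e1) + (b2 + e2)" using * a c by auto
    ultimately show ?l using c by simp
  qed
qed

text \<open>Here \<open>R\<close> stands for \<open>push\<close> in the case of renamings, for \<open>sder\<close> in the case of substitutions.\<close>

lemma der_App_lift:
  assumes t: "\<And>n \<Theta> k L. der n \<Theta> k t' L \<longleftrightarrow> (\<exists>n1 n2 k1 k2 \<Gamma>. n = n1 + n2 \<and> k = k1 + k2 \<and> der n1 \<Gamma> k1 t L \<and> R n2 \<Theta> k2 \<Gamma>)"
    and u: "\<And>n \<Theta> k L. der n \<Theta> k u' L \<longleftrightarrow> (\<exists>n1 n2 k1 k2 \<Gamma>. n = n1 + n2 \<and> k = k1 + k2 \<and> der n1 \<Gamma> k1 u L \<and> R n2 \<Theta> k2 \<Gamma>)"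
    and R0: "\<And>n \<Theta> k. R n \<Theta> k 0 \<longleftrightarrow> n = 0 \<and> k = 0 \<and> \<Theta> = 0"
    and Rp: "\<And>n \<Theta> k \<Gamma>1 \<Gamma>2. R n \<Theta> k (\<Gamma>1 + \<Gamma>2) \<longleftrightarrow>
      (\<exists>n1 n2 k1 k2 \<Theta>1 \<Theta>2. n = n1 + n2 \<and> k = k1 + k2 \<and> \<Theta> = \<Theta>1 + \<Theta>2 \<and> R n1 \<Theta>1 k1 \<Gamma>1 \<and> R n2 \<Theta>2 k2 \<Gamma>2)"
  shows "der n \<Theta> k (App d t' u') L \<longleftrightarrow>
    (\<exists>n1 n2 k1 k2 \<Gamma>. n = n1 + n2 \<and> k = k1 + k2 \<and> der n1 \<Gamma> k1 (App d t u) L \<and> R n2 \<Theta> k2 \<Gamma>)"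
    (is "?l \<longleftrightarrow> ?r")
proof
  note m = mder_lift[OF u R0 Rp]
  {
    assume ?l
    then obtain n1 n2 \<Theta>1 \<Theta>2 k1 k2 c M where *: "n = Suc (n1 + n2)" "\<Theta> = \<Theta>1 + \<Theta>2" "k = k1 + k2 + mark c d"
      and d: "der n1 \<Theta>1 k1 t' (Arr M c L)" "mder n2 \<Theta>2 k2 u' M" by (auto simp: der_App)
    obtain a1 a2 b1 b2 \<Gamma> where a: "n1 = a1 + a2" "k1 = b1 + b2" "der a1 \<Gamma> b1 t (Arr M c L)" "R a2 \<Theta>1 b2 \<Gamma>"
      using d(1) t by blast
    obtain c1 c2 e1 e2 \<Delta> where c: "n2 = c1 + c2" "k2 = e1 + e2" "mder c1 \<Delta> e1 u M" "R c2 \<Theta>2 e2 \<Delta>"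
      using d(2) m by blast
    have "der (Suc (a1 + c1)) (\<Gamma> + \<Delta>) (b1 + e1 + mark c d) (App d t u) L"
      using a(3) c(3) by (rule dapp)
    moreover have "R (a2 + c2) \<Theta> (b2 + e2) (\<Gamma> + \<Delta>)" unfolding Rp *(2) using a(4) c(4) by blast
    moreover have "n = Suc (a1 + c1) + (a2 + c2)" "k = (b1 + e1 + mark c d) + (b2 + e2)"
      using * a c by auto
    ultimately show ?r by blast
  }
  {
    assume ?r
    then obtain n1 n2 k1 k2 \<Gamma> where *: "n = n1 + n2" "k = k1 + k2" "der n1 \<Gamma> k1 (App d t u) L"
      and R: "R n2 \<Theta> k2 \<Gamma>" by blast
    from *(3) obtain a1 a2 \<Gamma>1 \<Gamma>2 b1 b2 c M where a: "n1 = Suc (a1 + a2)" "\<Gamma> = \<Gamma>1 + \<Gamma>2"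
      "k1 = b1 + b2 + mark c d" "der a1 \<Gamma>1 b1 t (Arr M c L)" "mder a2 \<Gamma>2 b2 u M" by (auto simp: der_App)
    from R a(2) obtain c1 c2 e1 e2 \<Theta>1 \<Theta>2 where c: "n2 = c1 + c2" "k2 = e1 + e2" "\<Theta> = \<Theta>1 + \<Theta>2"
      "R c1 \<Theta>1 e1 \<Gamma>1" "R c2 \<Theta>2 e2 \<Gamma>2" by (auto simp: Rp)
    have "der (a1 + c1) \<Theta>1 (b1 + e1) t' (Arr M c L)" using a c t by blast
    moreover have "mder (a2 + c2) \<Theta>2 (b2 + e2) u' M" using a c m by blast
    ultimately have "der (Suc ((a1 + c1) + (a2 + c2))) (\<Theta>1 + \<Theta>2) ((b1 + e1) + (b2 + e2) + mark c d) (App d t' u') L"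
      by (rule dapp)
    moreover have "n = Suc ((a1 + c1) + (a2 + c2))" "k = (b1 + e1) + (b2 + e2) + mark c d"
      using * a c by auto
    ultimately show ?l using c by simp
  }
qed

lemma push_inject: "inj f \<Longrightarrow> push f \<Gamma> = push f \<Delta> \<longleftrightarrow> \<Gamma> = \<Delta>"
  by (metis ext push_app)

text \<open>Eta-reduction rests on the direction from left to right: a typing of a shifted body
  cannot mention the removed binders and can be unshifted.\<close>

lemma der_ren: "inj f \<Longrightarrow> der n \<Theta> k (ren f t) L \<longleftrightarrow> (\<exists>\<Gamma>. \<Theta> = push f \<Gamma> \<and> der n \<Gamma> k t L)"
proof (induction t arbitrary: f n \<Theta> k L)
  case (Var x)
  then show ?case by (auto simp: der_Var push_upd)
next
  case (Lam c t)
  note IH = Lam.IH[OF inj_up_ren[OF Lam.prems]]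
  have "(\<exists>\<Gamma>. case_nat M \<Theta> = push (up_ren f) \<Gamma> \<and> der n \<Gamma> k t K) \<longleftrightarrow>
      (\<exists>\<Gamma>. \<Theta> = push f \<Gamma> \<and> der n (case_nat M \<Gamma>) k t K)" for M K
    by (metis Lam.prems case_nat_eta case_nat_inject push_up)
  then show ?case by (auto simp: der_Lam IH)
next
  case (App d t u)
  let ?R = "\<lambda>n \<Theta> k \<Gamma>. n = 0 \<and> k = 0 \<and> \<Theta> = push f \<Gamma>"
  have "der n \<Theta> k (App d (ren f t) (ren f u)) L \<longleftrightarrow>
    (\<exists>n1 n2 k1 k2 \<Gamma>. n = n1 + n2 \<and> k = k1 + k2 \<and> der n1 \<Gamma> k1 (App d t u) L \<and> ?R n2 \<Theta> k2 \<Gamma>)"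
    by (rule der_App_lift) (auto simp: App.IH[OF App.prems] push_zero push_plus push_inject[OF App.prems])
  also have "\<dots> \<longleftrightarrow> (\<exists>\<Gamma>. \<Theta> = push f \<Gamma> \<and> der n \<Gamma> k (App d t u) L)"
    by (auto simp: push_inject[OF App.prems])
  finally show ?case by simp
qed

section \<open>Substitutions acting on derivations\<close>

text \<open>One derivation of \<open>s x\<close> for each type that the last environment gives to
  \<open>x\<close>, with environments, counts and indices added up. The inductive form keeps the
  collection finite although \<open>s\<close> is defined on all indices.\<close>

inductive sder :: "(nat \<Rightarrow> 'c tm) \<Rightarrow> nat \<Rightarrow> 'c env \<Rightarrow> nat \<Rightarrow> 'c env \<Rightarrow> bool" for s where
  sder_nil: "sder s 0 0 0 0"
| sder_cons: "der m \<Gamma> k (s x) L \<Longrightarrow> sder s n \<Delta> l \<Phi> \<Longrightarrow>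
    sder s (m + n) (\<Gamma> + \<Delta>) (k + l) (0(x := {#L#}) + \<Phi>)"

lemma env_zero_iff: "\<Gamma> + \<Delta> = (0 :: 'c env) \<longleftrightarrow> \<Gamma> = 0 \<and> \<Delta> = 0"
  by (auto simp: fn fun_eq_iff)

lemma upd_neq_zero: "(0(x := {#L#}) :: 'c env) \<noteq> 0"
  by (metis add_mset_not_empty fun_upd_same zero_fun_apply zero_multiset_def fun_upd_same)

lemma sder_zero: "sder s n \<Theta> k 0 \<longleftrightarrow> n = 0 \<and> k = 0 \<and> \<Theta> = 0"
proof
  show "sder s n \<Theta> k 0 \<Longrightarrow> n = 0 \<and> k = 0 \<and> \<Theta> = 0"
    by (erule sder.cases) (auto simp: env_zero_iff upd_neq_zero eq_commute[of 0])
qed (auto intro: sder_nil)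

lemma sder_plus:
  "sder s n \<Theta> k \<Phi> \<Longrightarrow> sder s n' \<Theta>' k' \<Phi>' \<Longrightarrow> sder s (n + n') (\<Theta> + \<Theta>') (k + k') (\<Phi> + \<Phi>')"
proof (induction rule: sder.induct)
  case (sder_cons m \<Gamma> k x L n \<Delta> l \<Phi>)
  from sder.sder_cons[of m \<Gamma> k s x L, OF sder_cons.hyps(1) sder_cons.IH[OF sder_cons.prems]]
  show ?case by (simp add: ac_simps)
qed simp

lemma env_upd_split:
  assumes "0(x := {#L#}) + \<Phi> = \<Phi>1 + (\<Phi>2 :: 'c env)" "L \<in># \<Phi>1 x"
  obtains \<Psi> where "\<Phi>1 = 0(x := {#L#}) + \<Psi>" "\<Phi> = \<Psi> + \<Phi>2"
proof
  let ?P = "\<Phi>1(x := \<Phi>1 x - {#L#})"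
  show 1: "\<Phi>1 = 0(x := {#L#}) + ?P" using assms(2) by (auto simp: fn fun_eq_iff)
  then have "0(x := {#L#}) + \<Phi> = 0(x := {#L#}) + (?P + \<Phi>2)"
    unfolding assms(1) add.assoc[symmetric] by (rule arg_cong)
  then show "\<Phi> = ?P + \<Phi>2" by (rule add_left_imp_eq)
qed

text \<open>Derivations are attached to single type occurrences, so every splitting of
  \<open>\<Phi>\<close> distributes them.\<close>

lemma sder_plusD:
  "sder s n \<Theta> k \<Phi> \<Longrightarrow> \<Phi> = \<Phi>1 + \<Phi>2 \<Longrightarrow>
    \<exists>n1 n2 k1 k2 \<Theta>1 \<Theta>2. n = n1 + n2 \<and> k = k1 + k2 \<and> \<Theta> = \<Theta>1 + \<Theta>2 \<and> sder s n1 \<Theta>1 k1 \<Phi>1 \<and> sder s n2 \<Theta>2 k2 \<Phi>2"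
proof (induction arbitrary: \<Phi>1 \<Phi>2 rule: sder.induct)
  case sder_nil
  then show ?case using sder.sder_nil
    by (metis add_0 env_zero_iff)
next
  case (sder_cons m \<Gamma> k x L n \<Delta> l \<Phi>)
  have "L \<in># (\<Phi>1 + \<Phi>2) x" by (simp add: fn flip: sder_cons.prems)
  then consider "L \<in># \<Phi>1 x" | "L \<in># \<Phi>2 x" by (auto simp: fn)
  then show ?case
  proof cases
    case 1
    then obtain \<Psi> where P: "\<Phi>1 = 0(x := {#L#}) + \<Psi>" "\<Phi> = \<Psi> + \<Phi>2"
      using sder_cons.prems env_upd_split by blast
    from sder_cons.IH[OF P(2)] obtain n1 n2 k1 k2 \<Theta>1 \<Theta>2 where
      *: "n = n1 + n2" "l = k1 + k2" "\<Delta> = \<Theta>1 + \<Theta>2" "sder s n1 \<Theta>1 k1 \<Psi>" "sder s n2 \<Theta>2 k2 \<Phi>2" by blast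
    have "sder s (m + n1) (\<Gamma> + \<Theta>1) (k + k1) \<Phi>1"
      unfolding P using sder_cons.hyps(1) *(4) by (rule sder.sder_cons)
    moreover have "m + n = (m + n1) + n2" "k + l = (k + k1) + k2" "\<Gamma> + \<Delta> = (\<Gamma> + \<Theta>1) + \<Theta>2"
      using * by (simp_all add: ac_simps)
    ultimately show ?thesis using *(5) by blast
  next
    case 2
    then obtain \<Psi> where P: "\<Phi>2 = 0(x := {#L#}) + \<Psi>" "\<Phi> = \<Psi> + \<Phi>1"
      using sder_cons.prems env_upd_split[of x L \<Phi> \<Phi>2 \<Phi>1] by (metis add.commute)
    from sder_cons.IH[of \<Phi>1 \<Psi>] P(2) obtain n1 n2 k1 k2 \<Theta>1 \<Theta>2 where
      *: "n = n1 + n2" "l = k1 + k2" "\<Delta> = \<Theta>1 + \<Theta>2" "sder s n1 \<Theta>1 k1 \<Phi>1" "sder s n2 \<Theta>2 k2 \<Psi>"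
      by (metis add.commute)
    have "sder s (m + n2) (\<Gamma> + \<Theta>2) (k + k2) \<Phi>2"
      unfolding P using sder_cons.hyps(1) *(5) by (rule sder.sder_cons)
    moreover have "m + n = n1 + (m + n2)" "k + l = k1 + (k + k2)" "\<Gamma> + \<Delta> = \<Theta>1 + (\<Gamma> + \<Theta>2)"
      using * by (simp_all add: ac_simps)
    ultimately show ?thesis using *(4) by blast
  qed
qed

lemma sder_plus_iff:
  "sder s n \<Theta> k (\<Phi>1 + \<Phi>2) \<longleftrightarrow>
    (\<exists>n1 n2 k1 k2 \<Theta>1 \<Theta>2. n = n1 + n2 \<and> k = k1 + k2 \<and> \<Theta> = \<Theta>1 + \<Theta>2 \<and> sder s n1 \<Theta>1 k1 \<Phi>1 \<and> sder s n2 \<Theta>2 k2 \<Phi>2)"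
  using sder_plusD sder_plus by blast

lemma upd_eq_plus:
  assumes "(0(x := {#L#}) :: 'c env) = 0(y := {#K#}) + \<Phi>"
  shows "y = x \<and> K = L \<and> \<Phi> = 0"
proof -
  have "\<And>z. (0(x := {#L#}) :: 'c env) z = (0(y := {#K#}) + \<Phi>) z" using assms by simp
  from this[of y] have "y = x" "K = L" by (auto split: if_splits simp: fn)
  then show ?thesis using assms by (auto simp: fn fun_eq_iff split: if_splits)
qed

lemma sder_single: "sder s n \<Theta> k (0(x := {#L#})) \<longleftrightarrow> der n \<Theta> k (s x) L"
proof
  assume "sder s n \<Theta> k (0(x := {#L#}))"
  then show "der n \<Theta> k (s x) L"
    by cases (auto simp: upd_neq_zero sder_zero dest!: upd_eq_plus)
next
  assume "der n \<Theta> k (s x) L"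
  from sder_cons[of _ _ _ s, OF this sder_nil] show "sder s n \<Theta> k (0(x := {#L#}))" by simp
qed

lemma push_Suc: "push Suc \<Gamma> = case_nat {#} \<Gamma>"
  by (rule nat_fun_eqI) (auto simp: push_app push_notin)

lemma case_nat_upd_0: "0(0 := M) = case_nat M (0 :: 'c env)"
  by (rule nat_fun_eqI) (auto simp: fn)

lemma case_nat_upd_Suc: "0(Suc x := M) = case_nat {#} (0(x := M) :: 'c env)"
  by (rule nat_fun_eqI) (auto simp: fn)

lemma comp_Suc [simp]:
  "(\<Gamma> + \<Delta>) \<circ> Suc = (\<Gamma> \<circ> Suc) + (\<Delta> \<circ> Suc :: 'c env)" "case_nat M \<Gamma> \<circ> Suc = \<Gamma>"
  "0(Suc y := M) \<circ> Suc = (0(y := M) :: 'c env)" "0(0 := M) \<circ> Suc = (0 :: 'c env)"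
  "0 \<circ> Suc = (0 :: 'c env)"
  by (auto simp: fn fun_eq_iff)

lemma sder_upD: "sder (up s) n \<Theta> k \<Phi> \<Longrightarrow> \<Theta> 0 = \<Phi> 0 \<and> sder s n (\<Theta> \<circ> Suc) k (\<Phi> \<circ> Suc)"
proof (induction rule: sder.induct)
  case sder_nil
  then show ?case using sder.sder_nil[of s] by simp
next
  case (sder_cons m \<Gamma> k x L n \<Delta> l \<Phi>)
  show ?case
  proof (cases x)
    case 0
    with sder_cons.hyps(1) have "m = 0" "k = 0" "\<Gamma> = 0(0 := {#L#})" by (auto simp: der_Var)
    with 0 sder_cons.IH show ?thesis by (simp add: fn)
  next
    case (Suc y)
    with sder_cons.hyps obtain \<Gamma>' where g: "\<Gamma> = case_nat {#} \<Gamma>'" "der m \<Gamma>' k (s y) L"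
      by (auto simp: der_ren push_Suc)
    have "sder s (m + n) (\<Gamma>' + (\<Delta> \<circ> Suc)) (k + l) (0(y := {#L#}) + (\<Phi> \<circ> Suc))"
      using g(2) sder_cons.IH by (auto intro: sder.sder_cons)
    moreover have "(\<Gamma> + \<Delta>) 0 = (0(x := {#L#}) + \<Phi>) 0" using Suc g sder_cons.IH by (simp add: fn)
    ultimately show ?thesis using Suc g by simp
  qed
qed

lemma sder_upI1: "sder s n \<Theta> k \<Phi> \<Longrightarrow> sder (up s) n (case_nat {#} \<Theta>) k (case_nat {#} \<Phi>)"
proof (induction rule: sder.induct)
  case sder_nil
  then show ?case using sder.sder_nil[of "up s"] by (simp add: case_nat_zero)
next
  case (sder_cons m \<Gamma> k x L n \<Delta> l \<Phi>)
  have "der m (case_nat {#} \<Gamma>) k (up s (Suc x)) L"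
    using sder_cons.hyps by (auto simp: der_ren push_Suc)
  from sder.sder_cons[of _ _ _ "up s", OF this sder_cons.IH] show ?case
    by (simp add: case_nat_upd_Suc flip: case_nat_plus)
qed

lemma sder_upI0: "sder (up s) 0 (case_nat M 0) 0 (case_nat M 0)"
proof (induction M)
  case empty
  show ?case using sder.sder_nil[of "up s"] by (simp add: case_nat_zero)
next
  case (add L M)
  have "der 0 (0(0 := {#L#})) 0 (up s 0) L" by (simp add: der_Var)
  from sder.sder_cons[of _ _ _ "up s", OF this add.IH] show ?case
    by (simp add: case_nat_upd_0 flip: case_nat_plus)
qed

text \<open>Below a binder the new variable is substituted by itself, so its types pass through
  unchanged and at no cost.\<close>

lemma sder_up:
  "sder (up s) n \<Theta> k (case_nat M \<Phi>) \<longleftrightarrow> (\<exists>\<Theta>'. \<Theta> = case_nat M \<Theta>' \<and> sder s n \<Theta>' k \<Phi>)"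
proof
  assume "sder (up s) n \<Theta> k (case_nat M \<Phi>)"
  from sder_upD[OF this] show "\<exists>\<Theta>'. \<Theta> = case_nat M \<Theta>' \<and> sder s n \<Theta>' k \<Phi>"
    by (metis case_nat_eta case_nat_inject)
next
  assume "\<exists>\<Theta>'. \<Theta> = case_nat M \<Theta>' \<and> sder s n \<Theta>' k \<Phi>"
  then obtain \<Theta>' where "\<Theta> = case_nat M \<Theta>'" "sder s n \<Theta>' k \<Phi>" by blast
  with sder_plus[OF sder_upI0[of s M] sder_upI1[of s n \<Theta>' k \<Phi>]]
  show "sder (up s) n \<Theta> k (case_nat M \<Phi>)" by (simp flip: case_nat_plus)
qed

text \<open>As an equivalence this is substitution and anti-substitution at once. Counts and indices
  add up exactly, so that head steps can be measured in both directions.\<close>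

lemma der_sub:
  "der n \<Theta> k (sub s t) L \<longleftrightarrow>
    (\<exists>n1 n2 k1 k2 \<Phi>. n = n1 + n2 \<and> k = k1 + k2 \<and> der n1 \<Phi> k1 t L \<and> sder s n2 \<Theta> k2 \<Phi>)"
proof (induction t arbitrary: s n \<Theta> k L)
  case (Var x)
  show ?case by (auto simp: der_Var sder_single)
next
  case (Lam c t)
  have "(\<exists>n1 n2 k1 k2 \<Phi>. n = n1 + n2 \<and> k = k1 + k2 \<and> der n1 \<Phi> k1 t K \<and> sder (up s) n2 (case_nat M \<Theta>) k2 \<Phi>)
    \<longleftrightarrow> (\<exists>n1 n2 k1 k2 \<Phi>. n = n1 + n2 \<and> k = k1 + k2 \<and> der n1 (case_nat M \<Phi>) k1 t K \<and> sder s n2 \<Theta> k2 \<Phi>)"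
    (is "?l \<longleftrightarrow> ?r") for M K
  proof
    assume ?l
    then obtain n1 n2 k1 k2 \<Phi> where *: "n = n1 + n2" "k = k1 + k2" "der n1 \<Phi> k1 t K"
      "sder (up s) n2 (case_nat M \<Theta>) k2 \<Phi>" by blast
    from sder_up[of s n2 "case_nat M \<Theta>" k2 "\<Phi> 0" "\<Phi> \<circ> Suc"] *(4)
    have "M = \<Phi> 0" "sder s n2 \<Theta> k2 (\<Phi> \<circ> Suc)" by (auto simp: case_nat_eta case_nat_inject)
    moreover from this(1) have "case_nat M (\<Phi> \<circ> Suc) = \<Phi>" by (simp add: case_nat_eta)
    ultimately show ?r using * by metis
  next
    assume ?r
    then show ?l using sder_up by blast
  qed
  then show ?case by (simp add: der_Lam Lam.IH) blast
next
  case (App d t u)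
  show ?case unfolding sub.simps(3)
    by (rule der_App_lift[OF App.IH sder_zero sder_plus_iff])
qed

lemma sder_case_natD:
  "sder (case_nat u Var) n \<Theta> k \<Phi> \<Longrightarrow> \<exists>\<Delta>. mder n \<Delta> k u (\<Phi> 0) \<and> \<Theta> = \<Delta> + (\<Phi> \<circ> Suc)"
proof (induction rule: sder.induct)
  case sder_nil
  then show ?case by (auto simp: mder_empty fn)
next
  case (sder_cons m \<Gamma> k x L n \<Delta> l \<Phi>)
  then obtain \<Delta>' where D: "mder n \<Delta>' l u (\<Phi> 0)" "\<Delta> = \<Delta>' + (\<Phi> \<circ> Suc)" by blast
  show ?case
  proof (cases x)
    case 0
    then have "mder (m + n) (\<Gamma> + \<Delta>') (k + l) u (add_mset L (\<Phi> 0))"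
      using sder_cons.hyps(1) D by (auto intro: dcons)
    then have "mder (m + n) (\<Gamma> + \<Delta>') (k + l) u ((0(x := {#L#}) + \<Phi>) 0)" using 0 by (simp add: fn)
    moreover have "\<Gamma> + \<Delta> = (\<Gamma> + \<Delta>') + ((0(x := {#L#}) + \<Phi>) \<circ> Suc)"
      using 0 by (simp add: D(2) add.assoc)
    ultimately show ?thesis by blast
  next
    case (Suc y)
    with sder_cons.hyps(1) have "m = 0" "k = 0" "\<Gamma> = 0(y := {#L#})" by (auto simp: der_Var)
    moreover have "\<Gamma> + \<Delta> = \<Delta>' + ((0(x := {#L#}) + \<Phi>) \<circ> Suc)"
      using Suc by (simp add: D(2) ac_simps calculation(3))
    moreover have "(0(x := {#L#}) + \<Phi>) 0 = \<Phi> 0" using Suc by (simp add: fn)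
    ultimately show ?thesis using D(1) by auto
  qed
qed

lemma sder_case_natI0:
  "mder n \<Delta> k u M \<Longrightarrow> sder (case_nat u s) n \<Delta> k (case_nat M 0)"
proof (induction M arbitrary: n \<Delta> k)
  case empty
  then show ?case by (simp add: mder_empty case_nat_zero sder_zero)
next
  case (add L M)
  then obtain n1 n2 \<Gamma>1 \<Gamma>2 k1 k2 where *: "n = n1 + n2" "\<Delta> = \<Gamma>1 + \<Gamma>2" "k = k1 + k2"
    "der n1 \<Gamma>1 k1 u L" "mder n2 \<Gamma>2 k2 u M" by (auto simp: mder_add)
  have "der n1 \<Gamma>1 k1 (case_nat u s 0) L" using * by simp
  from sder_cons[of _ _ _ "case_nat u s", OF this add.IH[OF *(5)]] show ?case
    by (simp add: * case_nat_upd_0 flip: case_nat_plus)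
qed

lemma sder_case_natI1: "sder s n \<Theta> k \<Phi> \<Longrightarrow> sder (case_nat u s) n \<Theta> k (case_nat {#} \<Phi>)"
proof (induction rule: sder.induct)
  case sder_nil
  then show ?case by (simp add: case_nat_zero sder_zero)
next
  case (sder_cons m \<Gamma> k x L n \<Delta> l \<Phi>)
  have "der m \<Gamma> k (case_nat u s (Suc x)) L" using sder_cons.hyps by simp
  from sder.sder_cons[of _ _ _ "case_nat u s", OF this sder_cons.IH] show ?case
    by (simp add: case_nat_upd_Suc flip: case_nat_plus)
qed

text \<open>Restricted to environments of derivations, because only finitely supported environments
  can be collected by \<open>sder\<close>.\<close>

lemma sder_Var:
  "der n \<Gamma> k t L \<Longrightarrow> sder Var 0 \<Gamma> 0 \<Gamma>"
  "mder n \<Gamma> k t M \<Longrightarrow> sder Var 0 \<Gamma> 0 \<Gamma>"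
proof (induction rule: der_mder.inducts)
  case (dvar x L)
  show ?case unfolding sder_single by (rule der_mder.dvar)
next
  case (dnil t)
  show ?case by (rule sder_nil)
next
  case (dcons m \<Gamma> k t L n \<Delta> l M)
  show ?case using sder_plus[OF dcons.IH] by simp
next
  case (dapp m \<Gamma> k t M c L n \<Delta> l u d)
  show ?case using sder_plus[OF dapp.IH] by simp
next
  case (dabs n M \<Gamma> k t L c)
  then show ?case using sder_up[of Var 0 "case_nat M \<Gamma>" 0 M \<Gamma>] by (auto simp: case_nat_inject)
qed

lemma der_inst:
  "der n \<Theta> k (inst t u) L \<longleftrightarrow>
    (\<exists>n1 n2 k1 k2 \<Gamma> \<Delta> M. n = n1 + n2 \<and> k = k1 + k2 \<and> \<Theta> = \<Gamma> + \<Delta> \<and>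
      der n1 (case_nat M \<Gamma>) k1 t L \<and> mder n2 \<Delta> k2 u M)" (is "?l \<longleftrightarrow> ?r")
proof
  assume ?l
  then obtain n1 n2 k1 k2 \<Phi> where *: "n = n1 + n2" "k = k1 + k2" "der n1 \<Phi> k1 t L"
    and s: "sder (case_nat u Var) n2 \<Theta> k2 \<Phi>" unfolding inst_def der_sub by blast
  from sder_case_natD[OF s] obtain \<Delta> where "mder n2 \<Delta> k2 u (\<Phi> 0)" "\<Theta> = (\<Phi> \<circ> Suc) + \<Delta>"
    by (auto simp: add.commute)
  moreover have "der n1 (case_nat (\<Phi> 0) (\<Phi> \<circ> Suc)) k1 t L" using * by (simp add: case_nat_eta)
  ultimately show ?r using * by blast
next
  assume ?r
  then obtain n1 n2 k1 k2 \<Gamma> \<Delta> M where *: "n = n1 + n2" "k = k1 + k2" "\<Theta> = \<Gamma> + \<Delta>"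
    "der n1 (case_nat M \<Gamma>) k1 t L" "mder n2 \<Delta> k2 u M" by blast
  have "sder Var 0 \<Gamma> 0 \<Gamma>"
    using sder_Var(1)[OF *(4)] sder_up[of Var 0 "case_nat M \<Gamma>" 0 M \<Gamma>] by (auto simp: case_nat_inject)
  from sder_plus[OF sder_case_natI0[OF *(5), of Var] sder_case_natI1[OF this, of u]]
  have "sder (case_nat u Var) n2 \<Theta> k2 (case_nat M \<Gamma>)"
    by (simp add: * add.commute flip: case_nat_plus)
  then show ?l unfolding inst_def der_sub using * by blast
qed

text \<open>The redex uses one application rule, whose mark compares the colour of the abstraction,
  recorded in the arrow, with that of the application. Firing the redex removes this rule and this
  mark and nothing else.\<close>

lemma der_beta:
  "der n \<Theta> k (App d (Lam c t) u) L \<longleftrightarrow>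
    (\<exists>n' k'. n = Suc n' \<and> k = k' + mark c d \<and> der n' \<Theta> k' (inst t u) L)"
  unfolding der_inst der_App der_Lam by (fastforce simp: ac_simps)


section \<open>Spine reduction and head normalization\<close>

text \<open>Laxer than head reduction: the redex may also lie below an abstraction that is itself
  applied. Unlike head steps, these steps are closed under application, and their effect on
  derivations is the same.\<close>

inductive spine_step :: "nat \<Rightarrow> 'c tm \<Rightarrow> 'c tm \<Rightarrow> bool" where
  spine_step_beta: "spine_step (mark c d) (App d (Lam c t) u) (inst t u)"
| spine_step_Lam: "spine_step k t u \<Longrightarrow> spine_step k (Lam c t) (Lam c u)"
| spine_step_App: "spine_step k t t' \<Longrightarrow> spine_step k (App d t u) (App d t' u)"

inductive spine_reds :: "nat \<Rightarrow> 'c tm \<Rightarrow> 'c tm \<Rightarrow> bool" where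
  spine_reds_refl: "spine_reds 0 t t"
| spine_reds_step: "spine_step k t u \<Longrightarrow> spine_reds l u v \<Longrightarrow> spine_reds (k + l) t v"

lemma der_spine_step:
  "spine_step k t u \<Longrightarrow> der n \<Gamma> j t L \<longleftrightarrow> (\<exists>n' j'. n = Suc n' \<and> j = j' + k \<and> der n' \<Gamma> j' u L)"
proof (induction arbitrary: n \<Gamma> j L rule: spine_step.induct)
  case (spine_step_beta c d t u)
  show ?case by (rule der_beta)
next
  case (spine_step_Lam k t u c)
  show ?case unfolding der_Lam spine_step_Lam.IH by blast
next
  case (spine_step_App k t t' d u)
  show ?case (is "?l \<longleftrightarrow> ?r")
  proof
    assume ?l
    then obtain n1 n2 \<Gamma>' \<Delta> k' l c M where *: "n = Suc (n1 + n2)" "\<Gamma> = \<Gamma>' + \<Delta>" "j = k' + l + mark c d"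
      "der n1 \<Gamma>' k' t (Arr M c L)" "mder n2 \<Delta> l u M" by (auto simp: der_App)
    from *(4) obtain n' j' where n': "n1 = Suc n'" "k' = j' + k" "der n' \<Gamma>' j' t' (Arr M c L)"
      using spine_step_App.IH by blast
    have "der (Suc (n' + n2)) \<Gamma> (j' + l + mark c d) (App d t' u) L"
      unfolding *(2) using n'(3) *(5) by (rule dapp)
    then show ?r using * n' by (intro exI[of _ "Suc (n' + n2)"] exI[of _ "j' + l + mark c d"]) simp
  next
    assume ?r
    then obtain n' j' where n: "n = Suc n'" "j = j' + k" "der n' \<Gamma> j' (App d t' u) L" by blast
    then obtain n1 n2 \<Gamma>' \<Delta> k' l c M where *: "n' = Suc (n1 + n2)" "\<Gamma> = \<Gamma>' + \<Delta>" "j' = k' + l + mark c d"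
      "der n1 \<Gamma>' k' t' (Arr M c L)" "mder n2 \<Delta> l u M" by (auto simp: der_App)
    from *(4) have "der (Suc n1) \<Gamma>' (k' + k) t (Arr M c L)" using spine_step_App.IH by blast
    from dapp[OF this *(5), of d] show ?l using n * by (simp add: ac_simps)
  qed
qed

lemma der_spine_reds:
  "spine_reds k t u \<Longrightarrow> \<exists>m. \<forall>n \<Gamma> j L. der n \<Gamma> j t L \<longleftrightarrow> (\<exists>n' j'. n = n' + m \<and> j = j' + k \<and> der n' \<Gamma> j' u L)"
proof (induction rule: spine_reds.induct)
  case (spine_reds_refl t)
  show ?case by (rule exI[of _ 0]) simp
next
  case (spine_reds_step k t u l v)
  then obtain m where m: "\<And>n \<Gamma> j L. der n \<Gamma> j u L \<longleftrightarrow> (\<exists>n' j'. n = n' + m \<and> j = j' + l \<and> der n' \<Gamma> j' v L)"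
    by blast
  have "der n \<Gamma> j t L \<longleftrightarrow> (\<exists>n' j'. n = n' + Suc m \<and> j = j' + (k + l) \<and> der n' \<Gamma> j' v L)" for n \<Gamma> j L
    unfolding der_spine_step[OF spine_reds_step.hyps(1)] m by (auto simp: ac_simps)
  then show ?case by blast
qed

definition ty :: "nat \<Rightarrow> 'c tm \<Rightarrow> bool" where
  "ty k t \<longleftrightarrow> (\<exists>n \<Gamma> L. der n \<Gamma> k t L)"

lemma ty_spine_reds: "spine_reds k t u \<Longrightarrow> ty j t \<longleftrightarrow> (\<exists>j'. j = j' + k \<and> ty j' u)"
  unfolding ty_def using der_spine_reds[of k t u] by metis

lemma spine_reds_trans: "spine_reds k t u \<Longrightarrow> spine_reds l u v \<Longrightarrow> spine_reds (k + l) t v"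
  by (induction rule: spine_reds.induct) (auto simp: add.assoc intro: spine_reds.intros)

lemma spine_step_spine_reds: "spine_step k t u \<Longrightarrow> spine_reds k t u"
  using spine_reds_step[OF _ spine_reds_refl] by fastforce

lemma spine_reds_App: "spine_reds k t t' \<Longrightarrow> spine_reds k (App d t u) (App d t' u)"
  by (induction rule: spine_reds.induct) (auto intro: spine_reds.intros spine_step_App)

lemma spine_step_sub: "spine_step k t u \<Longrightarrow> spine_step k (sub s t) (sub s u)"
proof (induction arbitrary: s rule: spine_step.induct)
  case (spine_step_beta c d t u)
  show ?case unfolding sub_inst sub_Lam sub.simps(3) by (rule spine_step.spine_step_beta)
qed (auto intro: spine_step.intros)

lemma spine_reds_sub: "spine_reds k t u \<Longrightarrow> spine_reds k (sub s t) (sub s u)"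
  by (induction rule: spine_reds.induct) (auto intro: spine_reds.intros spine_step_sub)

text \<open>In a term of a single colour no step is an interaction, so black copies of ordinary
  reductions are free.\<close>

lemma spine_step_recolor: "spine_step k t u \<Longrightarrow> spine_step 0 (recolor (\<lambda>_. b) t) (recolor (\<lambda>_. b) u)"
proof (induction rule: spine_step.induct)
  case (spine_step_beta c d t u)
  show ?case using spine_step.spine_step_beta[of b b] by (simp add: recolor_inst mark_def)
qed (auto intro: spine_step.intros)

lemma spine_reds_recolor: "spine_reds k t u \<Longrightarrow> spine_reds 0 (recolor (\<lambda>_. b) t) (recolor (\<lambda>_. b) u)"
proof (induction rule: spine_reds.induct)
  case (spine_reds_step k t u l v)
  from spine_reds.spine_reds_step[OF spine_step_recolor[OF spine_reds_step.hyps(1)] spine_reds_step.IH] show ?case by simp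
qed (rule spine_reds_refl)

lemma spine_step_head_plug: "spine_step k t u \<Longrightarrow> spine_step k (head_plug cs us t) (head_plug cs us u)"
proof -
  assume "spine_step k t u"
  then have "spine_step k (foldl (\<lambda>s (d, u). App d s u) t us) (foldl (\<lambda>s (d, u). App d s u) u us)"
    by (induction us arbitrary: t u) (auto intro: spine_step_App)
  then show ?thesis unfolding head_plug_def
    by (induction cs) (auto simp: fn intro: spine_step_Lam)
qed

section \<open>Head normal forms and typability\<close>

lemma head_red_spine_reds: "head_red k t u \<Longrightarrow> spine_reds k t u"
  by (induction rule: head_red.induct)
    (auto elim!: head_step.cases intro: spine_reds.intros spine_step_head_plug spine_step_beta)

lemma head_shape:
  obtains cs us y where "t = head_plug cs us (Var y)"
  | cs us c d s u where "t = head_plug cs us (App d (Lam c s) u)"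
proof -
  have "\<exists>cs us r. t = head_plug cs us r \<and> ((\<exists>y. r = Var y) \<or> (\<exists>c d s u. r = App d (Lam c s) u))"
  proof (induction t)
    case (Var y)
    have "Var y = head_plug [] [] (Var y)" by (simp add: head_plug_def)
    then show ?case by blast
  next
    case (Lam c t)
    then obtain cs us r where "t = head_plug cs us r" and r: "(\<exists>y. r = Var y) \<or> (\<exists>c d s u. r = App d (Lam c s) u)"
      by blast
    then have "Lam c t = head_plug (c # cs) us r" by (simp add: head_plug_def fn)
    with r show ?case by blast
  next
    case (App d t u)
    then obtain cs us r where t: "t = head_plug cs us r" and r: "(\<exists>y. r = Var y) \<or> (\<exists>c d s u. r = App d (Lam c s) u)"
      by blast
    show ?case
    proof (cases cs)
      case Nil
      then have "App d t u = head_plug [] (us @ [(d, u)]) r" using t by (simp add: head_plug_def)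
      with r show ?thesis by blast
    next
      case (Cons c cs')
      then have "App d t u = head_plug [] [] (App d (Lam c (head_plug cs' us r)) u)"
        using t by (simp add: head_plug_def fn)
      then show ?thesis by blast
    qed
  qed
  then show ?thesis using that by blast
qed

lemma head_normal_shape:
  assumes "head_normal t"
  obtains cs us y where "t = head_plug cs us (Var y)"
  using assms unfolding head_normal_def by (metis head_shape head_step.intros)

text \<open>Every head step removes an application rule, so reduction stops. The index is only an
  upper bound because a derivation may also type the arguments of the head normal form, whose
  interactions head reduction never meets.\<close>

lemma der_converges: "der n \<Gamma> k t L \<Longrightarrow> \<exists>k' \<le> k. converges t k'"
proof (induction n arbitrary: k t)
  case (0 k t)
  have "head_normal t"
    using 0 der_spine_step spine_step_head_plug[OF spine_step_beta] unfolding head_normal_def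
    by (metis head_step.cases nat.distinct(1))
  then show ?case unfolding converges_def by (auto intro: head_red.refl exI[of _ 0])
next
  case (Suc n k t)
  show ?case
  proof (cases "head_normal t")
    case True
    then show ?thesis unfolding converges_def by (auto intro: head_red.refl exI[of _ 0])
  next
    case False
    then obtain j u where s: "head_step j t u" by (auto simp: head_normal_def)
    then have "spine_step j t u" by (auto elim!: head_step.cases intro: spine_step_head_plug spine_step_beta)
    from Suc.prems[unfolded der_spine_step[OF this]] obtain k1 where "k = k1 + j" "der n \<Gamma> k1 u L" by auto
    moreover from Suc.IH[OF this(2)] obtain k' where "k' \<le> k1" "converges u k'" by blast
    ultimately show ?thesis using s unfolding converges_def
      by (metis head_red.step add.commute add_le_mono1)
  qed
qed

text \<open>All arguments receive the empty multi type and each arrow the colour of its application,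
  so neither contributes to the index.\<close>

lemma der_Var_spine:
  "\<exists>T. der (length us) (0(y := {#T#})) 0 (foldl (\<lambda>s (d, u). App d s u) (Var y) us) L"
proof (induction us arbitrary: L rule: rev_induct)
  case Nil
  show ?case by (auto simp: der_Var)
next
  case (snoc x us)
  obtain d u where x: "x = (d, u)" by fastforce
  from snoc[of "Arr {#} d L"] obtain T where
    "der (length us) (0(y := {#T#})) 0 (foldl (\<lambda>s (d, u). App d s u) (Var y) us) (Arr {#} d L)" by blast
  from dapp[OF this dnil[of u], of d] show ?case
    by (auto simp: x mark_def)
qed

text \<open>The head normal form is typed at index 0, and going backwards each interaction step adds
  one. Together with \<open>ty_converges\<close>, the number of interactions is the least typing
  index.\<close>

lemma converges_ty:
  assumes "converges t k"
  shows "ty k t"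
proof -
  obtain h where h: "head_red k t h" "head_normal h" using assms by (auto simp: converges_def)
  then obtain cs us y where "h = head_plug cs us (Var y)" by (meson head_normal_shape)
  moreover have "ty 0 (head_plug cs us (Var y))"
  proof (induction cs)
    case Nil
    have "head_plug [] us (Var y) = foldl (\<lambda>s (d, u). App d s u) (Var y) us" by (simp add: head_plug_def)
    then show ?case unfolding ty_def using der_Var_spine by metis
  next
    case (Cons c cs)
    then obtain n \<Gamma> L where "der n \<Gamma> 0 (head_plug cs us (Var y)) L" by (auto simp: ty_def)
    then have "der n (\<Gamma> \<circ> Suc) 0 (Lam c (head_plug cs us (Var y))) (Arr (\<Gamma> 0) c L)"
      by (simp add: der_Lam case_nat_eta)
    then show ?case unfolding ty_def by (auto simp: head_plug_def fn)
  qed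
  ultimately show ?thesis using ty_spine_reds[OF head_red_spine_reds[OF h(1)]] by auto
qed

lemma ty_converges: "ty k t \<Longrightarrow> \<exists>k' \<le> k. converges t k'"
  unfolding ty_def using der_converges by blast

section \<open>Agreement with the typing rules of the statement\<close>

lemma typing_der: "typing \<Gamma> k t L \<Longrightarrow> \<exists>n. der n \<Gamma> k t L"
  and mtyping_der: "mtyping \<Gamma> k t M \<Longrightarrow> \<exists>n. mder n \<Gamma> k t M"
proof (induction rule: typing_mtyping.inducts)
qed (auto simp: env_plus_eq env_empty_eq intro: der_mder.intros)

lemma der_typing: "der n \<Gamma> k t L \<Longrightarrow> typing \<Gamma> k t L"
  and mder_mtyping: "mder n \<Gamma> k t M \<Longrightarrow> mtyping \<Gamma> k t M"
proof (induction rule: der_mder.inducts)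
qed (auto simp: env_plus_eq env_empty_eq intro: typing_mtyping.intros[unfolded env_plus_eq env_empty_eq])

lemma typing_iff: "typing \<Gamma> k t L \<longleftrightarrow> (\<exists>n. der n \<Gamma> k t L)"
  using typing_der der_typing by blast

lemma mark_unit [simp]: "mark c (d :: unit) = 0"
  by (simp add: mark_def)

lemma mark_same [simp]: "mark c c = 0"
  by (simp add: mark_def)

lemma ptyping_der: "ptyping \<Gamma> t L \<Longrightarrow> \<exists>n. der n \<Gamma> 0 t L"
  and pmtyping_der: "pmtyping \<Gamma> t M \<Longrightarrow> \<exists>n. mder n \<Gamma> 0 t M"
proof (induction rule: ptyping_pmtyping.inducts)
  case (pmany_cons \<Gamma> t L \<Delta> M)
  then show ?case using dcons[of _ \<Gamma> 0 t L _ \<Delta> 0 M] by (auto simp: env_plus_eq)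
next
  case (papp \<Gamma> t M L \<Delta> u)
  then show ?case using dapp[of _ \<Gamma> 0 t M "()" L _ \<Delta> 0 u "()"] by (auto simp: env_plus_eq)
qed (auto simp: env_plus_eq env_empty_eq intro: der_mder.intros)

lemma der_ptyping: "der n \<Gamma> k t L \<Longrightarrow> ptyping \<Gamma> t L"
  and mder_pmtyping: "mder n \<Gamma> k t M \<Longrightarrow> pmtyping \<Gamma> t M"
proof (induction rule: der_mder.inducts)
qed (auto intro: ptyping_pmtyping.intros[unfolded env_plus_eq env_empty_eq])

lemma ptyping_iff: "ptyping \<Gamma> t L \<longleftrightarrow> (\<exists>n k. der n \<Gamma> k t L)"
  using ptyping_der der_ptyping by blast

section \<open>Repainting types and derivations\<close>

abbreviation paint :: "'d \<Rightarrow> 'c ltype \<Rightarrow> 'd ltype" where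
  "paint b \<equiv> map_ltype (\<lambda>_. b)"

definition paint_env :: "'d \<Rightarrow> 'c env \<Rightarrow> 'd env" where
  "paint_env b \<Gamma> = (\<lambda>x. image_mset (paint b) (\<Gamma> x))"

lemma paint_env_simps:
  "paint_env b 0 = 0" "paint_env b (\<Gamma> + \<Delta>) = paint_env b \<Gamma> + paint_env b \<Delta>"
  "paint_env b (0(x := M)) = 0(x := image_mset (paint b) M)"
  by (auto simp: paint_env_def fn fun_eq_iff)

lemma paint_env_case_nat:
  "paint_env b (case_nat M \<Gamma>) = case_nat (image_mset (paint b) M) (paint_env b \<Gamma>)"
  by (rule nat_fun_eqI) (auto simp: paint_env_def)

text \<open>When everything has one colour, no arrow differs from its application, which makes the
  index 0; the rules and their number stay the same.\<close>

lemma der_recolor: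
  "der n \<Gamma> k t L \<Longrightarrow> der n (paint_env b \<Gamma>) 0 (recolor (\<lambda>_. b) t) (paint b L)"
  "mder n \<Gamma> k t M \<Longrightarrow> mder n (paint_env b \<Gamma>) 0 (recolor (\<lambda>_. b) t) (image_mset (paint b) M)"
proof (induction rule: der_mder.inducts)
  case (dvar x L)
  show ?case by (simp add: der_Var paint_env_simps)
next
  case (dnil t)
  show ?case by (simp add: mder_empty paint_env_simps)
next
  case (dcons m \<Gamma> k t L n \<Delta> l M)
  show ?case using der_mder.dcons[OF dcons.IH] by (simp add: paint_env_simps)
next
  case (dabs n M \<Gamma> k t L c)
  then show ?case by (auto simp: der_Lam paint_env_case_nat)
next
  case (dapp m \<Gamma> k t M c L n \<Delta> l u d)
  show ?case using der_mder.dapp[OF dapp.IH(1)[unfolded ltype.map] dapp.IH(2), of b]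
    by (simp add: paint_env_simps)
qed

lemma paint_paint: "paint () (paint b L) = (L :: unit ltype)"
proof -
  have "(\<lambda>_. ()) \<circ> (\<lambda>_. b) = id" by (rule ext) simp
  then show ?thesis by (simp add: ltype.map_comp ltype.map_id)
qed

lemma paint_env_paint_env: "paint_env () (paint_env b \<Gamma>) = (\<Gamma> :: unit env)"
  by (auto simp: paint_env_def paint_paint multiset.map_comp comp_def)

lemma recolor_paint_black: "recolor (\<lambda>_. ()) (paint_black t) = t"
proof -
  have "(\<lambda>_. ()) \<circ> (\<lambda>_. Black) = id" by (rule ext) simp
  then show ?thesis by (simp add: paint_black_def tm.map_comp tm.map_id)
qed


section \<open>Whitening\<close>

inductive_cases whiten_Atom_rE: "whiten p k L (Atom X)"
inductive_cases whiten_Arr_rE: "whiten p k L' (Arr M c L)"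
inductive_cases mwhiten_nil_rE: "mwhiten p k M {#}"

lemma whiten_Arr_r:
  assumes "whiten p k L1 (Arr M c L)"
  obtains k1 k2 M1 c1 L2 where "L1 = Arr M1 c1 L2" "mwhiten (opp p) k1 M1 M" "whiten p k2 L2 L"
    "c1 = c \<and> k = k1 + k2 \<or> p = Pos \<and> c = Black \<and> c1 = White \<and> k = k1 + k2 + 1"
  using assms by (cases rule: whiten_Arr_rE) auto

lemma mwhiten_empty_r: "mwhiten p k M {#} \<longleftrightarrow> k = 0 \<and> M = {#}"
  by (auto elim: mwhiten_nil_rE intro: whiten_mwhiten.nil)

lemma mwhiten_addD:
  "mwhiten p k M' N \<Longrightarrow> N = add_mset L M \<Longrightarrow>
    \<exists>k1 k2 L' M0. k = k1 + k2 \<and> M' = add_mset L' M0 \<and> whiten p k1 L' L \<and> mwhiten p k2 M0 M"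
proof (induction arbitrary: L M rule: whiten_mwhiten.inducts(2)[where ?P1.0 = "\<lambda>_ _ _ _. True"])
  case (cons p k L1' L1 l M1' M1)
  show ?case
  proof (cases "L1 = L")
    case True
    then have "M1 = M" using cons.prems by simp
    then show ?thesis using cons.hyps True by blast
  next
    case False
    with cons.prems obtain K where K: "M1 = add_mset L K" "M = add_mset L1 K"
      by (auto simp: add_eq_conv_ex)
    then obtain k1 k2 L' M0 where *: "l = k1 + k2" "M1' = add_mset L' M0" "whiten p k1 L' L" "mwhiten p k2 M0 K"
      using cons.IH by blast
    have "mwhiten p (k + k2) (add_mset L1' M0) M"
      unfolding K using cons.hyps(1) *(4) by (rule whiten_mwhiten.cons)
    moreover have "k + l = k1 + (k + k2)" "add_mset L1' M1' = add_mset L' (add_mset L1' M0)"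
      using * by simp_all
    ultimately show ?thesis using *(3) by blast
  qed
qed auto

lemma mwhiten_add_r:
  "mwhiten p k M' (add_mset L M) \<longleftrightarrow>
    (\<exists>k1 k2 L' M0. k = k1 + k2 \<and> M' = add_mset L' M0 \<and> whiten p k1 L' L \<and> mwhiten p k2 M0 M)"
  using mwhiten_addD whiten_mwhiten.cons by blast

lemma mwhiten_single_r: "mwhiten p k M' {#L#} \<longleftrightarrow> (\<exists>L'. M' = {#L'#} \<and> whiten p k L' L)"
  by (auto simp: mwhiten_add_r mwhiten_empty_r)

lemma mwhiten_single: "whiten p k L' L \<Longrightarrow> mwhiten p k {#L'#} {#L#}"
  by (simp add: mwhiten_single_r)

lemma mwhiten_plus_r:
  "mwhiten p k M' (M + N) \<longleftrightarrow>
    (\<exists>k1 k2 M0 N0. k = k1 + k2 \<and> M' = M0 + N0 \<and> mwhiten p k1 M0 M \<and> mwhiten p k2 N0 N)"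
proof (induction M arbitrary: k M')
  case empty
  show ?case by (auto simp: mwhiten_empty_r)
next
  case (add L M)
  show ?case (is "?l \<longleftrightarrow> ?r")
  proof
    assume ?l
    then obtain a b L' K where 1: "k = a + b" "M' = add_mset L' K" "whiten p a L' L" "mwhiten p b K (M + N)"
      by (auto simp: mwhiten_add_r)
    then obtain k1 k2 M0 N0 where 2: "b = k1 + k2" "K = M0 + N0" "mwhiten p k1 M0 M" "mwhiten p k2 N0 N"
      using add.IH by blast
    have "mwhiten p (a + k1) (add_mset L' M0) (add_mset L M)" using 1(3) 2(3) by (rule cons)
    moreover have "k = (a + k1) + k2" "M' = add_mset L' M0 + N0" using 1 2 by simp_all
    ultimately show ?r using 2(4) by blast
  next
    assume ?r
    then obtain k1 k2 M0 N0 where *: "k = k1 + k2" "M' = M0 + N0" "mwhiten p k1 M0 (add_mset L M)" "mwhiten p k2 N0 N"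
      by blast
    from *(3) obtain a b L' K where 1: "k1 = a + b" "M0 = add_mset L' K" "whiten p a L' L" "mwhiten p b K M"
      by (auto simp: mwhiten_add_r)
    have "mwhiten p (b + k2) (K + N0) (M + N)" using add.IH 1(4) *(4) by blast
    from cons[OF 1(3) this] show ?l using * 1 by (simp add: ac_simps)
  qed
qed

lemma mwhiten_refl_if: "(\<And>L. L \<in># M \<Longrightarrow> whiten p 0 L L) \<Longrightarrow> mwhiten p 0 M M"
proof (induction M)
  case empty
  show ?case by (rule nil)
next
  case (add L M)
  have "mwhiten p (0 + 0) (add_mset L M) (add_mset L M)"
    using add by (intro cons) auto
  then show ?case by simp
qed

lemma whiten_refl: "whiten p 0 L L"
proof (induction L arbitrary: p)
  case (Atom X)
  show ?case by (rule atom)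
next
  case (Arr M c L)
  have "whiten p (0 + 0) (Arr M c L) (Arr M c L)"
    using Arr by (intro keep mwhiten_refl_if) auto
  then show ?case by simp
qed

lemma mwhiten_refl: "mwhiten p 0 M M"
  by (rule mwhiten_refl_if) (rule whiten_refl)

lemma whiten_trans:
  "whiten p b L2 L3 \<Longrightarrow> whiten p a L1 L2 \<Longrightarrow> whiten p (a + b) L1 L3"
  "mwhiten p b M2 M3 \<Longrightarrow> mwhiten p a M1 M2 \<Longrightarrow> mwhiten p (a + b) M1 M3"
proof (induction arbitrary: a L1 and a M1 rule: whiten_mwhiten.inducts)
  case (atom p X)
  then show ?case by simp
next
  case (flip k M' M l L' L)
  from flip.prems obtain k0 l0 M0 L0 where 0: "a = k0 + l0" "L1 = Arr M0 White L0"
    "mwhiten Neg k0 M0 M'" "whiten Pos l0 L0 L'" by (auto elim: whiten_Arr_r)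
  from whiten_mwhiten.flip[OF flip.IH(1)[OF 0(3)] flip.IH(2)[OF 0(4)]] 0
  show ?case by (simp add: ac_simps)
next
  case (keep p k M' M l L' L c)
  from keep.prems obtain k0 l0 M0 c0 L0 where 0: "L1 = Arr M0 c0 L0"
    "mwhiten (opp p) k0 M0 M'" "whiten p l0 L0 L'"
    and c: "c0 = c \<and> a = k0 + l0 \<or> p = Pos \<and> c = Black \<and> c0 = White \<and> a = k0 + l0 + 1"
    by (rule whiten_Arr_r)
  note IH = keep.IH(1)[OF 0(2)] keep.IH(2)[OF 0(3)]
  show ?case
    using c whiten_mwhiten.keep[OF IH, of c] whiten_mwhiten.flip[of "k0 + k" M0 M "l0 + l" L0 L] IH
    by (auto simp: 0(1) ac_simps)
next
  case (nil p)
  then show ?case by (simp add: mwhiten_empty_r)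
next
  case (cons p k L' L l M' M)
  from cons.prems obtain k1 k2 L0 M0 where *: "a = k1 + k2" "M1 = add_mset L0 M0"
    "whiten p k1 L0 L'" "mwhiten p k2 M0 M'" by (auto simp: mwhiten_add_r)
  from whiten_mwhiten.cons[OF cons.IH(1)[OF *(3)] cons.IH(2)[OF *(4)]] *
  show ?case by (simp add: ac_simps)
qed

lemma opp_opp [simp]: "opp (opp p) = p"
  by (cases p) auto

text \<open>Whitenings of opposite polarities change arrows at disjoint positions and hence commute.\<close>

lemma whiten_diamond:
  "whiten p a L1 L \<Longrightarrow> whiten (opp p) b L2 L \<Longrightarrow> \<exists>B. whiten (opp p) b B L1 \<and> whiten p a B L2"
  "mwhiten p a M1 M \<Longrightarrow> mwhiten (opp p) b M2 M \<Longrightarrow> \<exists>B. mwhiten (opp p) b B M1 \<and> mwhiten p a B M2"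
proof (induction arbitrary: b L2 and b M2 rule: whiten_mwhiten.inducts)
  case (atom p X)
  from atom.prems have "b = 0" "L2 = Atom X" by (auto elim: whiten_Atom_rE)
  then show ?case by (auto intro: whiten_mwhiten.atom)
next
  case (flip k M' M l L' L)
  from flip.prems obtain k0 l0 M0 L0 where 0: "b = k0 + l0" "L2 = Arr M0 Black L0"
    "mwhiten Pos k0 M0 M" "whiten Neg l0 L0 L" by (auto elim: whiten_Arr_r)
  from flip.IH(1)[of k0 M0] 0 obtain BM where BM: "mwhiten Pos k0 BM M'" "mwhiten Neg k BM M0" by auto
  from flip.IH(2)[of l0 L0] 0 obtain BL where BL: "whiten Neg l0 BL L'" "whiten Pos l BL L0" by auto
  have "whiten Neg b (Arr BM White BL) (Arr M' White L')"
    unfolding 0 using BM BL by (intro whiten_mwhiten.keep) auto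
  moreover have "whiten Pos (k + l + 1) (Arr BM White BL) L2"
    unfolding 0 using BM BL by (intro whiten_mwhiten.flip) auto
  ultimately show ?case by auto
next
  case (keep p k M' M l L' L c)
  from keep.prems obtain k0 l0 M0 c0 L0 where 0: "L2 = Arr M0 c0 L0" "mwhiten p k0 M0 M" "whiten (opp p) l0 L0 L"
    and c: "c0 = c \<and> b = k0 + l0 \<or> opp p = Pos \<and> c = Black \<and> c0 = White \<and> b = k0 + l0 + 1"
    by (rule whiten_Arr_r[where p = "opp p", unfolded opp_opp])
  from keep.IH(1)[of k0 M0] 0 obtain BM where BM: "mwhiten p k0 BM M'" "mwhiten (opp p) k BM M0" by auto
  from keep.IH(2)[of l0 L0] 0 obtain BL where BL: "whiten (opp p) l0 BL L'" "whiten p l BL L0" by auto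
  have "whiten p (k + l) (Arr BM c0 BL) L2"
    unfolding 0 using BM BL by (intro whiten_mwhiten.keep)
  moreover have "whiten (opp p) b (Arr BM c0 BL) (Arr M' c L')"
    using c
  proof
    assume "c0 = c \<and> b = k0 + l0"
    then show ?thesis using BM BL whiten_mwhiten.keep[of "opp p" k0 BM M' l0 BL L'] by simp
  next
    assume *: "opp p = Pos \<and> c = Black \<and> c0 = White \<and> b = k0 + l0 + 1"
    then have "p = Neg" by (cases p) auto
    then show ?thesis using * BM BL whiten_mwhiten.flip[of k0 BM M' l0 BL L'] by simp
  qed
  ultimately show ?case by blast
next
  case (nil p)
  then show ?case by (auto simp: mwhiten_empty_r intro: whiten_mwhiten.nil)
next
  case (cons p k L' L l M' M)
  from cons.prems obtain k1 k2 L0 M0 where *: "b = k1 + k2" "M2 = add_mset L0 M0"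
    "whiten (opp p) k1 L0 L" "mwhiten (opp p) k2 M0 M" by (auto simp: mwhiten_add_r)
  from cons.IH(1)[OF *(3)] cons.IH(2)[OF *(4)] show ?case unfolding *
    by (blast intro: whiten_mwhiten.cons)
qed

text \<open>Each unit of a whitening index is one black arrow turned white, so this count drops by
  exactly the index. It is the measure by which the exchange between function and argument
  terminates.\<close>

primrec blacks :: "color ltype \<Rightarrow> nat" where
  "blacks (Atom X) = 0"
| "blacks (Arr M c L) = sum_mset (image_mset blacks M) + blacks L + (if c = Black then 1 else 0)"

lemma blacks_whiten:
  "whiten p k L' L \<Longrightarrow> blacks L = blacks L' + k"
  "mwhiten p k M' M \<Longrightarrow> sum_mset (image_mset blacks M) = sum_mset (image_mset blacks M') + k"
  by (induction rule: whiten_mwhiten.inducts) auto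

lemma whiten_0:
  "whiten p k L' L \<Longrightarrow> k = 0 \<Longrightarrow> L' = L"
  "mwhiten p k M' M \<Longrightarrow> k = 0 \<Longrightarrow> M' = M"
  by (induction rule: whiten_mwhiten.inducts) auto

lemma mwhiten_0: "mwhiten p 0 M' M \<longleftrightarrow> M' = M"
  using whiten_0(2) mwhiten_refl by blast


section \<open>Whitening of environments\<close>

text \<open>\<open>Sum_any\<close> carries its own support, so sums of two finitely supported
  families distribute without adjusting the index set.\<close>

lemma Sum_any_nat: "(\<Sum>x | f x \<noteq> 0. f x) = Sum_any (f :: nat \<Rightarrow> nat)"
  by (simp add: Sum_any.expand_set)

lemma env_whiten_iff:
  "env_whiten p k \<Gamma>' \<Gamma> \<longleftrightarrow>
    (\<exists>f. (\<forall>x. mwhiten p (f x) (\<Gamma>' x) (\<Gamma> x)) \<and> finite {x. f x \<noteq> 0} \<and> k = Sum_any f)"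
  unfolding env_whiten_def Sum_any_nat ..

lemma finite_support_plus:
  "finite {x. f x \<noteq> 0} \<Longrightarrow> finite {x. g x \<noteq> 0} \<Longrightarrow> finite {x. f x + g x \<noteq> (0 :: nat)}"
  by (rule finite_subset[of _ "{x. f x \<noteq> 0} \<union> {x. g x \<noteq> 0}"]) auto

lemma env_whiten_refl: "env_whiten p 0 \<Gamma> \<Gamma>"
  unfolding env_whiten_iff by (rule exI[of _ "\<lambda>_. 0"]) (simp add: mwhiten_refl)

lemma env_whiten_0: "env_whiten p 0 \<Gamma>' \<Gamma> \<longleftrightarrow> \<Gamma>' = \<Gamma>"
proof
  assume "env_whiten p 0 \<Gamma>' \<Gamma>"
  then obtain f where f: "\<And>x. mwhiten p (f x) (\<Gamma>' x) (\<Gamma> x)" "finite {x. f x \<noteq> 0}" "(\<Sum>x | f x \<noteq> 0. f x) = 0"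
    by (auto simp: env_whiten_def)
  then have "f x = 0" for x by auto
  with f(1) show "\<Gamma>' = \<Gamma>" by (metis ext mwhiten_0)
qed (simp add: env_whiten_refl)

lemma env_whiten_plus_r:
  "env_whiten p k \<Gamma>' (\<Gamma> + \<Delta>) \<longleftrightarrow>
    (\<exists>k1 k2 \<Gamma>0 \<Delta>0. k = k1 + k2 \<and> \<Gamma>' = \<Gamma>0 + \<Delta>0 \<and> env_whiten p k1 \<Gamma>0 \<Gamma> \<and> env_whiten p k2 \<Delta>0 \<Delta>)"
    (is "?l \<longleftrightarrow> ?r")
proof
  assume ?l
  then obtain f where f: "\<And>x. mwhiten p (f x) (\<Gamma>' x) (\<Gamma> x + \<Delta> x)" "finite {x. f x \<noteq> 0}" "k = Sum_any f"
    by (auto simp: env_whiten_iff fn)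
  then have "\<forall>x. \<exists>k1 k2 M N. f x = k1 + k2 \<and> \<Gamma>' x = M + N \<and> mwhiten p k1 M (\<Gamma> x) \<and> mwhiten p k2 N (\<Delta> x)"
    by (simp add: mwhiten_plus_r)
  then obtain g h M N where *: "\<And>x. f x = g x + h x" "\<And>x. \<Gamma>' x = M x + N x"
    "\<And>x. mwhiten p (g x) (M x) (\<Gamma> x)" "\<And>x. mwhiten p (h x) (N x) (\<Delta> x)" by metis
  have fin: "finite {x. g x \<noteq> 0}" "finite {x. h x \<noteq> 0}"
    by (rule finite_subset[OF _ f(2)], force simp: *(1))+
  have "k = Sum_any g + Sum_any h"
    unfolding f(3) Sum_any.distrib[OF fin, symmetric] by (simp add: *(1))
  moreover have "\<Gamma>' = M + N" by (auto simp: fun_eq_iff fn *(2))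
  moreover have "env_whiten p (Sum_any g) M \<Gamma>" "env_whiten p (Sum_any h) N \<Delta>"
    unfolding env_whiten_iff using * fin by blast+
  ultimately show ?r by blast
next
  assume ?r
  then obtain g h M N where *: "\<Gamma>' = M + N" "\<And>x. mwhiten p (g x) (M x) (\<Gamma> x)" "\<And>x. mwhiten p (h x) (N x) (\<Delta> x)"
    "finite {x. g x \<noteq> 0}" "finite {x. h x \<noteq> 0}" "k = Sum_any g + Sum_any h" by (auto simp: env_whiten_iff)
  have "k = (\<Sum>x. g x + h x)" using * by (simp add: Sum_any.distrib)
  moreover have "mwhiten p (g x + h x) (\<Gamma>' x) ((\<Gamma> + \<Delta>) x)" for x
    unfolding *(1) plus_fun_apply mwhiten_plus_r using *(2,3) by blast
  ultimately show ?l unfolding env_whiten_iff using finite_support_plus[OF *(4,5)]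
    by (intro exI[of _ "\<lambda>x. g x + h x"]) auto
qed

lemma env_whiten_plus:
  "env_whiten p k1 \<Gamma>' \<Gamma> \<Longrightarrow> env_whiten p k2 \<Delta>' \<Delta> \<Longrightarrow> env_whiten p (k1 + k2) (\<Gamma>' + \<Delta>') (\<Gamma> + \<Delta>)"
  using env_whiten_plus_r by blast

lemma env_whiten_trans:
  assumes "env_whiten p a \<Gamma>1 \<Gamma>2" "env_whiten p b \<Gamma>2 \<Gamma>3"
  shows "env_whiten p (a + b) \<Gamma>1 \<Gamma>3"
proof -
  obtain f g where *: "\<And>x. mwhiten p (f x) (\<Gamma>1 x) (\<Gamma>2 x)" "\<And>x. mwhiten p (g x) (\<Gamma>2 x) (\<Gamma>3 x)"
    "finite {x. f x \<noteq> 0}" "finite {x. g x \<noteq> 0}" "a = Sum_any f" "b = Sum_any g"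
    using assms by (auto simp: env_whiten_iff)
  have "mwhiten p (f x + g x) (\<Gamma>1 x) (\<Gamma>3 x)" for x using whiten_trans(2) * by blast
  moreover have "a + b = (\<Sum>x. f x + g x)" using * by (simp add: Sum_any.distrib)
  ultimately show ?thesis unfolding env_whiten_iff using finite_support_plus[OF *(3,4)]
    by (intro exI[of _ "\<lambda>x. f x + g x"]) auto
qed

lemma env_whiten_diamond:
  assumes "env_whiten p a \<Gamma>1 \<Gamma>" "env_whiten (opp p) b \<Gamma>2 \<Gamma>"
  shows "\<exists>B. env_whiten (opp p) b B \<Gamma>1 \<and> env_whiten p a B \<Gamma>2"
proof -
  obtain f g where *: "\<And>x. mwhiten p (f x) (\<Gamma>1 x) (\<Gamma> x)" "\<And>x. mwhiten (opp p) (g x) (\<Gamma>2 x) (\<Gamma> x)"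
    "finite {x. f x \<noteq> 0}" "finite {x. g x \<noteq> 0}" "a = Sum_any f" "b = Sum_any g"
    using assms by (auto simp: env_whiten_iff)
  have "\<forall>x. \<exists>B. mwhiten (opp p) (g x) B (\<Gamma>1 x) \<and> mwhiten p (f x) B (\<Gamma>2 x)"
    using whiten_diamond(2) * by blast
  then obtain B where "\<And>x. mwhiten (opp p) (g x) (B x) (\<Gamma>1 x) \<and> mwhiten p (f x) (B x) (\<Gamma>2 x)" by metis
  then show ?thesis unfolding env_whiten_iff using * by blast
qed

lemma env_whiten_single: "mwhiten p k M' M \<Longrightarrow> env_whiten p k (0(x := M')) (0(x := M))"
  unfolding env_whiten_iff
  by (rule exI[of _ "\<lambda>y. if y = x then k else 0"]) (auto simp: fn whiten_mwhiten.nil)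

lemma env_whiten_zero_r: "env_whiten p k \<Gamma>' 0 \<longleftrightarrow> k = 0 \<and> \<Gamma>' = 0"
proof
  assume "env_whiten p k \<Gamma>' 0"
  then obtain f where f: "\<And>x. mwhiten p (f x) (\<Gamma>' x) {#}" "finite {x. f x \<noteq> 0}" "k = (\<Sum>x | f x \<noteq> 0. f x)"
    by (auto simp: env_whiten_def fn)
  then show "k = 0 \<and> \<Gamma>' = 0" by (auto simp: mwhiten_empty_r fun_eq_iff fn)
qed (simp add: env_whiten_refl)

lemma env_whiten_case_nat:
  "env_whiten p k (case_nat M' \<Gamma>') (case_nat M \<Gamma>) \<longleftrightarrow>
    (\<exists>k1 k2. k = k1 + k2 \<and> mwhiten p k1 M' M \<and> env_whiten p k2 \<Gamma>' \<Gamma>)" (is "?l \<longleftrightarrow> ?r")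
proof -
  have fin: "finite {x. f x \<noteq> (0::nat)} \<longleftrightarrow> finite {x. f (Suc x) \<noteq> 0}" for f :: "nat \<Rightarrow> nat"
  proof
    assume "finite {x. f x \<noteq> 0}"
    then have "finite (Suc -` {x. f x \<noteq> 0})" by (rule finite_vimageI) simp
    then show "finite {x. f (Suc x) \<noteq> 0}" by simp
  next
    assume "finite {x. f (Suc x) \<noteq> 0}"
    then have "finite (insert 0 (Suc ` {x. f (Suc x) \<noteq> 0}))" by simp
    moreover have "{x. f x \<noteq> 0} \<subseteq> insert 0 (Suc ` {x. f (Suc x) \<noteq> 0})"
    proof
      fix x
      assume "x \<in> {x. f x \<noteq> 0}"
      then show "x \<in> insert 0 (Suc ` {x. f (Suc x) \<noteq> 0})" by (cases x) auto
    qed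
    ultimately show "finite {x. f x \<noteq> 0}" by (rule rev_finite_subset)
  qed
  have sum: "Sum_any f = f 0 + (\<Sum>x. f (Suc x))" if "finite {x. f x \<noteq> 0}" for f :: "nat \<Rightarrow> nat"
  proof -
    have "Sum_any f = sum f (insert 0 (Suc ` {x. f (Suc x) \<noteq> 0}))"
    proof (rule Sum_any.expand_superset)
      show "finite (insert 0 (Suc ` {x. f (Suc x) \<noteq> 0}))" using that fin by simp
      show "{x. f x \<noteq> 0} \<subseteq> insert 0 (Suc ` {x. f (Suc x) \<noteq> 0})"
      proof
        fix x
        assume "x \<in> {x. f x \<noteq> 0}"
        then show "x \<in> insert 0 (Suc ` {x. f (Suc x) \<noteq> 0})" by (cases x) auto
      qed
    qed
    also have "\<dots> = f 0 + sum f (Suc ` {x. f (Suc x) \<noteq> 0})"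
      using that fin by (subst sum.insert) auto
    also have "sum f (Suc ` {x. f (Suc x) \<noteq> 0}) = (\<Sum>x. f (Suc x))"
      by (subst sum.reindex) (auto simp: Sum_any.expand_set fn)
    finally show ?thesis .
  qed
  show ?thesis
  proof
    assume ?l
    then obtain f where f: "\<And>x. mwhiten p (f x) (case_nat M' \<Gamma>' x) (case_nat M \<Gamma> x)"
      "finite {x. f x \<noteq> 0}" "k = Sum_any f" by (auto simp: env_whiten_iff)
    have "mwhiten p (f 0) M' M" "\<And>x. mwhiten p (f (Suc x)) (\<Gamma>' x) (\<Gamma> x)"
      using f(1)[of 0] f(1)[of "Suc _"] by auto
    moreover have "finite {x. f (Suc x) \<noteq> 0}" "k = f 0 + (\<Sum>x. f (Suc x))" using f fin sum by auto
    moreover from calculation(2,3) have "env_whiten p (\<Sum>x. f (Suc x)) \<Gamma>' \<Gamma>"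
      unfolding env_whiten_iff by (intro exI[of _ "\<lambda>x. f (Suc x)"]) simp
    ultimately show ?r by blast
  next
    assume ?r
    then obtain k1 g where *: "mwhiten p k1 M' M" "\<And>x. mwhiten p (g x) (\<Gamma>' x) (\<Gamma> x)"
      "finite {x. g x \<noteq> 0}" "k = k1 + Sum_any g" by (auto simp: env_whiten_iff)
    let ?f = "case_nat k1 g"
    have "mwhiten p (?f x) (case_nat M' \<Gamma>' x) (case_nat M \<Gamma> x)" for x using * by (cases x) auto
    moreover have "finite {x. ?f x \<noteq> 0}" using * by (subst fin) simp
    moreover from sum[OF this] have "k = Sum_any ?f" using * by simp
    ultimately show ?l unfolding env_whiten_iff by blast
  qed
qed


section \<open>Improvement is contextual\<close>

text \<open>
  Closed under application, unlike improvement by itself: negative whitenings are moves of the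
  context, positive ones are answers of the term, and both are paid from one budget.
\<close>

definition stable :: "checkers \<Rightarrow> bool" where
  "stable t \<longleftrightarrow> (\<forall>\<Gamma> k L \<Gamma>1 L1 d1 d2.
    typing \<Gamma> k t L \<longrightarrow> env_whiten Pos d1 \<Gamma>1 \<Gamma> \<longrightarrow> whiten Neg d2 L1 L \<longrightarrow>
    (\<exists>\<Gamma>2 L2 k2 e1 e2. typing \<Gamma>2 k2 t L2 \<and> env_whiten Neg e1 \<Gamma>2 \<Gamma>1 \<and> whiten Pos e2 L2 L1 \<and>
      k2 + e1 + e2 \<le> k + d1 + d2))"

definition mstable :: "checkers \<Rightarrow> bool" where
  "mstable t \<longleftrightarrow> (\<forall>\<Gamma> k M \<Gamma>1 M1 d1 d2.
    mtyping \<Gamma> k t M \<longrightarrow> env_whiten Pos d1 \<Gamma>1 \<Gamma> \<longrightarrow> mwhiten Neg d2 M1 M \<longrightarrow>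
    (\<exists>\<Gamma>2 M2 k2 e1 e2. mtyping \<Gamma>2 k2 t M2 \<and> env_whiten Neg e1 \<Gamma>2 \<Gamma>1 \<and> mwhiten Pos e2 M2 M1 \<and>
      k2 + e1 + e2 \<le> k + d1 + d2))"

lemmas typing_intros = typing_mtyping.intros[unfolded env_plus_eq env_empty_eq]

lemma mtyping_induct [consumes 1, case_names nil cons]:
  assumes m: "mtyping \<Gamma> k t M"
    and nil: "P 0 0 {#}"
    and cons: "\<And>\<Gamma> k L \<Delta> l M. typing \<Gamma> k t L \<Longrightarrow> mtyping \<Delta> l t M \<Longrightarrow> P \<Delta> l M \<Longrightarrow> P (\<Gamma> + \<Delta>) (k + l) (add_mset L M)"
  shows "P \<Gamma> k M"
proof -
  have "t' = t \<longrightarrow> P \<Gamma> k M" if "mtyping \<Gamma> k t' M" for t'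
    using that
  proof (induction rule: typing_mtyping.inducts(2)[where ?P1.0 = "\<lambda>_ _ _ _. True" and ?P2.0 = "\<lambda>\<Gamma> k t' M. t' = t \<longrightarrow> P \<Gamma> k M"])
    case (many_nil t')
    show ?case using nil by (simp add: env_empty_eq)
  next
    case (many_cons \<Gamma> k t' L \<Delta> l M)
    then show ?case unfolding env_plus_eq using cons by blast
  qed auto
  then show ?thesis using m by blast
qed

lemma stableD:
  assumes "stable t" "typing \<Gamma> k t L" "env_whiten Pos d1 \<Gamma>1 \<Gamma>" "whiten Neg d2 L1 L"
  obtains \<Gamma>2 L2 k2 e1 e2 where "typing \<Gamma>2 k2 t L2" "env_whiten Neg e1 \<Gamma>2 \<Gamma>1" "whiten Pos e2 L2 L1"
    "k2 + e1 + e2 \<le> k + d1 + d2"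
  using assms unfolding stable_def by meson

lemma mstableD:
  assumes "mstable t" "mtyping \<Gamma> k t M" "env_whiten Pos d1 \<Gamma>1 \<Gamma>" "mwhiten Neg d2 M1 M"
  obtains \<Gamma>2 M2 k2 e1 e2 where "mtyping \<Gamma>2 k2 t M2" "env_whiten Neg e1 \<Gamma>2 \<Gamma>1" "mwhiten Pos e2 M2 M1"
    "k2 + e1 + e2 \<le> k + d1 + d2"
  using assms unfolding mstable_def by meson

lemma mstable:
  assumes "stable t"
  shows "mstable t"
proof -
  have "mtyping \<Gamma> k t M \<Longrightarrow> env_whiten Pos d1 \<Gamma>1 \<Gamma> \<Longrightarrow> mwhiten Neg d2 M1 M \<Longrightarrow>
    \<exists>\<Gamma>2 M2 k2 e1 e2. mtyping \<Gamma>2 k2 t M2 \<and> env_whiten Neg e1 \<Gamma>2 \<Gamma>1 \<and> mwhiten Pos e2 M2 M1 \<and>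
      k2 + e1 + e2 \<le> k + d1 + d2" for \<Gamma> k M \<Gamma>1 M1 d1 d2
  proof (induction arbitrary: \<Gamma>1 M1 d1 d2 rule: mtyping_induct)
    case nil
    then have "\<Gamma>1 = 0" "M1 = {#}" by (simp_all add: env_whiten_zero_r mwhiten_empty_r)
    then show ?case
      by (metis typing_intros(2) env_whiten_refl mwhiten_refl add_0 zero_le)
  next
    case (cons \<Gamma> k L \<Delta> l M)
    from cons.prems obtain a1 a2 \<Gamma>0 \<Delta>0 where a: "d1 = a1 + a2" "\<Gamma>1 = \<Gamma>0 + \<Delta>0"
      "env_whiten Pos a1 \<Gamma>0 \<Gamma>" "env_whiten Pos a2 \<Delta>0 \<Delta>" by (auto simp: env_whiten_plus_r)
    from cons.prems obtain b1 b2 L0 M0 where b: "d2 = b1 + b2" "M1 = add_mset L0 M0"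
      "whiten Neg b1 L0 L" "mwhiten Neg b2 M0 M" by (auto simp: mwhiten_add_r)
    obtain \<Gamma>2 L2 k2 e1 e2 where 1: "typing \<Gamma>2 k2 t L2" "env_whiten Neg e1 \<Gamma>2 \<Gamma>0" "whiten Pos e2 L2 L0"
      "k2 + e1 + e2 \<le> k + a1 + b1" by (rule stableD[OF assms cons.hyps(1) a(3) b(3)])
    from cons.IH[OF a(4) b(4)] obtain \<Delta>2 M2 l2 f1 f2 where
      2: "mtyping \<Delta>2 l2 t M2" "env_whiten Neg f1 \<Delta>2 \<Delta>0" "mwhiten Pos f2 M2 M0" "l2 + f1 + f2 \<le> l + a2 + b2"
      by blast
    have "mtyping (\<Gamma>2 + \<Delta>2) (k2 + l2) t (add_mset L2 M2)" using 1(1) 2(1) by (rule typing_intros)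
    moreover have "env_whiten Neg (e1 + f1) (\<Gamma>2 + \<Delta>2) \<Gamma>1" unfolding a(2) using 1(2) 2(2) by (rule env_whiten_plus)
    moreover have "mwhiten Pos (e2 + f2) (add_mset L2 M2) M1" unfolding b(2) using 1(3) 2(3) by (rule whiten_mwhiten.cons)
    moreover have "(k2 + l2) + (e1 + f1) + (e2 + f2) \<le> (k + l) + d1 + d2" using 1(4) 2(4) a(1) b(1) by simp
    ultimately show ?case by blast
  qed
  then show ?thesis unfolding mstable_def by blast
qed

text \<open>
  Function and argument answer each other's whitenings in turn. Each answer with a positive cost
  uses up a black arrow, so the exchange stops.
\<close>

lemma app_settle:
  assumes t: "stable t" and s: "mstable s"
  shows "typing \<Gamma>1 k1 t (Arr M1 c L) \<Longrightarrow> mtyping \<Gamma>2 k2 s M2 \<Longrightarrow>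
    mwhiten Neg e M1 M2 \<or> mwhiten Pos e M2 M1 \<Longrightarrow>
    \<exists>\<Gamma>' k' L' e1 e2. typing \<Gamma>' k' (App d t s) L' \<and> env_whiten Neg e1 \<Gamma>' (\<Gamma>1 + \<Gamma>2) \<and> whiten Pos e2 L' L \<and>
      k' + e1 + e2 \<le> k1 + k2 + e + mark c d"
proof (induction "sum_mset (image_mset blacks M1) + sum_mset (image_mset blacks M2)"
    arbitrary: \<Gamma>1 k1 M1 c L \<Gamma>2 k2 M2 e rule: less_induct)
  case less
  show ?case
  proof (cases "e = 0")
    case True
    then have "M1 = M2" using less.prems(3) by (auto simp: mwhiten_0)
    then have "typing (\<Gamma>1 + \<Gamma>2) (k1 + k2 + mark c d) (App d t s) L"
      using less.prems(1,2) by (auto intro: typing_intros)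
    moreover have "(k1 + k2 + mark c d) + 0 + 0 \<le> k1 + k2 + e + mark c d" by simp
    ultimately show ?thesis using env_whiten_refl whiten_refl by blast
  next
    case False
    from less.prems(3) show ?thesis
    proof
      \<comment> \<open>The function demands a negative whitening of the type of the argument, and
        the argument answers with a positive whitening of what is demanded. As \<open>e\<close> is
        positive, \<open>M2'\<close> has fewer black arrows than \<open>M2\<close>.\<close>
      assume w: "mwhiten Neg e M1 M2"
      obtain \<Gamma>2' M2' k2' x y where 1: "mtyping \<Gamma>2' k2' s M2'" "env_whiten Neg x \<Gamma>2' \<Gamma>2" "mwhiten Pos y M2' M1"
        "k2' + x + y \<le> k2 + 0 + e" by (rule mstableD[OF s less.prems(2) env_whiten_refl w])
      have "sum_mset (image_mset blacks M1) + sum_mset (image_mset blacks M2') <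
          sum_mset (image_mset blacks M1) + sum_mset (image_mset blacks M2)"
        using blacks_whiten(2)[OF w] blacks_whiten(2)[OF 1(3)] False by simp
      from less.hyps[OF this less.prems(1) 1(1)] 1(3) obtain \<Gamma>' k' L' e1 e2 where
        2: "typing \<Gamma>' k' (App d t s) L'" "env_whiten Neg e1 \<Gamma>' (\<Gamma>1 + \<Gamma>2')" "whiten Pos e2 L' L"
          "k' + e1 + e2 \<le> k1 + k2' + y + mark c d" by blast
      have "env_whiten Neg (0 + x) (\<Gamma>1 + \<Gamma>2') (\<Gamma>1 + \<Gamma>2)"
        using env_whiten_refl 1(2) by (rule env_whiten_plus)
      from env_whiten_trans[OF 2(2) this] have "env_whiten Neg (e1 + x) \<Gamma>' (\<Gamma>1 + \<Gamma>2)" by simp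
      moreover have "k' + (e1 + x) + e2 \<le> k1 + k2 + e + mark c d" using 1(4) 2(4) by simp
      ultimately show ?thesis using 2(1,3) by blast
    next
      \<comment> \<open>The argument has moved. Seen from the function, this is a negative whitening
        of its arrow type, to which it answers in turn.\<close>
      assume w: "mwhiten Pos e M2 M1"
      have w': "whiten Neg (e + 0) (Arr M2 c L) (Arr M1 c L)"
        using w whiten_refl by (intro keep) auto
      obtain \<Gamma>1' T k1' x y where 1: "typing \<Gamma>1' k1' t T" "env_whiten Neg x \<Gamma>1' \<Gamma>1" "whiten Pos y T (Arr M2 c L)"
        "k1' + x + y \<le> k1 + 0 + (e + 0)" by (rule stableD[OF t less.prems(1) env_whiten_refl w'])
      obtain y1 y2 M1' c' L' where 2: "T = Arr M1' c' L'" "mwhiten Neg y1 M1' M2" "whiten Pos y2 L' L"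
        and c: "c' = c \<and> y = y1 + y2 \<or> Pos = Pos \<and> c = Black \<and> c' = White \<and> y = y1 + y2 + 1"
        by (rule whiten_Arr_r[OF 1(3)]) simp
      \<comment> \<open>If the answer turns the arrow itself white, it pays 1 for that, which covers
        the interaction that the new colour may cause.\<close>
      have c': "y1 + y2 + mark c' d \<le> y + mark c d" using c by (auto simp: mark_def)
      have "sum_mset (image_mset blacks M1') + sum_mset (image_mset blacks M2) <
          sum_mset (image_mset blacks M1) + sum_mset (image_mset blacks M2)"
        using blacks_whiten(2)[OF w] blacks_whiten(2)[OF 2(2)] False by simp
      from less.hyps[OF this 1(1)[unfolded 2(1)] less.prems(2)] 2(2) obtain \<Gamma>' k' L'' e1 e2 where
        3: "typing \<Gamma>' k' (App d t s) L''" "env_whiten Neg e1 \<Gamma>' (\<Gamma>1' + \<Gamma>2)" "whiten Pos e2 L'' L'"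
          "k' + e1 + e2 \<le> k1' + k2 + y1 + mark c' d" by blast
      have "env_whiten Neg (x + 0) (\<Gamma>1' + \<Gamma>2) (\<Gamma>1 + \<Gamma>2)"
        using 1(2) env_whiten_refl by (rule env_whiten_plus)
      from env_whiten_trans[OF 3(2) this] have "env_whiten Neg (e1 + x) \<Gamma>' (\<Gamma>1 + \<Gamma>2)" by simp
      moreover have "whiten Pos (e2 + y2) L'' L" using whiten_trans(1)[OF 2(3) 3(3)] .
      moreover have "k' + (e1 + x) + (e2 + y2) \<le> k1 + k2 + e + mark c d" using 1(4) 3(4) c' by simp
      ultimately show ?thesis using 3(1) by blast
    qed
  qed
qed

inductive_cases typing_VarE: "typing \<Gamma> k (Var x) L"
inductive_cases typing_LamE: "typing \<Gamma> k (Lam c t) L"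
inductive_cases typing_AppE: "typing \<Gamma> k (App d t u) L"

text \<open>A variable copies each move between environment and result, which the diamond property
  permits. An abstraction passes moves on its domain to the bound variable with reversed polarity.
  In an application the function answers first, then the argument, and \<open>app_settle\<close>
  removes the mismatch that remains.\<close>

lemma stable: "stable t"
proof (induction t)
  case (Var x)
  show ?case unfolding stable_def
  proof (intro allI impI)
    fix \<Gamma> k L \<Gamma>1 L1 d1 d2
    assume ty: "typing \<Gamma> k (Var x) L" and e: "env_whiten Pos d1 \<Gamma>1 \<Gamma>" and l: "whiten Neg d2 L1 L"
    have G: "\<Gamma> = 0(x := {#L#})" "k = 0" using ty by (auto elim: typing_VarE simp: env_empty_eq)
    have "env_whiten (opp Pos) d2 (0(x := {#L1#})) \<Gamma>"
      unfolding G using l by (auto intro: env_whiten_single mwhiten_single)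
    from env_whiten_diamond[OF e this] obtain B where
      B: "env_whiten Neg d2 B \<Gamma>1" "env_whiten Pos d1 B (0(x := {#L1#}))" by auto
    then obtain f where f: "\<And>y. mwhiten Pos (f y) (B y) ((0(x := {#L1#})) y)" "finite {x. f x \<noteq> 0}"
      "d1 = (\<Sum>x | f x \<noteq> 0. f x)" unfolding env_whiten_def by blast
    have f0: "f y = 0 \<and> B y = {#}" if "y \<noteq> x" for y
      using f(1)[of y] that by (simp add: fn mwhiten_empty_r)
    from f(1)[of x] obtain L2 where L2: "B x = {#L2#}" "whiten Pos (f x) L2 L1"
      by (auto simp: fn mwhiten_single_r)
    have "B = 0(x := {#L2#})"
    proof
      fix y
      show "B y = (0(x := {#L2#})) y" using f0[of y] L2(1) by (cases "y = x") (simp_all add: fn)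
    qed
    then have "typing B 0 (Var x) L2" using typing_intros(1) by simp
    moreover have "f x \<le> d1"
    proof (cases "f x = 0")
      case False
      then have "f x \<le> (\<Sum>x | f x \<noteq> 0. f x)" using f(2) by (intro member_le_sum) auto
      then show ?thesis using f(3) by simp
    qed simp
    then have "0 + d2 + f x \<le> k + d1 + d2" by simp
    ultimately show "\<exists>\<Gamma>2 L2 k2 e1 e2. typing \<Gamma>2 k2 (Var x) L2 \<and> env_whiten Neg e1 \<Gamma>2 \<Gamma>1 \<and>
        whiten Pos e2 L2 L1 \<and> k2 + e1 + e2 \<le> k + d1 + d2"
      using B(1) L2(2) by blast
  qed
next
  case (Lam c t)
  show ?case unfolding stable_def
  proof (intro allI impI)
    fix \<Gamma> k T \<Gamma>1 T1 d1 d2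
    assume ty: "typing \<Gamma> k (Lam c t) T" and e: "env_whiten Pos d1 \<Gamma>1 \<Gamma>" and w: "whiten Neg d2 T1 T"
    obtain M L where T: "T = Arr M c L" "typing (case_nat M \<Gamma>) k t L" using ty by (auto elim: typing_LamE)
    obtain M1 L1 a b where 1: "T1 = Arr M1 c L1" "mwhiten Pos a M1 M" "whiten Neg b L1 L" "d2 = a + b"
      using w unfolding T by (auto elim: whiten_Arr_r)
    have e': "env_whiten Pos (a + d1) (case_nat M1 \<Gamma>1) (case_nat M \<Gamma>)"
      using 1(2) e by (auto simp: env_whiten_case_nat)
    obtain \<Gamma>2 L2 k2 e1 e2 where 2: "typing \<Gamma>2 k2 t L2" "env_whiten Neg e1 \<Gamma>2 (case_nat M1 \<Gamma>1)"
      "whiten Pos e2 L2 L1" "k2 + e1 + e2 \<le> k + (a + d1) + b"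
      by (rule stableD[OF Lam.IH T(2) e' 1(3)])
    have G: "case_nat (\<Gamma>2 0) (\<Gamma>2 \<circ> Suc) = \<Gamma>2" by (rule case_nat_eta)
    obtain f1 f2 where f: "e1 = f1 + f2" "mwhiten Neg f1 (\<Gamma>2 0) M1" "env_whiten Neg f2 (\<Gamma>2 \<circ> Suc) \<Gamma>1"
      using env_whiten_case_nat[of Neg e1 "\<Gamma>2 0" "\<Gamma>2 \<circ> Suc" M1 \<Gamma>1] 2(2) by (auto simp: G)
    have "typing (\<Gamma>2 \<circ> Suc) k2 (Lam c t) (Arr (\<Gamma>2 0) c L2)"
      using 2(1) by (intro typing_intros) (simp add: G)
    moreover have "whiten Pos (f1 + e2) (Arr (\<Gamma>2 0) c L2) T1"
      unfolding 1(1) using f(2) 2(3) by (intro keep) auto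
    moreover have "k2 + f2 + (f1 + e2) \<le> k + d1 + d2" using 2(4) 1(4) f(1) by simp
    ultimately show "\<exists>\<Gamma>2 L2 k2 e1 e2. typing \<Gamma>2 k2 (Lam c t) L2 \<and> env_whiten Neg e1 \<Gamma>2 \<Gamma>1 \<and>
        whiten Pos e2 L2 T1 \<and> k2 + e1 + e2 \<le> k + d1 + d2"
      using f(3) by blast
  qed
next
  case (App d t s)
  show ?case unfolding stable_def
  proof (intro allI impI)
    fix \<Gamma> k L \<Gamma>1 L1 d1 d2
    assume ty: "typing \<Gamma> k (App d t s) L" and e: "env_whiten Pos d1 \<Gamma>1 \<Gamma>" and w: "whiten Neg d2 L1 L"
    obtain \<Delta>1 \<Delta>2 k1 k2 c M where G: "\<Gamma> = \<Delta>1 + \<Delta>2" "k = k1 + k2 + mark c d"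
      and ts: "typing \<Delta>1 k1 t (Arr M c L)" "mtyping \<Delta>2 k2 s M"
      using ty by (auto elim: typing_AppE simp: env_plus_eq)
    obtain a1 a2 \<Gamma>a \<Gamma>b where a: "d1 = a1 + a2" "\<Gamma>1 = \<Gamma>a + \<Gamma>b" "env_whiten Pos a1 \<Gamma>a \<Delta>1" "env_whiten Pos a2 \<Gamma>b \<Delta>2"
      using e unfolding G env_whiten_plus_r by blast
    have w1: "whiten Neg (0 + d2) (Arr M c L1) (Arr M c L)" using w mwhiten_refl by (intro keep)
    obtain \<Gamma>a' T k1' e1 e2 where 1: "typing \<Gamma>a' k1' t T" "env_whiten Neg e1 \<Gamma>a' \<Gamma>a"
      "whiten Pos e2 T (Arr M c L1)" "k1' + e1 + e2 \<le> k1 + a1 + (0 + d2)"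
      by (rule stableD[OF App.IH(1) ts(1) a(3) w1])
    obtain y1 y2 M1 c' L' where 2: "T = Arr M1 c' L'" "mwhiten Neg y1 M1 M" "whiten Pos y2 L' L1"
      and c: "c' = c \<and> e2 = y1 + y2 \<or> Pos = Pos \<and> c = Black \<and> c' = White \<and> e2 = y1 + y2 + 1"
      by (rule whiten_Arr_r[OF 1(3)]) simp
    have c': "y1 + y2 + mark c' d \<le> e2 + mark c d" using c by (auto simp: mark_def)
    obtain \<Gamma>b' M2 k2' f1 f2 where 3: "mtyping \<Gamma>b' k2' s M2" "env_whiten Neg f1 \<Gamma>b' \<Gamma>b"
      "mwhiten Pos f2 M2 M1" "k2' + f1 + f2 \<le> k2 + a2 + y1"
      by (rule mstableD[OF mstable[OF App.IH(2)] ts(2) a(4) 2(2)])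
    from app_settle[OF App.IH(1) mstable[OF App.IH(2)] 1(1)[unfolded 2(1)] 3(1), of f2 d] 3(3)
    obtain \<Gamma>' k' L'' g1 g2 where 4: "typing \<Gamma>' k' (App d t s) L''" "env_whiten Neg g1 \<Gamma>' (\<Gamma>a' + \<Gamma>b')"
      "whiten Pos g2 L'' L'" "k' + g1 + g2 \<le> k1' + k2' + f2 + mark c' d" by blast
    have "env_whiten Neg (g1 + (e1 + f1)) \<Gamma>' \<Gamma>1"
      unfolding a(2) using env_whiten_trans[OF 4(2) env_whiten_plus[OF 1(2) 3(2)]] .
    moreover have "whiten Pos (g2 + y2) L'' L1" using whiten_trans(1)[OF 2(3) 4(3)] .
    moreover have "k' + (g1 + (e1 + f1)) + (g2 + y2) \<le> k + d1 + d2"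
      using 1(4) 3(4) 4(4) c' a(1) G(2) by simp
    ultimately show "\<exists>\<Gamma>2 L2 k2 e1 e2. typing \<Gamma>2 k2 (App d t s) L2 \<and> env_whiten Neg e1 \<Gamma>2 \<Gamma>1 \<and>
        whiten Pos e2 L2 L1 \<and> k2 + e1 + e2 \<le> k + d1 + d2"
      using 4(1) by blast
  qed
qed

section \<open>Improvement inside contexts\<close>

lemma pwc_checkers_iff:
  "pwc_checkers t u \<longleftrightarrow> (\<forall>\<Gamma> L k. typing \<Gamma> k t L \<longrightarrow>
    (\<exists>\<Gamma>' L' k' e1 e2. typing \<Gamma>' k' u L' \<and> env_whiten Neg e1 \<Gamma>' \<Gamma> \<and> whiten Pos e2 L' L \<and> k' + e1 + e2 \<le> k))"
proof -
  have "(\<exists>d. judg_whiten Pos d (\<Gamma>', L') (\<Gamma>, L) \<and> k' + d \<le> k) \<longleftrightarrow>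
    (\<exists>e1 e2. env_whiten Neg e1 \<Gamma>' \<Gamma> \<and> whiten Pos e2 L' L \<and> k' + e1 + e2 \<le> k)" (is "?l \<longleftrightarrow> ?r")
    for \<Gamma>' L' k' \<Gamma> L k
  proof
    assume ?l
    then obtain e1 e2 where "env_whiten Neg e1 \<Gamma>' \<Gamma>" "whiten Pos e2 L' L" "k' + (e1 + e2) \<le> k"
      unfolding judg_whiten_def by auto
    then show ?r unfolding add.assoc by blast
  next
    assume ?r
    then obtain e1 e2 where "env_whiten Neg e1 \<Gamma>' \<Gamma>" "whiten Pos e2 L' L" "k' + (e1 + e2) \<le> k"
      unfolding add.assoc by blast
    then show ?l unfolding judg_whiten_def by (intro exI[of _ "e1 + e2"]) auto
  qed
  then show ?thesis unfolding pwc_checkers_def interp_def by simp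
qed

lemma pwc_checkers_mtyping:
  assumes tu: "pwc_checkers t u"
  shows "mtyping \<Gamma> k t M \<Longrightarrow>
    \<exists>\<Gamma>' M' k' e1 e2. mtyping \<Gamma>' k' u M' \<and> env_whiten Neg e1 \<Gamma>' \<Gamma> \<and> mwhiten Pos e2 M' M \<and> k' + e1 + e2 \<le> k"
proof (induction rule: mtyping_induct)
  case nil
  show ?case
    by (metis typing_intros(2) env_whiten_refl mwhiten_refl add_0 zero_le)
next
  case (cons \<Gamma> k L \<Delta> l M)
  with tu obtain \<Gamma>2 L2 k2 e1 e2 where 1: "typing \<Gamma>2 k2 u L2" "env_whiten Neg e1 \<Gamma>2 \<Gamma>" "whiten Pos e2 L2 L"
      "k2 + e1 + e2 \<le> k" unfolding pwc_checkers_iff by blast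
  from cons obtain \<Delta>2 M2 l2 f1 f2 where 2: "mtyping \<Delta>2 l2 u M2" "env_whiten Neg f1 \<Delta>2 \<Delta>"
      "mwhiten Pos f2 M2 M" "l2 + f1 + f2 \<le> l" by blast
    have "mtyping (\<Gamma>2 + \<Delta>2) (k2 + l2) u (add_mset L2 M2)" using 1(1) 2(1) by (rule typing_intros)
    moreover have "env_whiten Neg (e1 + f1) (\<Gamma>2 + \<Delta>2) (\<Gamma> + \<Delta>)" using 1(2) 2(2) by (rule env_whiten_plus)
    moreover have "mwhiten Pos (e2 + f2) (add_mset L2 M2) (add_mset L M)" using 1(3) 2(3) by (rule whiten_mwhiten.cons)
    moreover have "(k2 + l2) + (e1 + f1) + (e2 + f2) \<le> k + l" using 1(4) 2(4) by simp
    ultimately show ?case by blast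
qed

lemma pwc_checkers_Lam:
  assumes "pwc_checkers t u"
  shows "pwc_checkers (Lam c t) (Lam c u)"
  unfolding pwc_checkers_iff
proof (intro allI impI)
  fix \<Gamma> T k
  assume "typing \<Gamma> k (Lam c t) T"
  then obtain M L where T: "T = Arr M c L" "typing (case_nat M \<Gamma>) k t L" by (auto elim: typing_LamE)
  obtain \<Gamma>2 L2 k2 e1 e2 where 2: "typing \<Gamma>2 k2 u L2" "env_whiten Neg e1 \<Gamma>2 (case_nat M \<Gamma>)"
    "whiten Pos e2 L2 L" "k2 + e1 + e2 \<le> k"
    using assms T(2) unfolding pwc_checkers_iff by blast
  have G: "case_nat (\<Gamma>2 0) (\<Gamma>2 \<circ> Suc) = \<Gamma>2" by (rule case_nat_eta)
  obtain f1 f2 where f: "e1 = f1 + f2" "mwhiten Neg f1 (\<Gamma>2 0) M" "env_whiten Neg f2 (\<Gamma>2 \<circ> Suc) \<Gamma>"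
    using env_whiten_case_nat[of Neg e1 "\<Gamma>2 0" "\<Gamma>2 \<circ> Suc" M \<Gamma>] 2(2) by (auto simp: G)
  have "typing (\<Gamma>2 \<circ> Suc) k2 (Lam c u) (Arr (\<Gamma>2 0) c L2)"
    using 2(1) by (intro typing_intros) (simp add: G)
  moreover have "whiten Pos (f1 + e2) (Arr (\<Gamma>2 0) c L2) T"
    unfolding T using f(2) 2(3) by (intro keep) auto
  moreover have "k2 + f2 + (f1 + e2) \<le> k" using 2(4) f(1) by simp
  ultimately show "\<exists>\<Gamma>' L' k' e1 e2. typing \<Gamma>' k' (Lam c u) L' \<and> env_whiten Neg e1 \<Gamma>' \<Gamma> \<and>
      whiten Pos e2 L' T \<and> k' + e1 + e2 \<le> k"
    using f(3) by blast
qed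

text \<open>The improved type of \<open>u\<close> may ask for an argument type that \<open>s\<close>
  does not have; since \<open>u\<close> and \<open>s\<close> are both stable, they can settle the
  difference within the budget.\<close>

lemma pwc_checkers_AppL:
  assumes "pwc_checkers t u"
  shows "pwc_checkers (App d t s) (App d u s)"
  unfolding pwc_checkers_iff
proof (intro allI impI)
  fix \<Gamma> L k
  assume "typing \<Gamma> k (App d t s) L"
  then obtain \<Delta>1 \<Delta>2 k1 k2 c M where G: "\<Gamma> = \<Delta>1 + \<Delta>2" "k = k1 + k2 + mark c d"
    and ts: "typing \<Delta>1 k1 t (Arr M c L)" "mtyping \<Delta>2 k2 s M"
    by (auto elim: typing_AppE simp: env_plus_eq)
  obtain \<Gamma>a T k1' e1 e2 where 1: "typing \<Gamma>a k1' u T" "env_whiten Neg e1 \<Gamma>a \<Delta>1"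
    "whiten Pos e2 T (Arr M c L)" "k1' + e1 + e2 \<le> k1"
    using assms ts(1) unfolding pwc_checkers_iff by blast
  obtain y1 y2 M1 c' L' where 2: "T = Arr M1 c' L'" "mwhiten Neg y1 M1 M" "whiten Pos y2 L' L"
    and c: "c' = c \<and> e2 = y1 + y2 \<or> Pos = Pos \<and> c = Black \<and> c' = White \<and> e2 = y1 + y2 + 1"
    by (rule whiten_Arr_r[OF 1(3)]) simp
  have c': "y1 + y2 + mark c' d \<le> e2 + mark c d" using c by (auto simp: mark_def)
  from app_settle[OF stable mstable[OF stable] 1(1)[unfolded 2(1)] ts(2), of y1 d] 2(2)
  obtain \<Gamma>' k' L'' g1 g2 where 4: "typing \<Gamma>' k' (App d u s) L''" "env_whiten Neg g1 \<Gamma>' (\<Gamma>a + \<Delta>2)"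
    "whiten Pos g2 L'' L'" "k' + g1 + g2 \<le> k1' + k2 + y1 + mark c' d" by blast
  have "env_whiten Neg (g1 + (e1 + 0)) \<Gamma>' \<Gamma>"
    unfolding G using env_whiten_trans[OF 4(2) env_whiten_plus[OF 1(2) env_whiten_refl]] .
  moreover have "whiten Pos (g2 + y2) L'' L" using whiten_trans(1)[OF 2(3) 4(3)] .
  moreover have "k' + (g1 + (e1 + 0)) + (g2 + y2) \<le> k" using 1(4) 4(4) c' G(2) by simp
  ultimately show "\<exists>\<Gamma>' L' k' e1 e2. typing \<Gamma>' k' (App d u s) L' \<and> env_whiten Neg e1 \<Gamma>' \<Gamma> \<and>
      whiten Pos e2 L' L \<and> k' + e1 + e2 \<le> k"
    using 4(1) by blast
qed

lemma pwc_checkers_AppR: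
  assumes "pwc_checkers t u"
  shows "pwc_checkers (App d s t) (App d s u)"
  unfolding pwc_checkers_iff
proof (intro allI impI)
  fix \<Gamma> L k
  assume "typing \<Gamma> k (App d s t) L"
  then obtain \<Delta>1 \<Delta>2 k1 k2 c M where G: "\<Gamma> = \<Delta>1 + \<Delta>2" "k = k1 + k2 + mark c d"
    and ts: "typing \<Delta>1 k1 s (Arr M c L)" "mtyping \<Delta>2 k2 t M"
    by (auto elim: typing_AppE simp: env_plus_eq)
  obtain \<Gamma>b M' k2' e1 e2 where 1: "mtyping \<Gamma>b k2' u M'" "env_whiten Neg e1 \<Gamma>b \<Delta>2"
    "mwhiten Pos e2 M' M" "k2' + e1 + e2 \<le> k2"
    using pwc_checkers_mtyping[OF assms ts(2)] by blast
  from app_settle[OF stable mstable[OF stable] ts(1) 1(1), of e2 d] 1(3)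
  obtain \<Gamma>' k' L'' g1 g2 where 4: "typing \<Gamma>' k' (App d s u) L''" "env_whiten Neg g1 \<Gamma>' (\<Delta>1 + \<Gamma>b)"
    "whiten Pos g2 L'' L" "k' + g1 + g2 \<le> k1 + k2' + e2 + mark c d" by blast
  have "env_whiten Neg (g1 + (0 + e1)) \<Gamma>' \<Gamma>"
    unfolding G using env_whiten_trans[OF 4(2) env_whiten_plus[OF env_whiten_refl 1(2)]] .
  moreover have "k' + (g1 + (0 + e1)) + g2 \<le> k" using 1(4) 4(4) G(2) by simp
  ultimately show "\<exists>\<Gamma>' L' k' e1 e2. typing \<Gamma>' k' (App d s u) L' \<and> env_whiten Neg e1 \<Gamma>' \<Gamma> \<and>
      whiten Pos e2 L' L \<and> k' + e1 + e2 \<le> k"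
    using 4(1,3) by blast
qed

lemma pwc_checkers_plug: "pwc_checkers t u \<Longrightarrow> pwc_checkers (plug C t) (plug C u)"
  by (induction C) (auto intro: pwc_checkers_Lam pwc_checkers_AppL pwc_checkers_AppR)

text \<open>The number of interactions is a least typing index, so the improved typing bounds it,
  and the whitening costs are dropped.\<close>

lemma pwc_int_imp: "pwc t u \<Longrightarrow> int_imp t u"
  unfolding pwc_def int_imp_def
proof (intro allI impI)
  fix C :: "color ctx" and k
  assume "pwc_checkers (paint_black t) (paint_black u)" "converges (plug C (paint_black t)) k"
  then obtain \<Gamma> L k' where "k' \<le> k" "typing \<Gamma> k' (plug C (paint_black u)) L"
    using pwc_checkers_plug[of "paint_black t" "paint_black u" C] converges_ty[of "plug C (paint_black t)" k]
    unfolding pwc_checkers_iff ty_def typing_iff[symmetric]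
    by (metis add.commute add_leE der_typing)
  then show "\<exists>k' \<le> k. converges (plug C (paint_black u)) k'"
    using ty_converges unfolding ty_def by (metis le_trans typing_iff)
qed

lemma pwc_rel_le:
  assumes "pwc t u"
  shows "rel_le t u"
proof -
  have "ptyping \<Gamma> u L" if pt: "ptyping \<Gamma> t L" for \<Gamma> L
  proof -
    obtain n k where "der n \<Gamma> k t L" using pt by (auto simp: ptyping_iff)
    from der_recolor(1)[OF this, of Black] have "typing (paint_env Black \<Gamma>) 0 (paint_black t) (paint Black L)"
      by (auto simp: paint_black_def intro: der_typing)
    \<comment> \<open>Index 0 leaves no budget, so both whitenings are trivial.\<close>
    then obtain \<Gamma>' L' where "typing \<Gamma>' 0 (paint_black u) L'" "env_whiten Neg 0 \<Gamma>' (paint_env Black \<Gamma>)"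
      "whiten Pos 0 L' (paint Black L)"
      using assms unfolding pwc_def pwc_checkers_iff by fastforce
    then have "typing (paint_env Black \<Gamma>) 0 (paint_black u) (paint Black L)"
      using whiten_0(1) by (auto simp: env_whiten_0)
    then obtain m where "der m (paint_env Black \<Gamma>) 0 (paint_black u) (paint Black L)" by (auto simp: typing_iff)
    from der_recolor(1)[OF this, of "()"] have "der m \<Gamma> 0 u L"
      by (simp add: recolor_paint_black paint_paint paint_env_paint_env)
    then show ?thesis by (rule der_ptyping)
  qed
  then show ?thesis by (auto simp: rel_le_def rel_interp_def)
qed


section \<open>Typing head normal forms\<close>

definition lamc :: "'c \<Rightarrow> nat \<Rightarrow> 'c tm \<Rightarrow> 'c tm" where
  "lamc c n t = (Lam c ^^ n) t"

definition appc :: "'c \<Rightarrow> 'c tm \<Rightarrow> 'c tm list \<Rightarrow> 'c tm" where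
  "appc d t us = foldl (App d) t us"

text \<open>Values are listed from the outermost binder inwards, so the last one lands at index 0.
  The same function serves for environments and for substitutions.\<close>

definition ext :: "'a list \<Rightarrow> (nat \<Rightarrow> 'a) \<Rightarrow> nat \<Rightarrow> 'a" where
  "ext as s = foldl (\<lambda>s a. case_nat a s) s as"

definition arrs :: "'c \<Rightarrow> 'c ltype multiset list \<Rightarrow> 'c ltype \<Rightarrow> 'c ltype" where
  "arrs c Ms L = foldr (\<lambda>M. Arr M c) Ms L"

lemma lamc_simps [simp]: "lamc c 0 t = t" "lamc c (Suc n) t = Lam c (lamc c n t)"
  by (simp_all add: lamc_def fn)

lemma appc_simps [simp]: "appc d t [] = t" "appc d t (u # us) = appc d (App d t u) us"
  by (simp_all add: appc_def)

lemma appc_append: "appc d t (us @ vs) = appc d (appc d t us) vs"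
  by (simp add: appc_def)

lemma ext_simps [simp]: "ext [] s = s" "ext (a # as) s = ext as (case_nat a s)"
  by (simp_all add: ext_def)

lemma ext_append: "ext (as @ bs) s = ext bs (ext as s)"
  by (simp add: ext_def)

lemma ext_nth: "ext as s i = (if i < length as then as ! (length as - 1 - i) else s (i - length as))"
proof (induction as arbitrary: s i)
  case Nil
  show ?case by simp
next
  case (Cons a as)
  consider "i < length as" | "i = length as" | j where "i = Suc (length as + j)"
    by (metis less_iff_Suc_add linorder_neqE_nat)
  then show ?case
  proof cases
    case 1
    then obtain j where "length as = Suc (i + j)" using less_iff_Suc_add by auto
    then show ?thesis by (simp add: Cons)
  qed (simp_all add: Cons)
qed

lemma arrs_simps [simp]: "arrs c [] L = L" "arrs c (M # Ms) L = Arr M c (arrs c Ms L)"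
  by (simp_all add: arrs_def fn)

lemma arrs_append: "arrs c (Ms @ Ns) L = arrs c Ms (arrs c Ns L)"
  by (simp add: arrs_def)

lemma ext_surj: "\<exists>as s. length as = n \<and> f = ext as s"
proof (induction n)
  case 0
  show ?case by (intro exI[of _ "[]"] exI[of _ f]) simp
next
  case (Suc n)
  then obtain as s where "length as = n" "f = ext as s" by blast
  then show ?case
    by (intro exI[of _ "s 0 # as"] exI[of _ "s \<circ> Suc"]) (simp add: case_nat_eta)
qed

lemma lams_lamc: "lams n t = lamc () n t"
  by (simp add: lams_def lamc_def)

lemma apps_appc: "apps t us = appc () t us"
  by (simp add: apps_def appc_def)

lemma paint_black_simps [simp]:
  "paint_black (Var i) = Var i" "paint_black (Lam c t) = Lam Black (paint_black t)"
  "paint_black (App d t u) = App Black (paint_black t) (paint_black u)"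
  by (simp_all add: paint_black_def)

lemma paint_black_lams: "paint_black (lams n t) = lamc Black n (paint_black t)"
  unfolding lams_lamc by (induction n) auto

lemma paint_black_apps: "paint_black (apps t us) = appc Black (paint_black t) (map paint_black us)"
  unfolding apps_appc by (induction us arbitrary: t) auto

lemma paint_black_ren: "paint_black (ren f t) = ren f (paint_black t)"
  by (simp add: paint_black_def recolor_ren)

lemma sub_appc: "sub s (appc d t us) = appc d (sub s t) (map (sub s) us)"
  by (induction us arbitrary: t) auto

lemma ren_appc: "ren f (appc d t us) = appc d (ren f t) (map (ren f) us)"
  by (induction us arbitrary: t) auto

lemma der_lamc:
  "der n \<Gamma> k (lamc c m t) T \<longleftrightarrow> (\<exists>Ms L. length Ms = m \<and> T = arrs c Ms L \<and> der n (ext Ms \<Gamma>) k t L)"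
proof (induction m arbitrary: \<Gamma> T)
  case 0
  show ?case by simp
next
  case (Suc m)
  show ?case (is "?l \<longleftrightarrow> ?r")
  proof
    assume ?l
    then obtain M L where 1: "T = Arr M c L" "der n (case_nat M \<Gamma>) k (lamc c m t) L" by (auto simp: der_Lam)
    then obtain Ms L' where "length Ms = m" "L = arrs c Ms L'" "der n (ext Ms (case_nat M \<Gamma>)) k t L'"
      by (auto simp: Suc)
    then show ?r using 1 by (intro exI[of _ "M # Ms"] exI[of _ L']) simp
  next
    assume ?r
    then obtain Ms L where "length Ms = Suc m" "T = arrs c Ms L" "der n (ext Ms \<Gamma>) k t L" by blast
    then show ?l by (cases Ms) (auto simp: der_Lam Suc)
  qed
qed

lemma der_lamcI: "der n (ext Ms \<Gamma>) k t L \<Longrightarrow> der n \<Gamma> k (lamc c (length Ms) t) (arrs c Ms L)"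
  unfolding der_lamc by blast

section \<open>Spines of arguments under a head\<close>

primrec spine_der :: "'c \<Rightarrow> nat \<Rightarrow> 'c env \<Rightarrow> nat \<Rightarrow> 'c tm list \<Rightarrow> 'c ltype \<Rightarrow> 'c ltype \<Rightarrow> bool" where
  "spine_der d n \<Gamma> k [] T L \<longleftrightarrow> n = 0 \<and> k = 0 \<and> \<Gamma> = 0 \<and> T = L"
| "spine_der d n \<Gamma> k (u # us) T L \<longleftrightarrow> (\<exists>n1 n2 \<Delta>1 \<Delta>2 k1 k2 M c T'. n = Suc (n1 + n2) \<and> \<Gamma> = \<Delta>1 + \<Delta>2 \<and>
    k = k1 + k2 + mark c d \<and> T = Arr M c T' \<and> mder n1 \<Delta>1 k1 u M \<and> spine_der d n2 \<Delta>2 k2 us T' L)"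

lemma der_appc:
  "der n \<Gamma> k (appc d t us) L \<longleftrightarrow>
    (\<exists>n1 n2 \<Gamma>1 \<Gamma>2 k1 k2 T. n = n1 + n2 \<and> \<Gamma> = \<Gamma>1 + \<Gamma>2 \<and> k = k1 + k2 \<and> der n1 \<Gamma>1 k1 t T \<and> spine_der d n2 \<Gamma>2 k2 us T L)"
proof (induction us arbitrary: t n \<Gamma> k)
  case Nil
  show ?case by simp
next
  case (Cons u us)
  show ?case (is "?l \<longleftrightarrow> ?r")
  proof
    assume ?l
    then obtain n1 n2 \<Gamma>1 \<Gamma>2 k1 k2 T where 1: "n = n1 + n2" "\<Gamma> = \<Gamma>1 + \<Gamma>2" "k = k1 + k2"
      "der n1 \<Gamma>1 k1 (App d t u) T" "spine_der d n2 \<Gamma>2 k2 us T L" unfolding appc_simps Cons by blast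
    then obtain m1 m2 \<Delta>1 \<Delta>2 j1 j2 c M where 2: "n1 = Suc (m1 + m2)" "\<Gamma>1 = \<Delta>1 + \<Delta>2" "k1 = j1 + j2 + mark c d"
      "der m1 \<Delta>1 j1 t (Arr M c T)" "mder m2 \<Delta>2 j2 u M" by (auto simp: der_App)
    have "spine_der d (Suc (m2 + n2)) (\<Delta>2 + \<Gamma>2) (j2 + k2 + mark c d) (u # us) (Arr M c T) L"
      using 1(5) 2(5) unfolding spine_der.simps by blast
    moreover have "n = m1 + Suc (m2 + n2)" "\<Gamma> = \<Delta>1 + (\<Delta>2 + \<Gamma>2)" "k = j1 + (j2 + k2 + mark c d)"
      using 1 2 by (simp_all add: ac_simps)
    ultimately show ?r using 2(4) by blast
  next
    assume ?r
    then obtain m1 m2 \<Delta>1 \<Delta> j1 j2 T where 1: "n = m1 + m2" "\<Gamma> = \<Delta>1 + \<Delta>" "k = j1 + j2"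
      "der m1 \<Delta>1 j1 t T" "spine_der d m2 \<Delta> j2 (u # us) T L" by blast
    from 1(5) obtain n1 n2 \<Delta>2 \<Delta>3 k1 k2 M c T' where 2: "m2 = Suc (n1 + n2)" "\<Delta> = \<Delta>2 + \<Delta>3"
      "j2 = k1 + k2 + mark c d" "T = Arr M c T'" "mder n1 \<Delta>2 k1 u M" "spine_der d n2 \<Delta>3 k2 us T' L"
      unfolding spine_der.simps by blast
    have "der (Suc (m1 + n1)) (\<Delta>1 + \<Delta>2) (j1 + k1 + mark c d) (App d t u) T'"
      using 1(4)[unfolded 2(4)] 2(5) by (rule dapp)
    moreover have "n = Suc (m1 + n1) + n2" "\<Gamma> = (\<Delta>1 + \<Delta>2) + \<Delta>3" "k = (j1 + k1 + mark c d) + k2"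
      using 1 2 by (simp_all add: ac_simps)
    ultimately show ?l unfolding appc_simps Cons using 2(6) by blast
  qed
qed

lemma der_appc_Var:
  "der n \<Gamma> k (appc d (Var y) us) L \<longleftrightarrow> (\<exists>\<Delta> T. \<Gamma> = 0(y := {#T#}) + \<Delta> \<and> spine_der d n \<Delta> k us T L)"
    (is "?l \<longleftrightarrow> ?r")
proof
  assume ?l
  then obtain \<Gamma>1 \<Gamma>2 T where "\<Gamma> = \<Gamma>1 + \<Gamma>2" "\<Gamma>1 = 0(y := {#T#})" "spine_der d n \<Gamma>2 k us T L"
    unfolding der_appc der_Var by auto
  then show ?r by blast
next
  assume ?r
  then obtain \<Delta> T where "\<Gamma> = 0(y := {#T#}) + \<Delta>" "spine_der d n \<Delta> k us T L" by blast
  moreover have "n = 0 + n" "k = 0 + k" by simp_all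
  ultimately show ?l unfolding der_appc using dvar[of y T] by blast
qed

lemma der_appc_VarI: "spine_der d n \<Delta> k us T L \<Longrightarrow> der n (0(y := {#T#}) + \<Delta>) k (appc d (Var y) us) L"
  unfolding der_appc_Var by blast

lemma spine_der_append:
  "spine_der d n \<Gamma> k (us @ vs) T L \<longleftrightarrow>
    (\<exists>n1 n2 \<Gamma>1 \<Gamma>2 k1 k2 T'. n = n1 + n2 \<and> \<Gamma> = \<Gamma>1 + \<Gamma>2 \<and> k = k1 + k2 \<and>
      spine_der d n1 \<Gamma>1 k1 us T T' \<and> spine_der d n2 \<Gamma>2 k2 vs T' L)" (is "?l us n \<Gamma> k T \<longleftrightarrow> ?r us n \<Gamma> k T")
proof (induction us arbitrary: n \<Gamma> k T)
  case Nil
  show ?case by simp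
next
  case (Cons u us)
  show ?case
  proof
    assume "?l (u # us) n \<Gamma> k T"
    then obtain n1 n2 \<Delta>1 \<Delta>2 k1 k2 M c T' where 1: "n = Suc (n1 + n2)" "\<Gamma> = \<Delta>1 + \<Delta>2"
      "k = k1 + k2 + mark c d" "T = Arr M c T'" "mder n1 \<Delta>1 k1 u M" "?l us n2 \<Delta>2 k2 T'" by auto
    from 1(6) obtain m1 m2 \<Gamma>1 \<Gamma>2 j1 j2 T'' where 2: "n2 = m1 + m2" "\<Delta>2 = \<Gamma>1 + \<Gamma>2" "k2 = j1 + j2"
      "spine_der d m1 \<Gamma>1 j1 us T' T''" "spine_der d m2 \<Gamma>2 j2 vs T'' L" unfolding Cons by blast
    have "spine_der d (Suc (n1 + m1)) (\<Delta>1 + \<Gamma>1) (k1 + j1 + mark c d) (u # us) T T''"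
      unfolding spine_der.simps using 1 2 by blast
    moreover have "n = Suc (n1 + m1) + m2" "\<Gamma> = (\<Delta>1 + \<Gamma>1) + \<Gamma>2" "k = (k1 + j1 + mark c d) + j2"
      using 1 2 by (simp_all add: ac_simps)
    ultimately show "?r (u # us) n \<Gamma> k T" using 2(5) by blast
  next
    assume "?r (u # us) n \<Gamma> k T"
    then obtain m1 m2 \<Gamma>1 \<Gamma>2 j1 j2 T'' where 2: "n = m1 + m2" "\<Gamma> = \<Gamma>1 + \<Gamma>2" "k = j1 + j2"
      "spine_der d m1 \<Gamma>1 j1 (u # us) T T''" "spine_der d m2 \<Gamma>2 j2 vs T'' L" by blast
    from 2(4) obtain n1 n2 \<Delta>1 \<Delta>2 k1 k2 M c T' where 1: "m1 = Suc (n1 + n2)" "\<Gamma>1 = \<Delta>1 + \<Delta>2"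
      "j1 = k1 + k2 + mark c d" "T = Arr M c T'" "mder n1 \<Delta>1 k1 u M" "spine_der d n2 \<Delta>2 k2 us T' T''" by auto
    have "?l us (n2 + m2) (\<Delta>2 + \<Gamma>2) (k2 + j2) T'" unfolding Cons using 1 2 by blast
    moreover have "n = Suc (n1 + (n2 + m2))" "\<Gamma> = \<Delta>1 + (\<Delta>2 + \<Gamma>2)" "k = k1 + (k2 + j2) + mark c d"
      using 1 2 by (simp_all add: ac_simps)
    ultimately show "?l (u # us) n \<Gamma> k T" unfolding append_Cons spine_der.simps using 1(4,5) by blast
  qed
qed

section \<open>Head normal forms of ordinary terms\<close>

lemma hnf_shape:
  assumes "hnf_of t h"
  obtains m y ts where "h = lams m (apps (Var y) ts)"
proof -
  have "head_normal h" using assms by (simp add: hnf_of_def)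
  then obtain cs us y where h: "h = head_plug cs us (Var y)" by (rule head_normal_shape)
  have "foldl (\<lambda>s (d, u). App d s u) s us = apps s (map snd us)" for s :: lam
    unfolding apps_appc by (induction us arbitrary: s) auto
  moreover have "foldr Lam cs s = lams (length cs) s" for s :: lam
    unfolding lams_lamc by (induction cs) (auto simp: fn)
  ultimately show ?thesis using that h unfolding head_plug_def by metis
qed

lemma hnf_spine_reds: "hnf_of t h \<Longrightarrow> \<exists>k. spine_reds k t h"
  unfolding hnf_of_def using head_red_spine_reds by blast

lemma hnf_spine_reds_black: "hnf_of t h \<Longrightarrow> spine_reds 0 (paint_black t) (paint_black h)"
  using hnf_spine_reds spine_reds_recolor[of _ t h Black] unfolding paint_black_def by blast

lemma der_hnf:
  assumes "der n \<Gamma> k (t :: lam) L"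
  shows "\<exists>h. hnf_of t h"
  using der_converges[OF assms] unfolding converges_def hnf_of_def by blast

lemma der_hnf_iff:
  assumes "hnf_of t h"
  shows "(\<exists>n k. der n \<Gamma> k t L) \<longleftrightarrow> (\<exists>n k. der n \<Gamma> k h L)"
proof -
  obtain j where "spine_reds j t h" using hnf_spine_reds[OF assms] by blast
  from der_spine_reds[OF this] show ?thesis by blast
qed

text \<open>Forgetting the colours of a derivation leaves one for the ordinary term.\<close>

lemma ty_black_hnf: "ty k (paint_black t) \<Longrightarrow> \<exists>h. hnf_of t h"
  unfolding ty_def using der_recolor(1)[of _ _ k "paint_black t" _ "()"] der_hnf recolor_paint_black by metis


section \<open>Boehm trees and type improvement\<close>

primrec lwhiten :: "polarity \<Rightarrow> nat \<Rightarrow> color ltype multiset list \<Rightarrow> color ltype multiset list \<Rightarrow> bool" where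
  "lwhiten p d [] Ms \<longleftrightarrow> d = 0 \<and> Ms = []"
| "lwhiten p d (N # Ns) Ms \<longleftrightarrow>
    (\<exists>M Ms' d1 d2. Ms = M # Ms' \<and> d = d1 + d2 \<and> mwhiten p d1 N M \<and> lwhiten p d2 Ns Ms')"

lemma env_whiten_ext:
  "length Ns = length Ms \<Longrightarrow> env_whiten p k (ext Ns \<Gamma>') (ext Ms \<Gamma>) \<longleftrightarrow>
    (\<exists>k1 k2. k = k1 + k2 \<and> lwhiten p k1 Ns Ms \<and> env_whiten p k2 \<Gamma>' \<Gamma>)"
proof (induction Ns Ms arbitrary: \<Gamma>' \<Gamma> k rule: list_induct2)
  case Nil
  show ?case by simp
next
  case (Cons N Ns M Ms)
  show ?case (is "?l \<longleftrightarrow> ?r")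
  proof
    assume ?l
    then obtain k1 k2 j1 j2 where "k = k1 + k2" "lwhiten p k1 Ns Ms" "k2 = j1 + j2" "mwhiten p j1 N M"
      "env_whiten p j2 \<Gamma>' \<Gamma>" unfolding ext_simps Cons.IH env_whiten_case_nat by blast
    moreover from this have "k = (j1 + k1) + j2" by simp
    ultimately show ?r unfolding lwhiten.simps by blast
  next
    assume ?r
    then obtain j1 k1 j2 where "k = (j1 + k1) + j2" "lwhiten p k1 Ns Ms" "mwhiten p j1 N M" "env_whiten p j2 \<Gamma>' \<Gamma>"
      unfolding lwhiten.simps by blast
    moreover from this have "k = k1 + (j1 + j2)" by simp
    ultimately show ?l unfolding ext_simps Cons.IH env_whiten_case_nat by blast
  qed
qed

lemma whiten_arrs:
  "lwhiten (opp p) c Ns Ms \<Longrightarrow> whiten p d L' L \<Longrightarrow> whiten p (c + d) (arrs b Ns L') (arrs b Ms L)"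
proof (induction Ns arbitrary: Ms c)
  case Nil
  then show ?case by simp
next
  case (Cons N Ns)
  then obtain M Ms' d1 d2 where *: "Ms = M # Ms'" "c = d1 + d2" "mwhiten (opp p) d1 N M" "lwhiten (opp p) d2 Ns Ms'"
    by auto
  from keep[OF *(3) Cons.IH[OF *(4) Cons.prems(2)], of b] show ?case by (simp add: * add.assoc)
qed

lemma upd_empty: "0(x := {#}) = (0 :: 'c env)"
  by (auto simp: fn fun_eq_iff)

lemma upd_add_mset: "0(x := add_mset L M) = 0(x := {#L#}) + (0(x := M) :: 'c env)"
  by (auto simp: fn fun_eq_iff)

lemma mder_Var: "mder n \<Gamma> k (Var x) M \<longleftrightarrow> n = 0 \<and> k = 0 \<and> \<Gamma> = 0(x := M)"
proof (induction M arbitrary: n \<Gamma> k)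
  case empty
  show ?case by (simp add: mder_empty upd_empty)
next
  case (add L M)
  show ?case by (auto simp: mder_add der_Var add upd_add_mset[of x L M])
qed

text \<open>The form in which an induction hypothesis on derivations is available for the arguments;
  the Boehm preorder, being coinductive, offers no induction of its own.\<close>

definition improves_below :: "nat \<Rightarrow> lam \<Rightarrow> lam \<Rightarrow> bool" where
  "improves_below n t u \<longleftrightarrow> (\<forall>m<n. \<forall>\<Gamma> k L. der m \<Gamma> k (paint_black t) L \<longrightarrow>
    (\<exists>n' \<Gamma>' L' k' e1 e2. der n' \<Gamma>' k' (paint_black u) L' \<and> env_whiten Neg e1 \<Gamma>' \<Gamma> \<and> whiten Pos e2 L' L \<and>
      k' + e1 + e2 \<le> k))"

lemma improves_below_mder:
  assumes "improves_below n t u"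
  shows "m < n \<Longrightarrow> mder m \<Gamma> k (paint_black t) M \<Longrightarrow>
    \<exists>n' \<Gamma>' M' k' e1 e2. mder n' \<Gamma>' k' (paint_black u) M' \<and> env_whiten Neg e1 \<Gamma>' \<Gamma> \<and> mwhiten Pos e2 M' M \<and>
      k' + e1 + e2 \<le> k"
proof (induction M arbitrary: m \<Gamma> k)
  case empty
  then have "\<Gamma> = 0" by (simp add: mder_empty)
  then show ?case by (metis dnil env_whiten_refl mwhiten_refl add_0 zero_le)
next
  case (add L M)
  from add.prems(2) obtain n1 n2 \<Gamma>1 \<Gamma>2 k1 k2 where 0: "m = n1 + n2" "\<Gamma> = \<Gamma>1 + \<Gamma>2" "k = k1 + k2"
    "der n1 \<Gamma>1 k1 (paint_black t) L" "mder n2 \<Gamma>2 k2 (paint_black t) M" by (auto simp: mder_add)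
  have "n1 < n" "n2 < n" using 0(1) add.prems(1) by auto
  with assms 0(4) obtain m1 \<Gamma>1' L' k1' a1 a2 where 1: "der m1 \<Gamma>1' k1' (paint_black u) L'"
    "env_whiten Neg a1 \<Gamma>1' \<Gamma>1" "whiten Pos a2 L' L" "k1' + a1 + a2 \<le> k1"
    unfolding improves_below_def by blast
  from add.IH[OF \<open>n2 < n\<close> 0(5)] obtain m2 \<Gamma>2' M' k2' b1 b2 where 2: "mder m2 \<Gamma>2' k2' (paint_black u) M'"
    "env_whiten Neg b1 \<Gamma>2' \<Gamma>2" "mwhiten Pos b2 M' M" "k2' + b1 + b2 \<le> k2" by blast
  have "mder (m1 + m2) (\<Gamma>1' + \<Gamma>2') (k1' + k2') (paint_black u) (add_mset L' M')" using 1(1) 2(1) by (rule dcons)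
  moreover have "env_whiten Neg (a1 + b1) (\<Gamma>1' + \<Gamma>2') \<Gamma>" unfolding 0 using 1(2) 2(2) by (rule env_whiten_plus)
  moreover have "mwhiten Pos (a2 + b2) (add_mset L' M') (add_mset L M)" using 1(3) 2(3) by (rule cons)
  moreover have "(k1' + k2') + (a1 + b1) + (a2 + b2) \<le> k" using 0(3) 1(4) 2(4) by simp
  ultimately show ?case by blast
qed

text \<open>Improving an argument whitens its multi type positively, hence the type of the head
  variable negatively, which is the polarity allowed in the environment. The whitening
  \<open>e\<close> of the result type is an input, so that the effect of later arguments can be
  carried up to the head; it is not charged again.\<close>

lemma spine_improves:
  "list_all2 (improves_below N) ts us \<Longrightarrow> m \<le> N \<Longrightarrow> spine_der Black m \<Gamma> k (map paint_black ts) T L \<Longrightarrow>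
    whiten Neg e L' L \<Longrightarrow>
    \<exists>n' \<Gamma>' k' T' e1 e2. spine_der Black n' \<Gamma>' k' (map paint_black us) T' L' \<and> env_whiten Neg e1 \<Gamma>' \<Gamma> \<and>
      whiten Neg (e + e2) T' T \<and> k' + e1 + e2 \<le> k"
proof (induction ts us arbitrary: m \<Gamma> k T rule: list_all2_induct)
  case Nil
  then have "\<Gamma> = 0" "T = L" by auto
  with Nil(3) show ?case
    by (intro exI[of _ 0] exI[of _ L'] exI[of _ "0 :: color env"]) (simp add: env_whiten_refl)
next
  case (Cons t ts u us)
  from Cons.prems(2) obtain n1 n2 \<Delta>1 \<Delta>2 k1 k2 M c T0 where 0: "m = Suc (n1 + n2)" "\<Gamma> = \<Delta>1 + \<Delta>2"
    "k = k1 + k2 + mark c Black" "T = Arr M c T0" "mder n1 \<Delta>1 k1 (paint_black t) M"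
    "spine_der Black n2 \<Delta>2 k2 (map paint_black ts) T0 L" by auto
  \<comment> \<open>The application rule of this argument makes its derivation strictly smaller than
    the bound.\<close>
  have "n1 < N" "n2 \<le> N" using 0(1) Cons.prems(1) by auto
  from improves_below_mder[OF Cons.hyps(1) \<open>n1 < N\<close> 0(5)] obtain m1 \<Gamma>1 M' k1' a1 a2 where
    1: "mder m1 \<Gamma>1 k1' (paint_black u) M'" "env_whiten Neg a1 \<Gamma>1 \<Delta>1" "mwhiten Pos a2 M' M" "k1' + a1 + a2 \<le> k1"
    by blast
  from Cons.IH[OF \<open>n2 \<le> N\<close> 0(6) Cons.prems(3)] obtain m2 \<Gamma>2 k2' T0' b1 b2 where
    2: "spine_der Black m2 \<Gamma>2 k2' (map paint_black us) T0' L'" "env_whiten Neg b1 \<Gamma>2 \<Delta>2"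
    "whiten Neg (e + b2) T0' T0" "k2' + b1 + b2 \<le> k2" by blast
  have "spine_der Black (Suc (m1 + m2)) (\<Gamma>1 + \<Gamma>2) (k1' + k2' + mark c Black) (map paint_black (u # us)) (Arr M' c T0') L'"
    using 1(1) 2(1) unfolding list.map spine_der.simps by blast
  moreover have "env_whiten Neg (a1 + b1) (\<Gamma>1 + \<Gamma>2) \<Gamma>" unfolding 0 using 1(2) 2(2) by (rule env_whiten_plus)
  moreover have "whiten Neg (a2 + (e + b2)) (Arr M' c T0') T" unfolding 0 using 1(3) 2(3) by (intro keep) auto
  then have "whiten Neg (e + (a2 + b2)) (Arr M' c T0') T" by (simp add: ac_simps)
  moreover have "(k1' + k2' + mark c Black) + (a1 + b1) + (a2 + b2) \<le> k" using 0(3) 1(4) 2(4) by simp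
  ultimately show ?case by blast
qed

lemma ext_Cons_zero: "ext (M # Ms) 0 = 0(length Ms := M) + (ext Ms 0 :: 'c env)"
  unfolding fun_eq_iff by (auto simp: ext_nth fn nth_Cons' simp del: ext_simps)

text \<open>
  The arguments that \<open>\<eta>\<close>-reduction removes: turning the arrows of the head variable, of arbitrary
  colours, into the black arrows of the removed abstractions costs exactly the interactions saved.
\<close>

lemma spine_improves_Var:
  "(\<And>j. j < length ts \<Longrightarrow> improves_below N (ts ! j) (Var (length ts - 1 - j))) \<Longrightarrow> m \<le> N \<Longrightarrow>
    spine_der Black m \<Gamma> k (map paint_black ts) T L \<Longrightarrow>
    \<exists>Ns T' e1 e2 e3. length Ns = length ts \<and> whiten Neg e2 T' T \<and> env_whiten Neg e1 (ext Ns 0) \<Gamma> \<and>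
      (\<forall>Ms d. lwhiten Neg d Ns Ms \<longrightarrow> whiten Pos (d + e3) T' (arrs Black Ms L)) \<and> e1 + e2 + e3 \<le> k"
proof (induction ts arbitrary: m \<Gamma> k T)
  case Nil
  then have G: "\<Gamma> = 0" "T = L" by auto
  show ?case unfolding G
    by (intro exI[of _ "[]"] exI[of _ 0] exI[of _ L]) (simp add: env_whiten_refl whiten_refl)
next
  case (Cons t ts)
  from Cons.prems(3) obtain n1 n2 \<Delta>1 \<Delta>2 k1 k2 M c T0 where 0: "m = Suc (n1 + n2)" "\<Gamma> = \<Delta>1 + \<Delta>2"
    "k = k1 + k2 + mark c Black" "T = Arr M c T0" "mder n1 \<Delta>1 k1 (paint_black t) M"
    "spine_der Black n2 \<Delta>2 k2 (map paint_black ts) T0 L" by auto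
  have n: "n1 < N" "n2 \<le> N" using 0(1) Cons.prems(2) by auto
  \<comment> \<open>The first removed argument belongs to the outermost removed binder, which has
    the largest index.\<close>
  have t: "improves_below N t (Var (length ts))" using Cons.prems(1)[of 0] by simp
  have ts: "improves_below N (ts ! j) (Var (length ts - 1 - j))" if "j < length ts" for j
    using Cons.prems(1)[of "Suc j"] that by simp
  from improves_below_mder[OF t n(1) 0(5)] obtain M' a1 a2 where
    1: "env_whiten Neg a1 (0(length ts := M')) \<Delta>1" "mwhiten Pos a2 M' M" "a1 + a2 \<le> k1"
    by (auto simp: mder_Var)
  from Cons.IH[OF ts n(2) 0(6)] obtain Ns T0' e1 e2 e3 where
    2: "length Ns = length ts" "whiten Neg e2 T0' T0" "env_whiten Neg e1 (ext Ns 0) \<Delta>2"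
    "e1 + e2 + e3 \<le> k2" and Pos: "\<And>Ms d. lwhiten Neg d Ns Ms \<Longrightarrow> whiten Pos (d + e3) T0' (arrs Black Ms L)"
    by auto
  have "length (M' # Ns) = length (t # ts)" using 2 by simp
  moreover have "whiten Neg (a2 + e2) (Arr M' c T0') T" unfolding 0 using 1(2) 2(2) by (intro keep) auto
  moreover have "env_whiten Neg (a1 + e1) (ext (M' # Ns) 0) \<Gamma>"
    unfolding ext_Cons_zero 0 2(1) using 1(1) 2(3) by (rule env_whiten_plus)
  moreover have "whiten Pos (d + (e3 + mark c Black)) (Arr M' c T0') (arrs Black Ms L)"
    if "lwhiten Neg d (M' # Ns) Ms" for Ms d
  proof -
    from that obtain M1 Ms' d1 d2 where *: "Ms = M1 # Ms'" "d = d1 + d2" "mwhiten Neg d1 M' M1" "lwhiten Neg d2 Ns Ms'"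
      by auto
    show ?thesis
    proof (cases c)
      case White
      from flip[OF *(3) Pos[OF *(4)]] show ?thesis by (simp add: * White mark_def ac_simps)
    next
      case Black
      from keep[of Pos d1 M' M1, OF _ Pos[OF *(4)]] *(3) show ?thesis by (simp add: * Black ac_simps)
    qed
  qed
  moreover have "(a1 + e1) + (a2 + e2) + (e3 + mark c Black) \<le> k" using 0(3) 1(3) 2(4) by simp
  ultimately show ?case by blast
qed

lemma inj_add: "inj (\<lambda>m. m + p :: nat)"
  by (simp add: inj_def)

lemma push_add: "push (\<lambda>m. m + p) \<Gamma> i = (if i < p then {#} else \<Gamma> (i - p))"
proof (cases "i < p")
  case True
  then have "i \<notin> range (\<lambda>m. m + p)" by auto
  then show ?thesis using True by (simp add: push_notin)
next
  case False
  then have "i = (i - p) + p" by simp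
  then show ?thesis using False push_app[OF inj_add, of p \<Gamma> "i - p"] by simp
qed

lemma push_add_ext: "push (\<lambda>m. m + length Ns) \<Gamma> + ext Ns 0 = (ext Ns \<Gamma> :: 'c env)"
  unfolding fun_eq_iff by (auto simp: fn push_add ext_nth)

text \<open>Each unfolding of the coinductive relation passes to arguments typed by proper
  subderivations, so the number of application rules bounds the depth explored, even inside an
  infinite eta-expansion.\<close>

lemma boehm_improves:
  "boehm_eta_red t u \<Longrightarrow> der m \<Gamma> k (paint_black t) L \<Longrightarrow>
    \<exists>n' \<Gamma>' L' k' e1 e2. der n' \<Gamma>' k' (paint_black u) L' \<and> env_whiten Neg e1 \<Gamma>' \<Gamma> \<and> whiten Pos e2 L' L \<and>
      k' + e1 + e2 \<le> k"
proof (induction m arbitrary: t u \<Gamma> k L rule: less_induct)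
  case (less m)
  have IH: "improves_below m t' u'" if "boehm_eta_red t' u'" for t' u'
    unfolding improves_below_def using less.IH that by blast
  from less.prems(1) show ?case
  proof (cases rule: boehm_eta_red.cases)
    case no_hnf
    then show ?thesis using less.prems(2) ty_black_hnf unfolding ty_def by blast
  next
    case (hnf n p y ts us)
    have "spine_reds 0 (paint_black t) (paint_black (lams (n + p) (apps (Var (y + p)) ts)))"
      using hnf(1) by (rule hnf_spine_reds_black)
    from der_spine_reds[OF this] less.prems(2) obtain m' l where "m = m' + l"
      "der m' \<Gamma> k (lamc Black (n + p) (appc Black (Var (y + p)) (map paint_black ts))) L"
      unfolding paint_black_lams paint_black_apps paint_black_simps by auto
    then have m': "m' \<le> m"
      "der m' \<Gamma> k (lamc Black (n + p) (appc Black (Var (y + p)) (map paint_black ts))) L" by simp_all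
    from m'(2) obtain Ms L0 where Ms: "length Ms = n + p" "L = arrs Black Ms L0"
      "der m' (ext Ms \<Gamma>) k (appc Black (Var (y + p)) (map paint_black ts)) L0" by (auto simp: der_lamc)
    define q where "q = length us"
    have "map paint_black ts = map paint_black (take q ts) @ map paint_black (drop q ts)"
      by (simp flip: map_append)
    with Ms(3) obtain \<Delta> T where D: "ext Ms \<Gamma> = 0(y + p := {#T#}) + \<Delta>"
      "spine_der Black m' \<Delta> k (map paint_black (take q ts) @ map paint_black (drop q ts)) T L0"
      unfolding der_appc_Var by auto
    from D(2) obtain m1 m2 \<Delta>1 \<Delta>2 k1 k2 T1 where S: "m' = m1 + m2" "\<Delta> = \<Delta>1 + \<Delta>2" "k = k1 + k2"
      "spine_der Black m1 \<Delta>1 k1 (map paint_black (take q ts)) T T1"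
      "spine_der Black m2 \<Delta>2 k2 (map paint_black (drop q ts)) T1 L0" unfolding spine_der_append by blast
    \<comment> \<open>The last \<open>p\<close> arguments come first: their answer changes the type
      \<open>T1\<close> left over by the retained arguments, and \<open>spine_improves\<close> then
      carries this change up to the head variable.\<close>
    have "improves_below m (drop q ts ! j) (Var (length (drop q ts) - 1 - j))" if "j < length (drop q ts)" for j
      using that hnf(3,5) by (intro IH) (auto simp: q_def)
    from spine_improves_Var[OF this _ S(5)] m'(1) S(1) obtain Ns T1' e1 e2 e3 where
      N: "length Ns = length (drop q ts)" "whiten Neg e2 T1' T1" "env_whiten Neg e1 (ext Ns 0) \<Delta>2"
      "e1 + e2 + e3 \<le> k2" and Pos: "\<And>Ms d. lwhiten Neg d Ns Ms \<Longrightarrow> whiten Pos (d + e3) T1' (arrs Black Ms L0)"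
      by auto
    have Np: "length Ns = p" using N(1) hnf(3) by (simp add: q_def)
    have "list_all2 (improves_below m) (take q ts) (map (ren (\<lambda>m. m + p)) us)"
      unfolding list_all2_conv_all_nth using hnf(3,4) by (auto simp: q_def intro: IH)
    from spine_improves[OF this _ S(4) N(2)] m'(1) S(1) obtain n1 \<Delta>1' k' T' a1 a2 where
      A: "spine_der Black n1 \<Delta>1' k' (map paint_black (map (ren (\<lambda>m. m + p)) us)) T' T1'" "env_whiten Neg a1 \<Delta>1' \<Delta>1"
      "whiten Neg (e2 + a2) T' T" "k' + a1 + a2 \<le> k1" by auto
    let ?body = "appc Black (Var y) (map paint_black us)"
    have meq: "map paint_black (map (ren (\<lambda>m. m + p)) us) = map (ren (\<lambda>m. m + p)) (map paint_black us)"
      by (simp add: paint_black_ren fn)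
    from A(1) have "der n1 (0(y + p := {#T'#}) + \<Delta>1') k' (ren (\<lambda>m. m + p) ?body) T1'"
      unfolding meq ren_appc ren.simps by (rule der_appc_VarI)
    \<comment> \<open>A typing of the shifted body gives no types to the removed binders; these
      receive types only through \<open>Ns\<close>.\<close>
    then obtain \<Gamma>u where u: "0(y + p := {#T'#}) + \<Delta>1' = push (\<lambda>m. m + p) \<Gamma>u" "der n1 \<Gamma>u k' ?body T1'"
      unfolding der_ren[OF inj_add] by blast
    have "env_whiten Neg ((e2 + a2) + (a1 + e1)) (0(y + p := {#T'#}) + (\<Delta>1' + ext Ns 0)) (ext Ms \<Gamma>)"
      unfolding D(1) S(2) using A(2,3) N(3) by (intro env_whiten_plus env_whiten_single mwhiten_single)
    moreover have "0(y + p := {#T'#}) + (\<Delta>1' + ext Ns 0) = ext Ns \<Gamma>u"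
      using push_add_ext[of Ns \<Gamma>u] unfolding Np u(1)[symmetric] add.assoc .
    moreover have "ext Ms \<Gamma> = ext (drop n Ms) (ext (take n Ms) \<Gamma>)" by (simp flip: ext_append)
    ultimately have "env_whiten Neg (e2 + a2 + (a1 + e1)) (ext Ns \<Gamma>u) (ext (drop n Ms) (ext (take n Ms) \<Gamma>))" by simp
    \<comment> \<open>The share \<open>d1\<close> concerns the removed binders. It leaves the
      environment and reappears, through \<open>Pos\<close>, as a whitening of the result
      type.\<close>
    then obtain d1 d2 where d: "e2 + a2 + (a1 + e1) = d1 + d2" "lwhiten Neg d1 Ns (drop n Ms)"
      "env_whiten Neg d2 \<Gamma>u (ext (take n Ms) \<Gamma>)"
      using env_whiten_ext[of Ns "drop n Ms"] Ms(1) Np by auto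
    obtain Ks \<Gamma>' where K: "length Ks = n" "\<Gamma>u = ext Ks \<Gamma>'" using ext_surj by blast
    with d(3) obtain c1 c2 where c: "d2 = c1 + c2" "lwhiten Neg c1 Ks (take n Ms)" "env_whiten Neg c2 \<Gamma>' \<Gamma>"
      using env_whiten_ext[of Ks "take n Ms"] Ms(1) by auto
    \<comment> \<open>For the retained binders, a negative whitening of the environment below them
      becomes a positive one of the type above them.\<close>
    have "whiten Pos (c1 + (d1 + e3)) (arrs Black Ks T1') (arrs Black (take n Ms) (arrs Black (drop n Ms) L0))"
      using c(2) Pos[OF d(2)] by (intro whiten_arrs) auto
    then have L': "whiten Pos (c1 + (d1 + e3)) (arrs Black Ks T1') L"
      unfolding Ms(2) by (simp flip: arrs_append)
    have "der n1 \<Gamma>' k' (paint_black (lams n (apps (Var y) us))) (arrs Black Ks T1')"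
      unfolding paint_black_lams paint_black_apps paint_black_simps der_lamc using K u(2) by auto
    then obtain n2 where "der n2 \<Gamma>' k' (paint_black u) (arrs Black Ks T1')"
      using der_spine_reds[OF hnf_spine_reds_black[OF hnf(2)]] by fastforce
    moreover have "k' + c2 + (c1 + (d1 + e3)) \<le> k" using c(1) d(1) A(4) N(4) S(3) by simp
    ultimately show ?thesis using L' c(3) by blast
  qed
qed

lemma boehm_pwc: "boehm_eta_red t u \<Longrightarrow> pwc t u"
  unfolding pwc_def pwc_checkers_iff typing_iff using boehm_improves by blast


section \<open>Boehm trees from the plain type preorder\<close>

text \<open>Identifies the type used by one occurrence of a variable: a fresh target tells it apart
  from all other types of that variable.\<close>

primrec target :: "'c ltype \<Rightarrow> nat" where
  "target (Atom a) = a"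
| "target (Arr M c L) = target L"

lemma target_arrs [simp]: "target (arrs c Ms L) = target L"
  by (induction Ms) auto

lemma arrs_eq_arrs_Atom:
  "arrs c Ms (Atom a) = arrs c Ns L \<Longrightarrow>
    length Ns \<le> length Ms \<and> Ns = take (length Ns) Ms \<and> L = arrs c (drop (length Ns) Ms) (Atom a)"
proof (induction Ns arbitrary: Ms)
  case Nil
  then show ?case by simp
next
  case (Cons N Ns)
  then show ?case by (cases Ms) auto
qed

lemma arrs_Atom_inject: "arrs c Ms (Atom a) = arrs c Ns (Atom a) \<longleftrightarrow> Ms = Ns"
proof
  assume eq: "arrs c Ms (Atom a) = arrs c Ns (Atom a)"
  from arrs_eq_arrs_Atom[OF eq] arrs_eq_arrs_Atom[OF eq[symmetric]] show "Ms = Ns" by auto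
qed simp

section \<open>Head types as probes for arguments\<close>

lemma spine_der_arrs:
  "spine_der () n \<Gamma> k us T L \<Longrightarrow> \<exists>Ns. length Ns = length us \<and> T = arrs () Ns L"
proof (induction us arbitrary: n \<Gamma> k T)
  case Nil
  then show ?case by simp
next
  case (Cons u us)
  then obtain M T' where "T = Arr M () T'" "\<exists>Ns. length Ns = length us \<and> T' = arrs () Ns L" by auto
  then obtain Ns where "length Ns = length us" "T = arrs () (M # Ns) L" by auto
  then show ?case by (intro exI[of _ "M # Ns"]) simp
qed

lemma spine_der_Cons_empty:
  "(\<exists>n k. spine_der d n \<Gamma> k (u # us) (Arr {#} c T) L) \<longleftrightarrow> (\<exists>n k. spine_der d n \<Gamma> k us T L)"
proof
  assume "\<exists>n k. spine_der d n \<Gamma> k us T L"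
  then obtain n k where "spine_der d n \<Gamma> k us T L" by blast
  then have "spine_der d (Suc (0 + n)) (0 + \<Gamma>) (0 + k + mark c d) (u # us) (Arr {#} c T) L"
    unfolding spine_der.simps using dnil by blast
  then show "\<exists>n k. spine_der d n \<Gamma> k (u # us) (Arr {#} c T) L" unfolding add_0 by blast
next
  assume "\<exists>n k. spine_der d n \<Gamma> k (u # us) (Arr {#} c T) L"
  then obtain n1 n2 \<Delta>1 \<Delta>2 k1 k2 where "\<Gamma> = \<Delta>1 + \<Delta>2" "mder n1 \<Delta>1 k1 u {#}" "spine_der d n2 \<Delta>2 k2 us T L"
    unfolding spine_der.simps by blast
  then show "\<exists>n k. spine_der d n \<Gamma> k us T L" unfolding mder_empty by auto
qed

lemma spine_der_none:
  "(\<exists>n k. spine_der d n \<Gamma> k us (arrs c (replicate (length us) {#}) L) L) \<longleftrightarrow> \<Gamma> = 0"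
proof (induction us arbitrary: \<Gamma>)
  case Nil
  show ?case by simp
next
  case (Cons u us)
  show ?case by (simp add: spine_der_Cons_empty Cons del: spine_der.simps)
qed

text \<open>Arguments of empty type add nothing to the environment, so such a head type works as a
  probe for a single argument.\<close>

lemma spine_der_one:
  "i < length us \<Longrightarrow>
    (\<exists>n k. spine_der d n \<Gamma> k us (arrs c ((replicate (length us) {#})[i := {#K#}]) L) L) \<longleftrightarrow> (\<exists>n k. der n \<Gamma> k (us ! i) K)"
proof (induction us arbitrary: \<Gamma> i)
  case Nil
  then show ?case by simp
next
  case (Cons u us)
  show ?case
  proof (cases i)
    case 0
    have "(\<exists>n k. spine_der d n \<Gamma> k (u # us) (Arr {#K#} c (arrs c (replicate (length us) {#}) L)) L) \<longleftrightarrow>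
      (\<exists>\<Delta>1 \<Delta>2. \<Gamma> = \<Delta>1 + \<Delta>2 \<and> (\<exists>n k. der n \<Delta>1 k u K) \<and>
        (\<exists>n k. spine_der d n \<Delta>2 k us (arrs c (replicate (length us) {#}) L) L))"
      by (simp add: mder_single) blast
    then show ?thesis using 0 by (simp add: spine_der_none)
  next
    case (Suc j)
    then show ?thesis using Cons by (simp add: spine_der_Cons_empty del: spine_der.simps)
  qed
qed

text \<open>The type given to \<open>t\<close> has exactly \<open>m\<close> arrows before an atom,
  so \<open>u\<close> has at most \<open>m\<close> binders, and the arrows they leave over must come
  from its spine. \<open>E\<close> is the environment below all binders of \<open>t\<close>; below
  the binders of \<open>u\<close> it is seen shifted by \<open>m - n\<close>.\<close>

lemma rel_le_hnf:
  assumes tu: "rel_le t u"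
    and t: "hnf_of t (lams m (apps (Var y) ts))" and u: "hnf_of u (lams n (apps (Var z) us))"
    and args: "spine_der () n0 \<Delta> k0 ts (arrs () Ns (Atom a)) (Atom a)"
    and E: "E = 0(y := {#arrs () Ns (Atom a)#}) + \<Delta>"
  obtains T \<Delta>' n1 k1 where "n \<le> m" "\<And>i. E (i + (m - n)) = (0(z := {#T#}) + \<Delta>') i"
    "spine_der () n1 \<Delta>' k1 us T (arrs () (map (\<lambda>j. E (m - n - 1 - j)) [0..<m - n]) (Atom a))"
proof -
  obtain Ms \<Gamma> where Ms: "length Ms = m" "E = ext Ms \<Gamma>" using ext_surj by blast
  have "der n0 \<Gamma> k0 (lams m (apps (Var y) ts)) (arrs () Ms (Atom a))"
    unfolding lams_lamc apps_appc Ms(1)[symmetric] using args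
    by (intro der_lamcI, unfold Ms(2)[symmetric] E) (rule der_appc_VarI)
  then have "\<exists>n k. der n \<Gamma> k t (arrs () Ms (Atom a))" unfolding der_hnf_iff[OF t] by blast
  then have "\<exists>n k. der n \<Gamma> k u (arrs () Ms (Atom a))"
    using tu unfolding rel_le_def rel_interp_def ptyping_iff by blast
  then obtain n1 k1 where "der n1 \<Gamma> k1 (lams n (apps (Var z) us)) (arrs () Ms (Atom a))"
    unfolding der_hnf_iff[OF u] by blast
  then obtain Ks L0 T \<Delta>' where K: "length Ks = n" "arrs () Ms (Atom a) = arrs () Ks L0"
    "ext Ks \<Gamma> = 0(z := {#T#}) + \<Delta>'" "spine_der () n1 \<Delta>' k1 us T L0"
    unfolding lams_lamc apps_appc der_lamc der_appc_Var by blast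
  from arrs_eq_arrs_Atom[OF K(2)] have 1: "n \<le> m" "Ks = take n Ms" "L0 = arrs () (drop n Ms) (Atom a)"
    using K(1) Ms(1) by auto
  have "E = ext (drop n Ms) (ext Ks \<Gamma>)" unfolding Ms(2) 1(2) by (simp flip: ext_append)
  then have E': "E i = (if i < m - n then drop n Ms ! (m - n - 1 - i) else ext Ks \<Gamma> (i - (m - n)))" for i
    using Ms(1) by (simp add: ext_nth[of "drop n Ms"])
  have "drop n Ms = map (\<lambda>j. E (m - n - 1 - j)) [0..<m - n]"
    using Ms(1) 1(1) by (intro nth_equalityI) (auto simp: E' intro: arg_cong[of _ _ "(!) Ms"])
  moreover have "E (i + (m - n)) = (0(z := {#T#}) + \<Delta>') i" for i using E'[of "i + (m - n)"] K(3) by simp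
  ultimately show ?thesis using that 1 K(4) by metis
qed

text \<open>With empty argument types, the environment of the body contains a single type, that of
  the head variable. Hence the heads coincide, and counting the arrows of this type compares the
  numbers of arguments.\<close>

lemma rel_le_hnf_shape:
  assumes "rel_le t u" "hnf_of t (lams m (apps (Var y) ts))" "hnf_of u (lams n (apps (Var z) us))"
  shows "n \<le> m \<and> y = z + (m - n) \<and> length ts = length us + (m - n)"
proof -
  let ?T = "arrs () (replicate (length ts) {#}) (Atom 0)"
  obtain n0 k0 where "spine_der () n0 0 k0 ts ?T (Atom 0)" 
    using spine_der_none[of "()" 0 ts "()" "Atom 0"] by blast
  from rel_le_hnf[OF assms this HOL.refl] obtain T \<Delta>' n1 k1 where 1: "n \<le> m"
    "\<And>i. (0(y := {#?T#}) + 0) (i + (m - n)) = (0(z := {#T#}) + \<Delta>') i"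
    "spine_der () n1 \<Delta>' k1 us T (arrs () (map (\<lambda>j. (0(y := {#?T#}) + 0) (m - n - 1 - j)) [0..<m - n]) (Atom 0))"
    by metis
  have "T \<in># (0(y := {#?T#})) (z + (m - n))" using 1(2)[of z] by (simp add: fn)
  then have yT: "y = z + (m - n)" "T = ?T" by (auto simp: fn split: if_splits)
  from spine_der_arrs[OF 1(3)] obtain Ns where Ns: "length Ns = length us"
    "T = arrs () Ns (arrs () (map (\<lambda>j. (0(y := {#?T#}) + 0) (m - n - 1 - j)) [0..<m - n]) (Atom 0))" by blast
  from Ns(2) have "replicate (length ts) {#} = Ns @ map (\<lambda>j. (0(y := {#?T#}) + 0) (m - n - 1 - j)) [0..<m - n]"
    unfolding yT(2) arrs_append[symmetric] arrs_Atom_inject .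
  from arg_cong[OF this, of length] show ?thesis using Ns(1) 1(1) yT(1) by simp
qed

text \<open>The probed argument may contain the head variable again, so that this variable has
  several types; the fresh atom tells which of them belongs to the head.\<close>

lemma rel_le_args:
  assumes tu: "rel_le t u" and t: "hnf_of t (lams (n + p) (apps (Var (z + p)) ts))"
    and u: "hnf_of u (lams n (apps (Var z) us))" and len: "length ts = length us + p" and i: "i < length ts"
  shows "rel_le (ts ! i) (if i < length us then ren (\<lambda>m. m + p) (us ! i) else Var (p - 1 - (i - length us)))"
proof -
  let ?u = "if i < length us then ren (\<lambda>m. m + p) (us ! i) else Var (p - 1 - (i - length us))"
  have "\<exists>n k. der n \<Delta> k ?u K" if d: "\<exists>n k. der n \<Delta> k (ts ! i) K" for \<Delta> K
  proof -
    obtain a where a: "a \<notin> target ` set_mset (\<Delta> (z + p))" using ex_new_if_finite[of "target ` set_mset (\<Delta> (z + p))"] by auto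
    define Ns where "Ns = (replicate (length ts) {#})[i := {#K#}]"
    define T0 where "T0 = arrs () Ns (Atom a)"
    define E where "E = 0(z + p := {#T0#}) + \<Delta>"
    have Elow: "E j = \<Delta> j" if "j < p" for j using that by (simp add: E_def fn)
    obtain n0 k0 where "spine_der () n0 \<Delta> k0 ts (arrs () Ns (Atom a)) (Atom a)"
      using d spine_der_one[OF i] unfolding Ns_def by blast
    from rel_le_hnf[OF tu t u this E_def[unfolded T0_def]] obtain T \<Delta>' n1 k1 where
      1: "\<And>j. E (j + p) = (0(z := {#T#}) + \<Delta>') j" "spine_der () n1 \<Delta>' k1 us T (arrs () (map (\<lambda>j. E (p - 1 - j)) [0..<p]) (Atom a))"
      by (metis add_diff_cancel_left')
    define D where "D = map (\<lambda>j. E (p - 1 - j)) [0..<p]"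
    from spine_der_arrs[OF 1(2)] obtain Ns' where Ns': "length Ns' = length us" "T = arrs () Ns' (arrs () D (Atom a))"
      unfolding D_def by blast
    have TT: "add_mset T0 (\<Delta> (z + p)) = add_mset T (\<Delta>' z)" using 1(1)[of z] by (simp add: E_def fn)
    \<comment> \<open>By freshness the head of \<open>u\<close> uses the type \<open>T0\<close> and
      none of those in \<open>\<Delta>\<close>.\<close>
    have "target T = a" using Ns'(2) by simp
    with a have "T \<notin># \<Delta> (z + p)" by auto
    then have T: "T = T0" using TT by (metis insert_iff set_mset_add_mset_insert)
    have Ds: "\<Delta>' j = \<Delta> (j + p)" for j
      using 1(1)[of j] unfolding T E_def by (auto simp: fn split: if_splits)
    \<comment> \<open>Two readings of the same head type: in \<open>u\<close> its first arguments
      type \<open>us\<close>, and its last \<open>p\<close> are the types of the removed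
      binders.\<close>
    have ND: "Ns = Ns' @ D" using Ns'(2) unfolding T T0_def arrs_append[symmetric] arrs_Atom_inject .
    have lD: "length D = p" by (simp add: D_def)
    have DD: "D ! j = \<Delta> (p - 1 - j)" if "j < p" for j using that by (simp add: D_def Elow)
    show ?thesis
    proof (cases "i < length us")
      case True
      \<comment> \<open>Probing a retained argument leaves the removed binders without types, and
        this puts \<open>\<Delta>\<close> into the image of the shift.\<close>
      have "D = drop (length us) Ns" using ND Ns'(1) by simp
      then have "D = replicate p {#}" using True len by (simp add: Ns_def drop_update_cancel)
      then have low: "\<Delta> j = {#}" if "j < p" for j using DD[of "p - 1 - j"] that by simp
      have "Ns' = take (length us) Ns" using ND Ns'(1) by simp
      then have "Ns' = (replicate (length us) {#})[i := {#K#}]" using len by (simp add: Ns_def take_update_swap)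
      with 1(2) Ns'(2) have "\<exists>n k. der n \<Delta>' k (us ! i) K"
        using spine_der_one[OF True, of "()" \<Delta>' "()" K "arrs () D (Atom a)"] unfolding D_def by blast
      moreover have "\<Delta> = push (\<lambda>m. m + p) \<Delta>'"
        unfolding fun_eq_iff by (auto simp: push_add low Ds)
      ultimately show ?thesis using True by (auto simp: der_ren[OF inj_add])
    next
      case False
      define j where "j = i - length us"
      have j: "j < p" "i = length us + j" using False i len by (auto simp: j_def)
      have "Ns' = take (length us) Ns" using ND Ns'(1) by simp
      then have "Ns' = replicate (length us) {#}" using len False by (simp add: Ns_def)
      \<comment> \<open>All retained arguments are probed with empty types, so
        \<open>\<Delta>\<close> can only type the removed binder at position \<open>j\<close>; this
        is the axiom for that variable.\<close>
      with 1(2) Ns'(2) have "\<Delta>' = 0" using spine_der_none[of "()" \<Delta>' us "()" "arrs () D (Atom a)"] unfolding D_def by blast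
      have "Ns ! (length us + l) = (if l = j then {#K#} else {#})" if "l < p" for l
        using that j len by (simp add: Ns_def nth_list_update)
      moreover have "D ! l = Ns ! (length us + l)" if "l < p" for l using ND Ns'(1) by (simp add: nth_append)
      ultimately have low: "\<Delta> (p - 1 - l) = (if l = j then {#K#} else {#})" if "l < p" for l
        using DD[OF that] that by simp
      have "\<Delta> x = (0(p - 1 - j := {#K#})) x" for x
      proof (cases "x < p")
        case True
        then show ?thesis using low[of "p - 1 - x"] j by (auto simp: fn)
      next
        case False
        then show ?thesis using Ds[of "x - p"] \<open>\<Delta>' = 0\<close> j by (auto simp: fn)
      qed
      then have "\<Delta> = 0(p - 1 - j := {#K#})" ..
      then show ?thesis using False by (auto simp: der_Var j_def)
    qed
  qed
  then show ?thesis unfolding rel_le_def rel_interp_def ptyping_iff by blast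
qed

lemma rel_le_boehm: "rel_le t u \<Longrightarrow> boehm_eta_red t u"
proof (coinduction arbitrary: t u)
  case boehm_eta_red
  show ?case
  proof (cases "\<exists>h. hnf_of t h")
    case False
    then show ?thesis by blast
  next
    case True
    then obtain m y ts where t: "hnf_of t (lams m (apps (Var y) ts))" using hnf_shape by metis
    obtain n0 k0 where "spine_der () n0 0 k0 ts (arrs () (replicate (length ts) {#}) (Atom 0)) (Atom 0)"
      using spine_der_none[of "()" 0 ts "()" "Atom 0"] by blast
    then have "der n0 (0(y := {#arrs () (replicate (length ts) {#}) (Atom 0)#}) + 0) k0 (apps (Var y) ts) (Atom 0)"
      (is "der _ ?E _ _ _") unfolding apps_appc by (rule der_appc_VarI)
    moreover obtain Ms and \<Gamma> :: "unit env" where "length Ms = m" "?E = ext Ms \<Gamma>"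
      using ext_surj by blast
    ultimately have "der n0 \<Gamma> k0 (lams m (apps (Var y) ts)) (arrs () Ms (Atom 0))"
      unfolding lams_lamc using der_lamcI by metis
    then have "\<exists>n k. der n \<Gamma> k u (arrs () Ms (Atom 0))"
      using der_hnf_iff[OF t] boehm_eta_red unfolding rel_le_def rel_interp_def ptyping_iff by blast
    then obtain n z us where u: "hnf_of u (lams n (apps (Var z) us))" using der_hnf hnf_shape by metis
    from rel_le_hnf_shape[OF boehm_eta_red t u] obtain p where p: "m = n + p" "y = z + p" "length ts = length us + p"
      by (metis add_diff_inverse_nat not_less)
    note args = rel_le_args[OF boehm_eta_red t[unfolded p(1,2)] u p(3)]
    have "rel_le (ts ! i) (ren (\<lambda>m. m + p) (us ! i))" if "i < length us" for i
      using args[of i] that p(3) by simp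
    moreover have "rel_le (ts ! (length us + j)) (Var (p - 1 - j))" if "j < p" for j
      using args[of "length us + j"] that p(3) by simp
    ultimately show ?thesis using t u p by blast
  qed
qed


section \<open>Boehm trees from interaction improvement\<close>

primrec cl :: "nat \<Rightarrow> 'c tm \<Rightarrow> bool" where
  "cl n (Var i) \<longleftrightarrow> i < n"
| "cl n (Lam c t) \<longleftrightarrow> cl (Suc n) t"
| "cl n (App d t u) \<longleftrightarrow> cl n t \<and> cl n u"

lemma cl_sub: "cl n t \<Longrightarrow> (\<And>i. i < n \<Longrightarrow> s i = Var i) \<Longrightarrow> sub s t = t"
proof (induction t arbitrary: n s)
  case (Lam c t)
  have "up s i = Var i" if "i < Suc n" for i using that Lam.prems(2) by (cases i) auto
  then show ?case using Lam.IH[of "Suc n" "up s"] Lam.prems(1) by simp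
qed auto

lemma cl_mono: "cl n t \<Longrightarrow> n \<le> m \<Longrightarrow> cl m t"
  by (induction t arbitrary: n m) fastforce+

lemma cl_lamc [simp]: "cl n (lamc c m t) \<longleftrightarrow> cl (n + m) t"
  by (induction m arbitrary: n) auto

lemma cl_appc [simp]: "cl n (appc d t us) \<longleftrightarrow> cl n t \<and> (\<forall>u \<in> set us. cl n u)"
  by (induction us arbitrary: t) auto

lemma sub_closed: "cl 0 t \<Longrightarrow> sub s t = t"
  using cl_sub by blast

lemma lamc_add: "lamc c (m + n) t = lamc c m (lamc c n t)"
  by (induction m) auto

lemma spine_reds_appc: "spine_reds k t t' \<Longrightarrow> spine_reds k (appc d t us) (appc d t' us)"
  by (induction us arbitrary: t t') (auto intro: spine_reds_App)

text \<open>The substitution is kept general to accumulate the arguments already consumed.\<close>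

lemma spine_reds_lamc:
  "length us = n \<Longrightarrow> spine_reds (n * mark c d) (appc d (sub s (lamc c n t)) us) (sub (ext us s) t)"
proof (induction us arbitrary: n s)
  case Nil
  then show ?case by (simp add: spine_reds_refl)
next
  case (Cons u us)
  then obtain m where n: "n = Suc m" "length us = m" by auto
  have "spine_step (mark c d) (App d (Lam c (sub (up s) (lamc c m t))) u) (sub (case_nat u s) (lamc c m t))"
    using spine_step_beta[of c d "sub (up s) (lamc c m t)" u] by (simp add: inst_sub_up)
  from spine_reds_trans[OF spine_reds_appc[OF spine_step_spine_reds[OF this]] Cons.IH[OF n(2)]] show ?case by (simp add: n)
qed

section \<open>Tuplers, selectors and other test terms\<close>

definition identity :: checkers where
  "identity = Lam White (Var 0)"

text \<open>Boehm's tupler, \<open>\<lambda>x1 ... xa z. z x1 ... xa\<close>. Being white, it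
  interacts with the black applications of the tested term but not with those of the test.\<close>

definition tup :: "nat \<Rightarrow> checkers" where
  "tup a = lamc White (Suc a) (appc White (Var 0) (map (\<lambda>j. Var (a - j)) [0..<a]))"

definition discard :: "nat \<Rightarrow> checkers" where
  "discard r = lamc White r identity"

text \<open>A successful test ends in the identity, which hands over to the next copy; thus runs are
  chained and each is charged in full.\<close>

primrec rep :: "nat \<Rightarrow> checkers \<Rightarrow> checkers" where
  "rep 0 t = identity"
| "rep (Suc n) t = App White t (rep n t)"

text \<open>The Boehm-out step into one argument. Positions count from the outermost binder, whence
  the index \<open>a - 1 - i\<close>.\<close>

definition select :: "nat \<Rightarrow> nat \<Rightarrow> checkers list \<Rightarrow> nat \<Rightarrow> checkers" where
  "select a i vs n = lamc White a (rep n (appc White (Var (a - 1 - i)) vs))"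

definition omega :: checkers where
  "omega = App White (Lam White (App White (Var 0) (Var 0))) (Lam White (App White (Var 0) (Var 0)))"

lemma closed_identity [simp]: "cl n identity"
  by (simp add: identity_def)

lemma closed_tup [simp]: "cl n (tup a)"
  unfolding tup_def cl_lamc by auto

lemma closed_discard [simp]: "cl n (discard r)"
  by (simp add: discard_def)

lemma closed_omega [simp]: "cl n omega"
  by (simp add: omega_def)

lemma cl_rep: "cl n t \<Longrightarrow> cl n (rep m t)"
  by (induction m) auto

lemma closed_select:
  assumes "i < a" "\<forall>v \<in> set vs. cl 0 v"
  shows "cl 0 (select a i vs n)"
proof -
  have "cl a v" if "v \<in> set vs" for v using assms(2) that cl_mono[of 0 v a] by simp
  then show ?thesis using assms(1) unfolding select_def by (auto intro!: cl_rep)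
qed

lemma sub_rep: "sub s (rep n t) = rep n (sub s t)"
  by (induction n) (auto intro: sub_closed)

lemma spine_reds_rep: "spine_reds k t identity \<Longrightarrow> spine_reds (n * k) (rep n t) identity"
proof (induction n)
  case 0
  show ?case by (simp add: spine_reds_refl)
next
  case (Suc n)
  have "spine_step 0 (App White identity (rep n t)) (rep n t)"
    using spine_step_beta[of White White "Var 0" "rep n t"] by (simp add: identity_def inst_def)
  from spine_reds_trans[OF spine_reds_App[OF Suc.prems] spine_reds_trans[OF spine_step_spine_reds[OF this] Suc.IH[OF Suc.prems]]]
  show ?case by simp
qed

lemma spine_reds_discard: "length us = r \<Longrightarrow> spine_reds 0 (appc White (discard r) us) identity"
  using spine_reds_lamc[of us r White White Var identity] by (simp add: discard_def sub_closed)

lemma spine_reds_select: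
  assumes "length us = a" "i < a" "\<forall>v \<in> set vs. cl 0 v"
  shows "spine_reds 0 (appc White (select a i vs n) us) (rep n (appc White (us ! i) vs))"
proof -
  have "map (sub (ext us Var)) vs = vs" using assms(3) by (intro map_idI) (simp add: sub_closed)
  then show ?thesis
    using spine_reds_lamc[of us a White White Var "rep n (appc White (Var (a - 1 - i)) vs)"] assms(1,2)
    by (simp add: select_def sub_rep sub_appc ext_nth)
qed

text \<open>Only the arguments stored by black applications interact with the tupler; the filler
  \<open>xs\<close>, applied in white, completes the arity for free.\<close>

lemma spine_reds_tup:
  assumes "length ts + length xs = a"
  shows "spine_reds (length ts) (appc White (appc Black (tup a) ts) (xs @ w # vs)) (appc White w (ts @ xs @ vs))"
proof -
  let ?b = "appc White (Var 0) (map (\<lambda>j. Var (a - j)) [0..<a])"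
  let ?r = "ext (ts @ xs @ [w]) Var"
  have tup: "tup a = sub Var (lamc White (length ts) (lamc White (Suc (length xs)) ?b))"
    using assms unfolding tup_def sub_Var lamc_add[symmetric] by simp
  have "spine_reds (length ts) (appc Black (tup a) ts) (sub (ext ts Var) (lamc White (Suc (length xs)) ?b))"
    using spine_reds_lamc[of ts "length ts" White Black Var "lamc White (Suc (length xs)) ?b"]
    unfolding tup by (simp add: mark_def)
  moreover have "spine_reds 0 (appc White (sub (ext ts Var) (lamc White (Suc (length xs)) ?b)) (xs @ [w])) (sub ?r ?b)"
    using spine_reds_lamc[of "xs @ [w]" "Suc (length xs)" White White "ext ts Var" ?b] by (simp add: ext_append)
  moreover have "map (sub ?r) (map (\<lambda>j. Var (a - j)) [0..<a]) = ts @ xs"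
    using assms by (intro nth_equalityI) (auto simp: ext_nth nth_append fn)
  then have "sub ?r ?b = appc White w (ts @ xs)"
    unfolding sub_appc by (simp add: ext_nth nth_append)
  ultimately have "spine_reds (length ts) (appc White (appc Black (tup a) ts) (xs @ [w])) (appc White w (ts @ xs))"
    using spine_reds_trans[OF spine_reds_appc] by fastforce
  from spine_reds_appc[OF this, of White vs] show ?thesis by (simp flip: appc_append)
qed

section \<open>Evaluating tests on head normal forms\<close>

lemma ty_appc_head: "ty k (appc d t us) \<Longrightarrow> \<exists>k. ty k t"
  unfolding ty_def der_appc by blast

lemma ty_sub: "ty k (sub s t) \<Longrightarrow> \<exists>k. ty k t"
  unfolding ty_def der_sub by blast

lemma ty_rep: "ty k (rep (Suc n) t) \<Longrightarrow> \<exists>k. ty k t"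
  using ty_appc_head[of k White t "[rep n t]"] by simp

lemma ty_identity: "ty 0 identity"
proof -
  have "der 0 (case_nat {#Atom 0#} 0) 0 (Var 0) (Atom 0)"
    unfolding case_nat_upd_0[symmetric] by (rule dvar)
  then have "der 0 0 0 identity (Arr {#Atom 0#} White (Atom 0))"
    unfolding identity_def by (rule dabs)
  then show ?thesis unfolding ty_def by (intro exI)
qed

text \<open>\<open>omega\<close> reduces to itself, while each step lowers the number of application
  rules by one.\<close>

lemma not_ty_omega: "\<not> ty k omega"
proof -
  have omega: "spine_step 0 omega omega"
    using spine_step_beta[of White White "App White (Var 0) (Var 0)" "Lam White (App White (Var 0) (Var 0))"]
    by (simp add: omega_def inst_def)
  have "\<not> der n \<Gamma> k omega L" for n \<Gamma> k and L
  proof (induction n arbitrary: k)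
    case 0
    show ?case using der_spine_step[OF omega, of 0 \<Gamma> k L] by blast
  next
    case (Suc n)
    then show ?case using der_spine_step[OF omega, of "Suc n" \<Gamma> k L] by blast
  qed
  then show ?thesis by (simp add: ty_def)
qed

text \<open>The cost counts the \<open>m\<close> black abstractions, each opened by a white
  application, and the black applications to \<open>ts\<close>, each meeting the white tupler. It
  does not depend on what the arguments are.\<close>

lemma hnf_eval:
  assumes t: "hnf_of t (lams m (apps (Var y) ts))" and as: "length as = m"
    and y: "ext as s y = tup a" and a: "length ts + length xs = a"
  shows "spine_reds (m + length ts) (appc White (sub s (paint_black t)) (as @ xs @ w # vs))
    (appc White w (map (\<lambda>t. sub (ext as s) (paint_black t)) ts @ xs @ vs))"
proof -
  let ?ts = "map (\<lambda>t. sub (ext as s) (paint_black t)) ts"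
  have "spine_reds 0 (sub s (paint_black t)) (sub s (lamc Black m (appc Black (Var y) (map paint_black ts))))"
    using spine_reds_sub[OF hnf_spine_reds_black[OF t]] by (simp add: paint_black_lams paint_black_apps)
  from spine_reds_trans[OF spine_reds_appc[OF this] spine_reds_lamc[OF as, of Black White s]]
  have "spine_reds m (appc White (sub s (paint_black t)) as) (appc Black (tup a) ?ts)"
    using y by (simp add: mark_def sub_appc comp_def)
  from spine_reds_trans[OF spine_reds_appc[OF this, of White "xs @ w # vs"] spine_reds_tup[of ?ts xs a w vs]]
  show ?thesis using a by (simp flip: appc_append)
qed

text \<open>
  The outcome of a test is the identity, so that tests can be chained: a head normal form that is
  reached by \<open>\<eta>\<close>-reduction is cheaper, and only repeating the test of an argument outweighs this.
\<close>

definition tests_bound :: "nat \<Rightarrow> lam \<Rightarrow> lam \<Rightarrow> bool" where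
  "tests_bound N t u \<longleftrightarrow> (\<forall>s vs k. (\<forall>i. \<exists>a \<ge> N. s i = tup a) \<longrightarrow> (\<forall>v \<in> set vs. cl 0 v) \<longrightarrow>
    spine_reds k (appc White (sub s (paint_black t)) vs) identity \<longrightarrow>
    (\<exists>j. ty j (appc White (sub s (paint_black u)) vs)) \<and>
    (\<forall>k'. spine_reds k' (appc White (sub s (paint_black u)) vs) identity \<longrightarrow> k' \<le> k))"

text \<open>The lower bound on arities is left open because passing to an argument raises it: the
  tupler of the head variable must have room for all its arguments.\<close>

definition bounded_tests :: "lam \<Rightarrow> lam \<Rightarrow> bool" where
  "bounded_tests t u \<longleftrightarrow> (\<exists>N. tests_bound N t u)"

lemma tests_boundD:
  assumes "tests_bound N t u" "\<And>i. \<exists>a \<ge> N. s i = tup a" "\<And>v. v \<in> set vs \<Longrightarrow> cl 0 v"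
    "spine_reds k (appc White (sub s (paint_black t)) vs) identity"
  shows "\<exists>j. ty j (appc White (sub s (paint_black u)) vs)"
    "\<And>k'. spine_reds k' (appc White (sub s (paint_black u)) vs) identity \<Longrightarrow> k' \<le> k"
  using assms unfolding tests_bound_def by blast+

text \<open>Replaces a substitution on all indices by finitely many arguments, as a context can
  supply only these.\<close>

lemma sub_fv_bound: "\<exists>r. \<forall>s s'. (\<forall>i<r. s i = s' i) \<longrightarrow> sub s t = sub s' t"
proof (induction t)
  case (Var x)
  show ?case by (rule exI[of _ "Suc x"]) simp
next
  case (Lam c t)
  then obtain r where r: "\<And>s s'. (\<forall>i<r. s i = s' i) \<Longrightarrow> sub s t = sub s' t" by blast
  have "sub (up s) t = sub (up s') t" if "\<forall>i<r. s i = s' i" for s s'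
  proof (rule r, intro allI impI)
    fix i
    assume "i < r"
    then show "up s i = up s' i" using that by (cases i) auto
  qed
  then show ?case by (intro exI[of _ r]) simp
next
  case (App d t u)
  then obtain r r' where "\<And>s s'. (\<forall>i<r. s i = s' i) \<Longrightarrow> sub s t = sub s' t"
    "\<And>s s'. (\<forall>i<r'. s i = s' i) \<Longrightarrow> sub s u = sub s' u" by blast
  then show ?case by (intro exI[of _ "max r r'"]) simp
qed

lemma plug_test:
  "\<exists>C. \<forall>t. plug C t = appc d (lamc c r t) as"
proof (induction as rule: rev_induct)
  case Nil
  have "plug ((CLam c ^^ r) Hole) t = lamc c r t" for t by (induction r) (auto simp: fn)
  then show ?case by auto
next
  case (snoc a as)
  then obtain C where "\<And>t. plug C t = appc d (lamc c r t) as" by blast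
  then show ?case by (intro exI[of _ "CAppL d C a"]) (simp add: appc_append)
qed

lemma int_imp_bounded_tests:
  assumes tu: "int_imp t u"
  shows "bounded_tests t u"
proof -
  have "(\<exists>j. ty j (appc White (sub s (paint_black u)) vs)) \<and>
      (\<forall>k'. spine_reds k' (appc White (sub s (paint_black u)) vs) identity \<longrightarrow> k' \<le> k)"
    if k: "spine_reds k (appc White (sub s (paint_black t)) vs) identity" for s vs k
  proof -
    obtain r1 r2 where r: "\<And>s s'. (\<forall>i<r1. s i = s' i) \<Longrightarrow> sub s (paint_black t) = sub s' (paint_black t)"
      "\<And>s s'. (\<forall>i<r2. s i = s' i) \<Longrightarrow> sub s (paint_black u) = sub s' (paint_black u)"
      using sub_fv_bound by metis
    define r where "r = max r1 r2"
    \<comment> \<open>The last entry lands at index 0, so the values are listed by descending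
      index.\<close>
    define as where "as = map s (rev [0..<r])"
    have as: "length as = r" "\<And>i. i < r \<Longrightarrow> ext as Var i = s i" by (auto simp: as_def ext_nth rev_nth)
    obtain C where C: "\<And>t. plug C t = appc White (lamc White r t) (as @ vs)" using plug_test by metis
    have red: "spine_reds 0 (plug C x) (appc White (sub (ext as Var) x) vs)" for x
      using spine_reds_appc[OF spine_reds_lamc[OF as(1), of White White Var x]] by (simp add: C appc_append)
    have t: "sub (ext as Var) (paint_black t) = sub s (paint_black t)"
      by (rule r(1)) (simp add: as r_def)
    have u: "sub (ext as Var) (paint_black u) = sub s (paint_black u)"
      by (rule r(2)) (simp add: as r_def)
    have "ty k (plug C (paint_black t))"
      using ty_spine_reds[OF spine_reds_trans[OF red k[folded t]]] ty_identity by simp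
    then obtain k1 where k1: "k1 \<le> k" "converges (plug C (paint_black t)) k1" using ty_converges by blast
    then obtain k2 where k2: "k2 \<le> k1" "converges (plug C (paint_black u)) k2" using tu unfolding int_imp_def by blast
    then have ty: "ty k2 (appc White (sub s (paint_black u)) vs)"
      using converges_ty ty_spine_reds[OF red] u by fastforce
    \<comment> \<open>A typing index is at least the cost of any reduction, so the index
      \<open>k2\<close> bounds \<open>k'\<close>.\<close>
    have "k' \<le> k" if "spine_reds k' (appc White (sub s (paint_black u)) vs) identity" for k'
      using ty ty_spine_reds[OF that] k1(1) k2(1) by fastforce
    with ty show ?thesis by blast
  qed
  then have "tests_bound 0 t u" unfolding tests_bound_def by blast
  then show ?thesis unfolding bounded_tests_def ..
qed

section \<open>Separating head normal forms by tests\<close>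

text \<open>A discarding term ignores the arguments, so some test succeeds on \<open>t\<close>
  whatever they are; typability of the same test on \<open>u\<close> descends to \<open>u\<close>
  itself.\<close>

lemma bounded_tests_hnf:
  assumes tu: "bounded_tests t u" and t: "hnf_of t (lams m (apps (Var y) ts))"
  shows "\<exists>h. hnf_of u h"
proof -
  obtain N where N: "tests_bound N t u"
    using tu unfolding bounded_tests_def by blast
  define a where "a = N + length ts"
  let ?s = "\<lambda>_ :: nat. tup a"
  let ?as = "replicate m (tup a)" and ?xs = "replicate N identity"
  have "spine_reds (m + length ts) (appc White (sub ?s (paint_black t)) (?as @ ?xs @ discard a # []))
    (appc White (discard a) (map (\<lambda>t. sub (ext ?as ?s) (paint_black t)) ts @ ?xs @ []))"
    by (rule hnf_eval[OF t, of _ _ a]) (auto simp: ext_nth a_def)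
  moreover have "spine_reds 0 (appc White (discard a) (map (\<lambda>t. sub (ext ?as ?s) (paint_black t)) ts @ ?xs @ [])) identity"
    by (rule spine_reds_discard) (simp add: a_def)
  ultimately have I: "spine_reds (m + length ts + 0) (appc White (sub ?s (paint_black t)) (?as @ ?xs @ discard a # [])) identity"
    by (rule spine_reds_trans)
  have "\<exists>b \<ge> N. tup a = tup b" by (rule exI[of _ a]) (simp add: a_def)
  moreover have "cl 0 v" if "v \<in> set (?as @ ?xs @ discard a # [])" for v
    using that by (auto split: if_splits)
  ultimately obtain j where "ty j (appc White (sub ?s (paint_black u)) (?as @ ?xs @ discard a # []))"
    using tests_boundD(1)[OF N _ _ I] by blast
  from ty_appc_head[OF this] obtain j where "ty j (sub ?s (paint_black u))" ..
  from ty_sub[OF this] obtain j where "ty j (paint_black u)" ..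
  then show ?thesis by (rule ty_black_hnf)
qed

text \<open>
  The integer \<open>y - m\<close> names the head variable \<open>y\<close> below \<open>m\<close> binders: a nonnegative one is a free
  index, and \<open>- 1 - j\<close> is the variable of the \<open>j\<close>-th binder. The function \<open>\<alpha>\<close> assigns to each
  name the arity of its tupler; \<open>m + \<alpha> (y - m) - k\<close> is then the position of the argument that the
  tupler calls when it already has \<open>k\<close> arguments.
\<close>

lemma hnf_eval_arity:
  fixes \<alpha> :: "int \<Rightarrow> nat"
  assumes t: "hnf_of t (lams m (apps (Var y) ts))"
    and as: "\<And>j. j < m \<Longrightarrow> as ! j = tup (\<alpha> (- 1 - int j))"
    and \<alpha>: "length ts \<le> \<alpha> (int y - int m)"
    and q: "q = m + (\<alpha> (int y - int m) - length ts)" and len: "q < length as"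
  shows "\<exists>us. length us = \<alpha> (int y - int m) + (length as - 1 - q) \<and>
    spine_reds (m + length ts) (appc White (sub (\<lambda>i. tup (\<alpha> (int i))) (paint_black t)) as) (appc White (as ! q) us)"
proof -
  let ?s = "\<lambda>i. tup (\<alpha> (int i))"
  define xs where "xs = drop m (take q as)"
  have split: "as = take m as @ xs @ as ! q # drop (Suc q) as"
  proof -
    have "take m as @ xs = take q as"
      unfolding xs_def using q append_take_drop_id[of m "take q as"] by (simp add: min_def)
    then show ?thesis using id_take_nth_drop[OF len] by (metis append_assoc)
  qed
  have y: "ext (take m as) ?s y = tup (\<alpha> (int y - int m))"
  proof (cases "y < m")
    case True
    then have "- 1 - int (m - Suc y) = int y - int m" by simp
    then show ?thesis using True as[of "m - Suc y"] q len by (simp add: ext_nth)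
  next
    case False
    then show ?thesis using q len by (simp add: ext_nth of_nat_diff)
  qed
  have "length (take m as) = m" "length ts + length xs = \<alpha> (int y - int m)"
    using \<alpha> q len by (auto simp: xs_def)
  from hnf_eval[OF t this(1) y this(2), of "as ! q" "drop (Suc q) as"] split
  have "spine_reds (m + length ts) (appc White (sub ?s (paint_black t)) as)
    (appc White (as ! q) (map (\<lambda>t. sub (ext (take m as) ?s) (paint_black t)) ts @ xs @ drop (Suc q) as))" by simp
  moreover have "length (map (\<lambda>t. sub (ext (take m as) ?s) (paint_black t)) ts @ xs @ drop (Suc q) as) =
    \<alpha> (int y - int m) + (length as - 1 - q)" using \<alpha> q len by (simp add: xs_def)
  ultimately show ?thesis by blast
qed

text \<open>Which entry of the argument list gets called depends on the numbers of binders and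
  arguments and on the arity of the head's tupler. Varying the arities thus determines the name of
  the head and the difference of binders and arguments. Convergence leaves the direction of eta
  open; the costs decide it.\<close>

lemma bounded_tests_shape:
  assumes tu: "bounded_tests t u" and t: "hnf_of t (lams m (apps (Var y) ts))"
    and u: "hnf_of u (lams n (apps (Var z) us))"
  shows "n \<le> m \<and> y = z + (m - n) \<and> length ts = length us + (m - n)"
proof -
  obtain N where N: "tests_bound N t u"
    using tu unfolding bounded_tests_def by blast
  define b where "b = N + m + n + length ts + length us"
  define y' where "y' = int y - int m"
  define z' where "z' = int z - int n"
  \<comment> \<open>If the called positions differed, a discarding term at the one of
    \<open>t\<close> would make \<open>t\<close> succeed, while \<open>omega\<close> at the other
    makes \<open>u\<close> untypable.\<close>
  have same_position: "m + (\<alpha> y' - length ts) = n + (\<alpha> z' - length us)" if \<alpha>: "\<And>i. b \<le> \<alpha> i" for \<alpha>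
  proof (rule ccontr)
    define q where "q = m + (\<alpha> y' - length ts)"
    define r where "r = n + (\<alpha> z' - length us)"
    assume "m + (\<alpha> y' - length ts) \<noteq> n + (\<alpha> z' - length us)"
    then have qr: "q \<noteq> r" by (simp add: q_def r_def)
    have ge: "m \<le> q" "n \<le> q" "m \<le> r" "n \<le> r" "length ts \<le> \<alpha> y'" "length us \<le> \<alpha> z'"
      using \<alpha>[of y'] \<alpha>[of z'] by (auto simp: q_def r_def b_def)
    define l where "l = max q r"
    \<comment> \<open>The discarding term must also absorb the \<open>l - q\<close> entries behind
      it. The entries for the binders remain tuplers, since \<open>q\<close> and \<open>r\<close>
      lie beyond them.\<close>
    define as where "as = map (\<lambda>j. if j = r then omega else if j = q then discard (\<alpha> y' + (l - q))
      else tup (\<alpha> (- 1 - int j))) [0..<Suc l]"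
    have len: "length as = Suc l" "q < length as" "r < length as" by (auto simp: as_def l_def simp del: upt_Suc)
    have nth: "as ! j = (if j = r then omega else if j = q then discard (\<alpha> y' + (l - q))
      else tup (\<alpha> (- 1 - int j)))" if "j \<le> l" for j
      using that by (simp add: as_def del: upt_Suc)
    have tups: "as ! j = tup (\<alpha> (- 1 - int j))" if "j < m \<or> j < n" for j
      using that ge nth[of j] by (auto simp: l_def)
    have q: "as ! q = discard (\<alpha> y' + (l - q))" and r: "as ! r = omega"
      using nth[of q] nth[of r] qr by (auto simp: l_def)
    from hnf_eval_arity[OF t tups ge(5)[unfolded y'_def] q_def[unfolded y'_def] len(2)] q len(1)
    obtain vs where vs: "length vs = \<alpha> y' + (l - q)"
      "spine_reds (m + length ts) (appc White (sub (\<lambda>i. tup (\<alpha> (int i))) (paint_black t)) as) (appc White (discard (\<alpha> y' + (l - q))) vs)"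
      by (auto simp: y'_def)
    note I = spine_reds_trans[OF vs(2) spine_reds_discard[OF vs(1)]]
    have "\<exists>a \<ge> N. tup (\<alpha> (int i)) = tup a" for i
      using \<alpha>[of "int i"] by (intro exI[of _ "\<alpha> (int i)"]) (simp add: b_def)
    moreover have "cl 0 v" if "v \<in> set as" for v using that by (auto simp: as_def)
    ultimately obtain j where j: "ty j (appc White (sub (\<lambda>i. tup (\<alpha> (int i))) (paint_black u)) as)"
      using tests_boundD(1)[OF N _ _ I] by blast
    from hnf_eval_arity[OF u tups ge(6)[unfolded z'_def] r_def[unfolded z'_def] len(3)] r
    obtain ws where "spine_reds (n + length us) (appc White (sub (\<lambda>i. tup (\<alpha> (int i))) (paint_black u)) as) (appc White omega ws)"
      by auto
    from ty_spine_reds[OF this] j obtain j where "ty j (appc White omega ws)" by blast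
    from ty_appc_head[OF this] show False using not_ty_omega by blast
  qed
  have ge: "length ts \<le> b" "length us \<le> b" by (auto simp: b_def)
  have eq1: "m + (b - length ts) = n + (b - length us)" using same_position[of "\<lambda>_. b"] by simp
  \<comment> \<open>Raising the arity of the name \<open>y'\<close> alone moves the position called
    by \<open>t\<close> but not the one called by \<open>u\<close>, if the names differ.\<close>
  have yz: "y' = z'"
  proof (rule ccontr)
    assume "y' \<noteq> z'"
    have "b \<le> (if i = y' then Suc b else b)" for i by simp
    from same_position[of "\<lambda>i. if i = y' then Suc b else b", OF this] show False using \<open>y' \<noteq> z'\<close> eq1 ge by simp
  qed
  define q where "q = m + (b - length ts)"
  define as where "as = replicate q (tup b) @ [discard b]"
  have as: "as ! j = tup b" if "j < m \<or> j < n" for j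
    using that eq1 by (auto simp: as_def q_def nth_append)
  have q: "q < length as" "as ! q = discard b" "length as - 1 - q = 0" by (auto simp: as_def nth_append)
  have "\<exists>vs. length vs = b + (length as - 1 - q) \<and>
    spine_reds (m + length ts) (appc White (sub (\<lambda>i. tup b) (paint_black t)) as) (appc White (as ! q) vs)"
    by (rule hnf_eval_arity[where \<alpha> = "\<lambda>_. b", OF t _ ge(1) q_def q(1)]) (simp add: as)
  then obtain vs where "length vs = b" "spine_reds (m + length ts) (appc White (sub (\<lambda>i. tup b) (paint_black t)) as) (appc White (discard b) vs)"
    unfolding q(2,3) by auto
  then have I1: "spine_reds (m + length ts) (appc White (sub (\<lambda>i. tup b) (paint_black t)) as) identity"
    using spine_reds_trans[OF _ spine_reds_discard] by fastforce
  have "\<exists>ws. length ws = b + (length as - 1 - q) \<and>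
    spine_reds (n + length us) (appc White (sub (\<lambda>i. tup b) (paint_black u)) as) (appc White (as ! q) ws)"
    by (rule hnf_eval_arity[where \<alpha> = "\<lambda>_. b", OF u _ ge(2) q_def[unfolded eq1] q(1)]) (simp add: as)
  then obtain ws where "length ws = b" "spine_reds (n + length us) (appc White (sub (\<lambda>i. tup b) (paint_black u)) as) (appc White (discard b) ws)"
    unfolding q(2,3) by auto
  then have I2: "spine_reds (n + length us) (appc White (sub (\<lambda>i. tup b) (paint_black u)) as) identity"
    using spine_reds_trans[OF _ spine_reds_discard] by fastforce
  have "\<exists>a \<ge> N. tup b = tup a" by (rule exI[of _ b]) (simp add: b_def)
  moreover have "cl 0 v" if "v \<in> set as" for v using that by (auto simp: as_def)
  \<comment> \<open>Binders and arguments differ by the same amount in both terms, so the comparison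
    of their sums yields the sign of that amount.\<close>
  ultimately have "n + length us \<le> m + length ts" using tests_boundD(2)[OF N _ _ I1 I2] by blast
  then show ?thesis using eq1 ge yz by (auto simp: y'_def z'_def)
qed

text \<open>A test for an argument becomes a test for the whole term by selecting that argument.
  Since \<open>t\<close> spends more than \<open>u\<close> on the way, one run of the test could
  hide an excess of \<open>u\<close>; enough repetitions cannot.\<close>

lemma bounded_tests_args:
  assumes tu: "bounded_tests t u" and t: "hnf_of t (lams (n + p) (apps (Var (z + p)) ts))"
    and u: "hnf_of u (lams n (apps (Var z) us))" and len: "length ts = length us + p" and i: "i < length ts"
  shows "bounded_tests (ts ! i) (if i < length us then ren (\<lambda>m. m + p) (us ! i) else Var (p - 1 - (i - length us)))"
    (is "bounded_tests _ ?u")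
proof -
  obtain N where N: "tests_bound N t u"
    using tu unfolding bounded_tests_def by blast
  have "(\<exists>j. ty j (appc White (sub s (paint_black ?u)) vs)) \<and>
      (\<forall>k'. spine_reds k' (appc White (sub s (paint_black ?u)) vs) identity \<longrightarrow> k' \<le> k)"
    if s: "\<forall>i. \<exists>a \<ge> N + length ts. s i = tup a" and vs: "\<forall>v \<in> set vs. cl 0 v"
      and k: "spine_reds k (appc White (sub s (paint_black (ts ! i))) vs) identity" for s vs k
  proof -
    define m where "m = n + p"
    \<comment> \<open>A substitution for the arguments of \<open>t\<close> splits into the values
      fed to its \<open>m\<close> binders and a substitution \<open>s0\<close> for the free
      variables.\<close>
    define as where "as = map (\<lambda>j. s (m - 1 - j)) [0..<m]"
    define s0 where "s0 = (\<lambda>i. s (i + m))"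
    have las: "length as = m" by (simp add: as_def)
    have ext: "ext as s0 = s" unfolding fun_eq_iff by (auto simp: ext_nth as_def s0_def)
    obtain a where a: "N + length ts \<le> a" "s (z + p) = tup a" using s by blast
    define xs where "xs = replicate (a - length ts) identity"
    \<comment> \<open>Up to the selection, \<open>t\<close> pays for \<open>p\<close> binders and
      \<open>p\<close> arguments more than \<open>u\<close>. One interaction too many in each run of
      \<open>u\<close> then exceeds this advantage of \<open>2 * p\<close>.\<close>
    define M where "M = Suc (2 * p)"
    define w where "w = select a i vs M"
    let ?A = "as @ xs @ w # []"
    have la: "length ts + length xs = a" using a by (simp add: xs_def)
    have ia: "i < a" using i a by simp
    let ?ts = "map (\<lambda>t. sub s (paint_black t)) ts @ xs @ []"
    have t1: "spine_reds (m + length ts) (appc White (sub s0 (paint_black t)) ?A) (appc White w ?ts)"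
      using hnf_eval[OF t las[unfolded m_def] _ la, of s0 w "[]"] ext a(2) by (simp add: m_def)
    have t2: "spine_reds 0 (appc White w ?ts) (rep M (appc White (sub s (paint_black (ts ! i))) vs))"
      using spine_reds_select[of ?ts a i vs M] la ia vs i by (simp add: w_def nth_append)
    have T: "spine_reds (m + length ts + (0 + M * k)) (appc White (sub s0 (paint_black t)) ?A) identity"
      using spine_reds_trans[OF t1 spine_reds_trans[OF t2 spine_reds_rep[OF k]]] .
    have tups: "\<exists>a \<ge> N. s0 i = tup a" for i using s unfolding s0_def by (meson add_leE)
    have closed_s: "cl 0 (s i)" for i using s by (metis closed_tup)
    have closed_A: "cl 0 v" if "v \<in> set ?A" for v
      using that closed_s closed_select[OF ia vs] by (auto simp: as_def xs_def w_def)
    have extu: "ext (take n as) s0 = (\<lambda>i. s (i + p))"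
    proof
      fix x
      show "ext (take n as) s0 x = s (x + p)"
        using las by (auto simp: ext_nth as_def s0_def m_def ac_simps intro: arg_cong[of _ _ s])
    qed
    \<comment> \<open>The last \<open>p\<close> entries of \<open>as\<close> find no binder in
      \<open>u\<close> and line up behind its own arguments, as the images of the removed bound
      variables.\<close>
    let ?us = "map (\<lambda>t. sub (\<lambda>i. s (i + p)) (paint_black t)) us @ (drop n as @ xs) @ []"
    have lu: "length us + length (drop n as @ xs) = a" using la len las by (simp add: m_def)
    have u0: "spine_reds (n + length us) (appc White (sub s0 (paint_black u)) (take n as @ (drop n as @ xs) @ w # [])) (appc White w ?us)"
      using hnf_eval[OF u _ _ lu, of "take n as" s0 w "[]"] extu a(2) las by (simp add: m_def)
    have "take n as @ (drop n as @ xs) @ w # [] = ?A" by (simp flip: append_assoc)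
    note u1 = u0[unfolded this]
    have "?us ! i = sub s (paint_black ?u)"
    proof (cases "i < length us")
      case True
      then show ?thesis by (simp add: nth_append paint_black_ren sub_ren comp_def)
    next
      case False
      define j where "j = i - length us"
      have j: "j < p" "i = length us + j" using False i len by (auto simp: j_def)
      then show ?thesis using las by (simp add: nth_append as_def m_def)
    qed
    then have u2: "spine_reds 0 (appc White w ?us) (rep M (appc White (sub s (paint_black ?u)) vs))"
      using spine_reds_select[of ?us a i vs M] lu ia vs by (simp add: w_def)
    note u12 = spine_reds_trans[OF u1 u2]
    have "\<exists>j. ty j (appc White (sub s (paint_black ?u)) vs)"
      using tests_boundD(1)[OF N tups closed_A T] ty_spine_reds[OF u12] ty_rep unfolding M_def by blast
    moreover have "k' \<le> k" if "spine_reds k' (appc White (sub s (paint_black ?u)) vs) identity" for k'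
    proof (rule ccontr)
      assume "\<not> k' \<le> k"
      then have "M * Suc k \<le> M * k'" by (intro mult_le_mono) auto
      moreover have "n + length us + 0 + M * k' \<le> m + length ts + (0 + M * k)"
        by (rule tests_boundD(2)[OF N tups closed_A T spine_reds_trans[OF u12 spine_reds_rep[OF that]]])
      ultimately show False using len by (simp add: m_def M_def)
    qed
    ultimately show ?thesis by blast
  qed
  then have "tests_bound (N + length ts) (ts ! i) ?u" unfolding tests_bound_def by blast
  then show ?thesis unfolding bounded_tests_def ..
qed

lemma bounded_tests_boehm: "bounded_tests t u \<Longrightarrow> boehm_eta_red t u"
proof (coinduction arbitrary: t u)
  case boehm_eta_red
  show ?case
  proof (cases "\<exists>h. hnf_of t h")
    case False
    then show ?thesis by blast
  next
    case True
    then obtain m y ts where t: "hnf_of t (lams m (apps (Var y) ts))" using hnf_shape by metis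
    obtain n z us where u: "hnf_of u (lams n (apps (Var z) us))"
      using bounded_tests_hnf[OF boehm_eta_red t] hnf_shape by metis
    from bounded_tests_shape[OF boehm_eta_red t u] obtain p where
      p: "m = n + p" "y = z + p" "length ts = length us + p"
      by (metis add_diff_inverse_nat not_less)
    note args = bounded_tests_args[OF boehm_eta_red t[unfolded p(1,2)] u p(3)]
    have "bounded_tests (ts ! i) (ren (\<lambda>m. m + p) (us ! i))" if "i < length us" for i
      using args[of i] that p(3) by simp
    moreover have "bounded_tests (ts ! (length us + j)) (Var (p - 1 - j))" if "j < p" for j
      using args[of "length us + j"] that p(3) by simp
    ultimately show ?thesis using t u p by blast
  qed
qed

theorem theorem5:
  fixes t u :: lam
  shows "(boehm_eta_red t u \<longleftrightarrow> pwc t u) \<and> (pwc t u \<longleftrightarrow> int_imp t u) \<and> (int_imp t u \<longleftrightarrow> rel_le t u)"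
  using boehm_pwc pwc_int_imp pwc_rel_le rel_le_boehm int_imp_bounded_tests bounded_tests_boehm by blast

end
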